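(* Let $n\in\mathbb{N}\cup\{0\}$, $\tau\in(0,+\infty)$, $x_0\in\mathbb{R}^d$, $p\in[2,+\infty)$, $\alpha\in(0,1]$, and let $f:[0,(n+1)\tau]\times\mathbb{R}^d\times\mathbb{R}^d\to\mathbb{R}^d$ satisfy the following assumptions: (A1) $f(t,\cdot,\cdot)\in C(\mathbb{R}^d\times\mathbb{R}^d;\mathbb{R}^d)$ for all $t\in[0,(n+1)\tau]$; (A2) $f(\cdot,x,z)$ is Borel measurable for all $(x,z)\in\mathbb{R}^d\times\mathbb{R}^d$; (A3') there exist $\bar K,L:[0,(n+1)\tau]\to[0,+\infty)$ with $\bar K,L\in L^p([0,(n+1)\tau])$ such that for all $t\in[0,(n+1)\tau]$ $$\|f(t,0,0)\|\le\bar K(t),$$ and for all $t\in[0,(n+1)\tau]$, $x_1,x_2,z_1,z_2\in\mathbb{R}^d$ $$\|f(t,x_1,z_1)-f(t,x_2,z_2)\|\le L(t)\bigl(\|x_1-x_2\|+\|z_1-z_2\|^{\alpha}\bigr).$$ Let $x$ be the solution of the delay differential equation $$x'(t)=f(t,x(t),x(t-\tau)),\quad t\in[0,(n+1)\tau],\qquad x(t)=x_0,\quad t\in[-\tau,0),$$ and for $N\in\mathbb{N}$ let $h=\tau/N$, $t_i^j=j\tau+ih$, and let $y_i^j$ ($0\le i\le N$, $0\le j\le n$) be the output of the randomized Euler scheme with discretization parameter $N$. Then there exist $C_0,C_1,\ldots,C_n\in(0,+\infty)$ such that for all $N\ge\lceil\tau\rceil$ and $j=0,1,\ldots,n$ $$\Bigl\|\max_{0\le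 i\le N}\|x(t_i^j)-y_i^j\|\Bigr\|_{L^p(\Omega)}\le C_j\,h^{\frac12\alpha^j}.$$ In particular, if $\alpha=1$ then for $j=0,1,\ldots,n$ $$\Bigl\|\max_{0\le i\le N}\|x(t_i^j)-y_i^j\|\Bigr\|_{L^p(\Omega)}\le C_j\,h^{1/2}.$$
   Context: $\|\cdot\|$ is the Euclidean norm on $\mathbb{R}^d$. $(\Omega,\Sigma,\mathbb{P})$ is a complete probability space, and for a real random variable $X$, $\|X\|_{L^p(\Omega)}=(\mathbb{E}|X|^p)^{1/p}$. Solution: the unique absolutely continuous function $x:[-\tau,(n+1)\tau]\to\mathbb{R}^d$ with $x(t)=x_0$ for $t\in[-\tau,0]$ and $x'(t)=f(t,x(t),x(t-\tau))$ for almost every $t\in[0,(n+1)\tau]$ (it exists and is unique under the stated assumptions). Randomized Euler scheme: let $\{\gamma_k^j\}_{j\in\mathbb{N}_0,k\in\mathbb{N}}$ be i.i.d. random variables on $(\Omega,\Sigma,\mathbb{P})$, each uniformly distributed on $[0,1]$. For $N\in\mathbb{N}$ put $h=\tau/N$, $t_k^j=j\tau+kh$ for $k=0,\ldots,N$, $j=0,\ldots,n$, and $\theta_{k+1}^j=t_k^j+h\gamma_{k+1}^j$. Set $y_0^{-1}=\cdots=y_N^{-1}=x_0$, and for $j=0,1,\ldots,n$, $k=0,1,\ldots,N-1$ $$y_0^j=y_N^{j-1},\qquad y_{k+1}^j=y_k^j+h\,f(\theta_{k+1}^j,y_k^j,y_k^{j-1}).$$ The $y_k^j$ depend on $N$;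 the constants $C_0,\ldots,C_n$ do not. *)

theory Defs
  imports "HOL-Probability.Probability"
begin

definition absolutely_continuous_on :: "real set \<Rightarrow> (real \<Rightarrow> 'a::real_normed_vector) \<Rightarrow> bool" where
  "absolutely_continuous_on S x \<longleftrightarrow>
     (\<forall>\<epsilon>>0. \<exists>\<delta>>0. \<forall>(m::nat) u v.
        (\<forall>i<m. u i \<le> v i \<and> {u i..v i} \<subseteq> S) \<and>
        disjoint_family_on (\<lambda>i. {u i<..<v i}) {..<m} \<and>
        (\<Sum>i<m. v i - u i) < \<delta>
        \<longrightarrow> (\<Sum>i<m. norm (x (v i) - x (u i))) < \<epsilon>)"

definition in_Lp :: "'a measure \<Rightarrow> real \<Rightarrow> ('a \<Rightarrow> real) \<Rightarrow> bool" where
  "in_Lp M p g \<longleftrightarrow> g \<in> borel_measurable M \<and> integrable M (\<lambda>\<omega>. \<bar>g \<omega>\<bar> powr p)"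

text \<open>The Bochner integral of a non-integrable function is 0, so a bound on
  \<open>Lp_norm M p g\<close> is meaningful only together with \<open>in_Lp M p g\<close>.\<close>

definition Lp_norm :: "'a measure \<Rightarrow> real \<Rightarrow> ('a \<Rightarrow> real) \<Rightarrow> real" where
  "Lp_norm M p g = (\<integral>\<omega>. \<bar>g \<omega>\<bar> powr p \<partial>M) powr (1 / p)"

text \<open>The right-hand side \<open>f\<close> is a total function in HOL; only its values at times in
  \<open>[0, (n+1)\<tau>]\<close> are constrained or relevant.\<close>

definition dde_solution ::
  "(real \<Rightarrow> 'a::euclidean_space \<Rightarrow> 'a \<Rightarrow> 'a) \<Rightarrow> real \<Rightarrow> nat \<Rightarrow> 'a \<Rightarrow> (real \<Rightarrow> 'a) \<Rightarrow> bool" where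
  "dde_solution f \<tau> n x\<^sub>0 x \<longleftrightarrow>
     absolutely_continuous_on {-\<tau>..real (n + 1) * \<tau>} x \<and>
     (\<forall>t\<in>{-\<tau>..0}. x t = x\<^sub>0) \<and>
     (AE t in lebesgue_on {0..real (n + 1) * \<tau>}.
        (x has_vector_derivative f t (x t) (x (t - \<tau>))) (at t))"

definition grid_time :: "real \<Rightarrow> nat \<Rightarrow> nat \<Rightarrow> nat \<Rightarrow> real" where
  "grid_time \<tau> N j k = real j * \<tau> + real k * (\<tau> / real N)"

text \<open>\<open>rand_euler f \<tau> x\<^sub>0 N g j k\<close> is \<open>y\<^sub>k\<^sup>j\<close> for the realization \<open>g\<close> of the random variables,
  \<open>g j k\<close> being the value of \<open>\<gamma>\<^sub>k\<^sup>j\<close>. The row \<open>j = -1\<close>, constantly \<open>x\<^sub>0\<close>, is inlined into the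
  equations for \<open>j = 0\<close>. Only the values with \<open>k \<le> N\<close> belong to the scheme.\<close>

fun rand_euler ::
  "(real \<Rightarrow> 'a::real_vector \<Rightarrow> 'a \<Rightarrow> 'a) \<Rightarrow> real \<Rightarrow> 'a \<Rightarrow> nat \<Rightarrow> (nat \<Rightarrow> nat \<Rightarrow> real) \<Rightarrow> nat \<Rightarrow> nat \<Rightarrow> 'a"
where
  "rand_euler f \<tau> x\<^sub>0 N g 0 0 = x\<^sub>0"
| "rand_euler f \<tau> x\<^sub>0 N g (Suc j) 0 = rand_euler f \<tau> x\<^sub>0 N g j N"
| "rand_euler f \<tau> x\<^sub>0 N g 0 (Suc k) =
     rand_euler f \<tau> x\<^sub>0 N g 0 k +
     (\<tau> / real N) *\<^sub>R
       f (grid_time \<tau> N 0 k + \<tau> / real N * g 0 (Suc k)) (rand_euler f \<tau> x\<^sub>0 N g 0 k) x\<^sub>0"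
| "rand_euler f \<tau> x\<^sub>0 N g (Suc j) (Suc k) =
     rand_euler f \<tau> x\<^sub>0 N g (Suc j) k +
     (\<tau> / real N) *\<^sub>R
       f (grid_time \<tau> N (Suc j) k + \<tau> / real N * g (Suc j) (Suc k))
         (rand_euler f \<tau> x\<^sub>0 N g (Suc j) k) (rand_euler f \<tau> x\<^sub>0 N g j k)"

definition max_grid_error ::
  "(real \<Rightarrow> 'a::real_normed_vector \<Rightarrow> 'a \<Rightarrow> 'a) \<Rightarrow> real \<Rightarrow> 'a \<Rightarrow> (real \<Rightarrow> 'a) \<Rightarrow>
     nat \<Rightarrow> nat \<Rightarrow> (nat \<Rightarrow> nat \<Rightarrow> real) \<Rightarrow> real" where
  "max_grid_error f \<tau> x\<^sub>0 x N j g =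
     (MAX i\<in>{0..N}. norm (x (grid_time \<tau> N j i) - rand_euler f \<tau> x\<^sub>0 N g j i))"

end

(*
The global error on a row splits as
  e_k = e_0 + sum_{i<k} (increment of x minus its randomized quadrature) + h sum_{i<k} drift_i.
The quadrature errors are independent and centred, so the maximum of their partial sums has L^p norm
O(h^(1/2)). The drift at step i is bounded by L(theta) times (|e_i| + error of the delayed argument), and
L(theta) is independent of the second factor. Hence p-th moments obey a Gronwall recursion whose
weights are the integrals of L(t)^p over the grid cells, although exp(h sum L(theta_i)) need not be integrable.
The delayed error enters with power alpha, which yields the exponent alpha^j / 2 by induction on rows.
*)
theory Submission
  imports Defs
begin

text \<open>Order 1/2 has two sources: the noise, and the displacement of x between a grid point and
  the random point, which is O(sqrt h) because x' is square integrable; this is where p >= 2 enters.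
  For the noise no conditional expectation is used. A second order expansion of |a + b|^p and a
  pathwise Doob inequality leave only terms of the form (function of the past) times (next summand),
  and independence makes their means vanish. Moments are carried as \<open>nn_integral\<close>s in
  \<open>ennreal\<close>: Gronwall runs before any moment of the scheme is known to be finite, and
  finiteness is a result of it. The bounds \<open>K\<close> and \<open>L\<close> are merely Lebesgue
  measurable and \<open>f\<close> is unconstrained outside the time interval. The estimates are
  therefore made for a modified right-hand side with Borel bounds at all real times; almost surely
  the scheme does not see the modification, and completeness of the probability space carries
  measurability back.\<close>

section \<open>Elementary inequalities for powers\<close>

text \<open>The tangent of the convex function t^p at b, evaluated at a: p a b^(p-1) <= a^p + (p-1)
  b^p. Taken at a mean it gives the power-mean and Jensen inequalities, taken at the previous
  running maximum it gives Doob's.\<close>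

lemma powr_tangent_le:
  fixes a b p :: real
  assumes "1 \<le> p" "0 \<le> a" "0 \<le> b"
  shows "a * b powr (p - 1) \<le> a powr p / p + (1 - 1 / p) * b powr p"
proof (cases "p = 1")
  case True
  then show ?thesis using assms by (auto simp: powr_def)
next
  case False
  define q where "q = p / (p - 1)"
  have p1: "p > 1" using False assms by simp
  have "a * b powr (p - 1) \<le> a powr p / p + (b powr (p - 1)) powr q / q"
    by (rule Youngs_inequality) (use p1 assms in \<open>auto simp: q_def field_simps\<close>)
  also have "(b powr (p - 1)) powr q = b powr p" using p1 by (simp add: powr_powr q_def)
  also have "b powr p / q = (1 - 1 / p) * b powr p" using p1 by (simp add: q_def field_simps)
  finally show ?thesis .
qed

text \<open>Power-mean inequality: summing the tangent inequality at the mean \<open>m\<close>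
  bounds c m^p by (1 - 1/p) c m^p plus the wanted sum over p.\<close>

lemma powr_sum_le:
  fixes a :: "'i \<Rightarrow> real"
  assumes p: "1 \<le> p" and fin: "finite A" and a: "\<And>i. i \<in> A \<Longrightarrow> 0 \<le> a i"
  shows "(\<Sum>i\<in>A. a i) powr p \<le> real (card A) powr (p - 1) * (\<Sum>i\<in>A. a i powr p)"
proof (cases "A = {}")
  case False
  define c where "c = real (card A)"
  have c: "c > 0" using False fin by (simp add: c_def card_gt_0_iff)
  define m where "m = (\<Sum>i\<in>A. a i) / c"
  have m: "m \<ge> 0" using c a by (simp add: m_def sum_nonneg)
  have "c * m powr p = (\<Sum>i\<in>A. a i) * m powr (p - 1)"
  proof (cases "m = 0")
    case True then show ?thesis using p by simp
  next
    case False
    then have "m powr p = m * m powr (p - 1)" using m by (simp add: powr_diff)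
    then show ?thesis using c by (simp add: m_def)
  qed
  also have "\<dots> = (\<Sum>i\<in>A. a i * m powr (p - 1))" by (simp add: sum_distrib_right)
  also have "\<dots> \<le> (\<Sum>i\<in>A. a i powr p / p + (1 - 1 / p) * m powr p)"
    by (intro sum_mono powr_tangent_le) (use a m p in auto)
  also have "\<dots> = (\<Sum>i\<in>A. a i powr p) / p + c * (1 - 1 / p) * m powr p"
    by (simp add: sum.distrib sum_divide_distrib c_def)
  finally have "c * m powr p / p \<le> (\<Sum>i\<in>A. a i powr p) / p"
    by (simp add: field_simps)
  then have 1: "c * m powr p \<le> (\<Sum>i\<in>A. a i powr p)" using p by (simp add: divide_le_cancel)
  have "(\<Sum>i\<in>A. a i) powr p = (c * m) powr p" using c by (simp add: m_def)
  also have "\<dots> = c powr (p - 1) * (c * m powr p)"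
    using c m by (simp add: powr_mult powr_diff)
  also have "\<dots> \<le> c powr (p - 1) * (\<Sum>i\<in>A. a i powr p)"
    using 1 by (intro mult_left_mono) auto
  finally show ?thesis by (simp add: c_def)
qed (use p in simp)

lemma powr_add_le:
  fixes a b :: real
  assumes "1 \<le> p" "0 \<le> a" "0 \<le> b"
  shows "(a + b) powr p \<le> 2 powr (p - 1) * (a powr p + b powr p)"
  using powr_sum_le[of p "UNIV :: bool set" "\<lambda>i. if i then a else b"] assms
  by (simp add: UNIV_bool add.commute)

lemma powr_add3_le:
  fixes a b c :: real
  assumes "1 \<le> p" "0 \<le> a" "0 \<le> b" "0 \<le> c"
  shows "(a + b + c) powr p \<le> 3 powr (p - 1) * (a powr p + b powr p + c powr p)"
  using powr_sum_le[of p "{0..<3::nat}" "\<lambda>i. if i = 0 then a else if i = 1 then b else c"] assms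
  by (simp add: numeral_3_eq_3)

text \<open>After division by a + b both fractions lie in [0,1], where t <= t^\<alpha>.\<close>

lemma powr_add_le_add_powr:
  fixes a b :: real
  assumes "0 < \<alpha>" "\<alpha> \<le> 1" "0 \<le> a" "0 \<le> b"
  shows "(a + b) powr \<alpha> \<le> a powr \<alpha> + b powr \<alpha>"
proof (cases "a + b = 0")
  case False
  then have s: "a + b > 0" using assms by simp
  have *: "c / (a + b) \<le> (c / (a + b)) powr \<alpha>" if "0 \<le> c" "c \<le> a + b" for c
    using powr_mono'[of \<alpha> 1 "c / (a + b)"] that s assms by (auto simp: divide_le_eq)
  have "1 = a / (a + b) + b / (a + b)" using s by (simp add: add_divide_distrib[symmetric])
  also have "\<dots> \<le> (a / (a + b)) powr \<alpha> + (b / (a + b)) powr \<alpha>"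
    using *[of a] *[of b] assms by simp
  also have "\<dots> = (a powr \<alpha> + b powr \<alpha>) / (a + b) powr \<alpha>"
    using assms s by (simp add: powr_divide add_divide_distrib)
  finally show ?thesis using s by (simp add: field_simps)
qed (use assms in \<open>auto simp: add_nonneg_eq_0_iff\<close>)

text \<open>Affine upper bound of the concave power at scale c. Integrated with c of the size of the
  moment of z, it has the effect of Jensen's inequality, up to a constant, for an
  \<open>nn_integral\<close>.\<close>

lemma powr_le_one_plus:
  fixes z c \<alpha> :: real
  assumes "0 \<le> \<alpha>" "\<alpha> \<le> 1" "0 < c" "0 \<le> z"
  shows "z powr \<alpha> \<le> c powr \<alpha> * (1 + z / c)"
proof -
  have "(z / c) powr \<alpha> \<le> 1 + z / c"
  proof (cases "z / c \<le> 1")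
    case True
    then have "(z / c) powr \<alpha> \<le> 1" using assms by (intro powr_le1) auto
    then show ?thesis using assms by (simp add: add_increasing2)
  next
    case False
    then have "(z / c) powr \<alpha> \<le> (z / c) powr 1" using assms by (intro powr_mono) auto
    then show ?thesis using False assms by simp
  qed
  then have "c powr \<alpha> * (z / c) powr \<alpha> \<le> c powr \<alpha> * (1 + z / c)" by (intro mult_left_mono) auto
  then show ?thesis using assms by (simp add: powr_divide)
qed

text \<open>Young's inequality with a free weight, by cases on which of c b^2 and a^2 is larger. The
  weight c = N later makes the first term affordable over N steps, at the price N^(p/2 - 1) for the
  second.\<close>

lemma powr_weighted_le:
  fixes a b c p :: real
  assumes "2 \<le> p" "0 < c" "0 \<le> a" "0 \<le> b"
  shows "a powr (p - 2) * b\<^sup>2 \<le> a powr p / c + c powr (p / 2 - 1) * b powr p"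
proof (cases "c * b\<^sup>2 \<le> a\<^sup>2")
  case True
  have "a powr (p - 2) * b\<^sup>2 \<le> a powr (p - 2) * (a\<^sup>2 / c)"
    using True assms by (intro mult_left_mono) (auto simp: field_simps)
  also have "\<dots> = a powr p / c"
    using assms by (cases "a = 0") (auto simp: powr_diff power2_eq_square powr_numeral)
  finally show ?thesis using assms by (simp add: add_increasing2)
next
  case False
  then have b: "b > 0" using assms by (cases "b = 0") auto
  have "a\<^sup>2 \<le> (sqrt c * b)\<^sup>2" using False assms by (simp add: power_mult_distrib)
  then have "a \<le> sqrt c * b" using assms by (simp add: abs_le_square_iff[symmetric])
  then have "a powr (p - 2) \<le> (sqrt c * b) powr (p - 2)" using assms by (intro powr_mono2) auto
  also have "\<dots> = c powr (p / 2 - 1) * b powr (p - 2)"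
    using assms by (simp add: powr_mult powr_half_sqrt[symmetric] powr_powr diff_divide_distrib)
  finally have "a powr (p - 2) * b\<^sup>2 \<le> c powr (p / 2 - 1) * b powr (p - 2) * b\<^sup>2"
    by (intro mult_right_mono) auto
  also have "b powr (p - 2) * b\<^sup>2 = b powr p" using b by (simp add: powr_diff)
  then have "c powr (p / 2 - 1) * b powr (p - 2) * b\<^sup>2 = c powr (p / 2 - 1) * b powr p" 
    by (simp add: mult.assoc)
  finally show ?thesis using assms by (simp add: add_increasing)
qed

text \<open>Second order Taylor bound, from two applications of the mean value theorem; |t| <= 1/2
  keeps all bases positive and below 2.\<close>

lemma one_plus_powr_le:
  fixes p t :: real
  assumes p: "2 \<le> p" and t: "\<bar>t\<bar> \<le> 1/2"
  shows "(1 + t) powr p \<le> 1 + p * t + p\<^sup>2 * 2 powr p * t\<^sup>2"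
proof -
  have D: "((\<lambda>s. (1 + s) powr q) has_real_derivative q * (1 + s) powr (q - 1)) (at s)"
    if "\<bar>s\<bar> \<le> 1/2" for q s :: real
    using that by (auto intro!: derivative_eq_intros simp: powr_diff)
  \<comment> \<open>The intermediate point is recorded with modulus at most |s|, so that the mean
    value theorem applies again between 0 and it.\<close>
  have MV: "\<exists>\<xi>. \<bar>\<xi>\<bar> \<le> \<bar>s\<bar> \<and> 0 \<le> s * \<xi> \<and> (1 + s) powr q - 1 = s * (q * (1 + \<xi>) powr (q - 1))"
    if s: "\<bar>s\<bar> \<le> 1/2" for q s :: real
  proof (cases s "0 :: real" rule: linorder_cases)
    case less
    obtain z where "s < z" "z < 0" "(1 + 0) powr q - (1 + s) powr q = (0 - s) * (q * (1 + z) powr (q - 1))"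
      using MVT2[of s 0 "\<lambda>s. (1 + s) powr q" "\<lambda>s. q * (1 + s) powr (q - 1)"] D less s by auto
    then show ?thesis by (intro exI[of _ z]) (auto simp: mult_nonpos_nonpos)
  next
    case greater
    obtain z where "0 < z" "z < s" "(1 + s) powr q - (1 + 0) powr q = (s - 0) * (q * (1 + z) powr (q - 1))"
      using MVT2[of 0 s "\<lambda>s. (1 + s) powr q" "\<lambda>s. q * (1 + s) powr (q - 1)"] D greater s by auto
    then show ?thesis by (intro exI[of _ z]) auto
  qed auto
  obtain \<xi> where x: "\<bar>\<xi>\<bar> \<le> \<bar>t\<bar>" "0 \<le> t * \<xi>" "(1 + t) powr p - 1 = t * (p * (1 + \<xi>) powr (p - 1))"
    using MV[OF t] by blast
  obtain \<eta> where y: "\<bar>\<eta>\<bar> \<le> \<bar>\<xi>\<bar>" "(1 + \<xi>) powr (p - 1) - 1 = \<xi> * ((p - 1) * (1 + \<eta>) powr (p - 2))"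
    using MV[of \<xi> "p - 1"] x t by force
  have "(1 + t) powr p = 1 + p * t + p * t * ((1 + \<xi>) powr (p - 1) - 1)"
    using x by (simp add: algebra_simps)
  also have "p * t * ((1 + \<xi>) powr (p - 1) - 1) = (t * \<xi>) * (p * (p - 1) * (1 + \<eta>) powr (p - 2))"
    using y by simp
  also have "\<dots> \<le> t\<^sup>2 * (p\<^sup>2 * 2 powr p)"
  proof (intro mult_mono)
    have "t * \<xi> \<le> \<bar>t\<bar> * \<bar>\<xi>\<bar>" by (metis abs_ge_self abs_mult)
    also have "\<dots> \<le> \<bar>t\<bar> * \<bar>t\<bar>" using x(1) by (intro mult_left_mono) auto
    finally show "t * \<xi> \<le> t\<^sup>2" by (simp add: power2_eq_square)
    show "p * (p - 1) \<le> p\<^sup>2" using p by (simp add: power2_eq_square)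
    have "(1 + \<eta>) powr (p - 2) \<le> 2 powr (p - 2)"
      using x y t p by (intro powr_mono2) auto
    also have "\<dots> \<le> 2 powr p" by (intro powr_mono) auto
    finally show "(1 + \<eta>) powr (p - 2) \<le> 2 powr p" .
  qed (use p x in auto)
  finally show ?thesis by (simp add: mult.commute mult.left_commute)
qed

text \<open>The first summand is the Taylor remainder for |b| <= |a|/2. The others cover |a| <=
  2|b|, where |a + b| <= 3|b| and the linear term is at most p 2^p |b|^p.\<close>

definition smooth_const :: "real \<Rightarrow> real" where
  "smooth_const p = p\<^sup>2 * 2 powr p + 3 powr p + p * 2 powr p"

lemma smooth_const_pos: "2 \<le> p \<Longrightarrow> 0 < smooth_const p"
  by (auto simp: smooth_const_def intro!: add_nonneg_pos add_pos_nonneg)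

text \<open>Expansion of |.|^p around a with its derivative p |a|^(p-1) sgn a. The linear term
  averages out for centred b independent of a; the remainder is quadratic in b or of size
  |b|^p.\<close>

lemma abs_add_powr_le:
  fixes a b p :: real
  assumes p: "2 \<le> p"
  shows "\<bar>a + b\<bar> powr p \<le> \<bar>a\<bar> powr p + p * (\<bar>a\<bar> powr (p - 1) * sgn a) * b
           + smooth_const p * (\<bar>a\<bar> powr (p - 2) * b\<^sup>2 + \<bar>b\<bar> powr p)"
proof (cases "\<bar>b\<bar> \<le> \<bar>a\<bar> / 2 \<and> a \<noteq> 0")
  case True
  define t where "t = b / a"
  have t: "\<bar>t\<bar> \<le> 1/2" using True by (simp add: t_def abs_divide divide_le_eq)
  have b: "b = a * t" using True by (simp add: t_def)
  have "\<bar>a + b\<bar> = \<bar>a\<bar> * \<bar>1 + t\<bar>" unfolding b abs_mult[symmetric] by (simp add: algebra_simps)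
  also have "\<bar>1 + t\<bar> = 1 + t" using t by auto
  finally have "\<bar>a + b\<bar> powr p = \<bar>a\<bar> powr p * (1 + t) powr p" using t by (simp add: powr_mult)
  also have "\<dots> \<le> \<bar>a\<bar> powr p * (1 + p * t + p\<^sup>2 * 2 powr p * t\<^sup>2)"
    using one_plus_powr_le[OF p t] by (intro mult_left_mono) auto
  also have "\<dots> = \<bar>a\<bar> powr p + p * (\<bar>a\<bar> powr p * t) + p\<^sup>2 * 2 powr p * (\<bar>a\<bar> powr p * t\<^sup>2)"
    by (simp add: algebra_simps)
  also have "\<bar>a\<bar> powr p * t = (\<bar>a\<bar> powr (p - 1) * sgn a) * b"
  proof -
    have "\<bar>a\<bar> powr p = \<bar>a\<bar> powr (p - 1) * \<bar>a\<bar>" using True by (simp add: powr_diff)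
    moreover have "sgn a * a = \<bar>a\<bar>" by (simp add: abs_sgn)
    ultimately show ?thesis unfolding b by (simp add: mult.assoc[symmetric]) 
  qed
  also have "\<bar>a\<bar> powr p * t\<^sup>2 = \<bar>a\<bar> powr (p - 2) * b\<^sup>2"
    using True by (simp add: b powr_diff powr_numeral power_mult_distrib)
  also have "p\<^sup>2 * 2 powr p * (\<bar>a\<bar> powr (p - 2) * b\<^sup>2) \<le> smooth_const p * (\<bar>a\<bar> powr (p - 2) * b\<^sup>2 + \<bar>b\<bar> powr p)"
    by (intro mult_mono) (use p in \<open>auto simp: smooth_const_def\<close>)
  finally show ?thesis by (simp add: mult.assoc)
next
  case False
  have ab: "\<bar>a\<bar> \<le> 2 * \<bar>b\<bar>" using False by auto
  have "\<bar>a + b\<bar> powr p \<le> (3 * \<bar>b\<bar>) powr p" using ab p by (intro powr_mono2) auto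
  then have 1: "\<bar>a + b\<bar> powr p \<le> 3 powr p * \<bar>b\<bar> powr p" by (simp add: powr_mult)
  have "\<bar>p * (\<bar>a\<bar> powr (p - 1) * sgn a) * b\<bar> \<le> p * \<bar>a\<bar> powr (p - 1) * \<bar>b\<bar>"
    using p by (auto simp: abs_mult abs_sgn_eq)
  also have "\<dots> \<le> p * (2 * \<bar>b\<bar>) powr (p - 1) * \<bar>b\<bar>"
    using ab p by (intro mult_mono powr_mono2) auto
  also have "\<dots> = p * 2 powr (p - 1) * \<bar>b\<bar> powr p"
    by (cases "b = 0") (auto simp: powr_mult powr_diff)
  also have "\<dots> \<le> p * 2 powr p * \<bar>b\<bar> powr p"
    using p by (intro mult_right_mono mult_left_mono powr_mono) auto
  finally have 2: "- (p * (\<bar>a\<bar> powr (p - 1) * sgn a) * b) \<le> p * 2 powr p * \<bar>b\<bar> powr p" by linarith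
  have 3: "smooth_const p * (\<bar>a\<bar> powr (p - 2) * b\<^sup>2 + \<bar>b\<bar> powr p) \<ge> (3 powr p + p * 2 powr p) * \<bar>b\<bar> powr p"
    by (intro mult_mono) (use p in \<open>auto simp: smooth_const_def\<close>)
  have "0 \<le> \<bar>a\<bar> powr p" by simp
  with 1 2 3[unfolded distrib_right] show ?thesis by linarith
qed

section \<open>Maximal inequality for sums of independent random variables\<close>

text \<open>Recursion on k makes one more step a binary \<open>max\<close>, so measurability and the
  Doob argument go by induction; \<open>Max_norm_eq_run_max\<close> links it to the maximum in
  \<open>max_grid_error\<close>.\<close>

primrec run_max :: "(nat \<Rightarrow> 'a::real_normed_vector) \<Rightarrow> nat \<Rightarrow> real" where
  "run_max s 0 = norm (s 0)"
| "run_max s (Suc k) = max (run_max s k) (norm (s (Suc k)))"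

lemma norm_le_run_max: "i \<le> k \<Longrightarrow> norm (s i) \<le> run_max s k"
  by (induction k) (auto simp: le_Suc_eq max.coboundedI1)

lemma run_max_nonneg [simp]: "0 \<le> run_max s k"
  using norm_le_run_max[of 0 k s] norm_ge_zero order_trans by blast

lemma run_max_le: "(\<And>i. i \<le> k \<Longrightarrow> norm (s i) \<le> c) \<Longrightarrow> run_max s k \<le> c"
  by (induction k) auto

lemma run_max_cong: "(\<And>i. i \<le> k \<Longrightarrow> s i = s' i) \<Longrightarrow> run_max s k = run_max s' k"
  by (induction k) auto

lemma Max_norm_eq_run_max: "(MAX i\<in>{0..k}. norm (s i)) = run_max s k"
  by (intro antisym run_max_le Max.boundedI) (auto simp: norm_le_run_max)

lemma borel_measurable_run_max [measurable (raw)]: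
  fixes s :: "'w \<Rightarrow> nat \<Rightarrow> 'a::{real_normed_vector, second_countable_topology}"
  assumes "\<And>i. i \<le> k \<Longrightarrow> (\<lambda>\<omega>. s \<omega> i) \<in> borel_measurable M"
  shows "(\<lambda>\<omega>. run_max (s \<omega>) k) \<in> borel_measurable M"
  using assms by (induction k) auto

text \<open>Pathwise Doob inequality: the subtracted sum is a martingale transform, with mean 0 for
  centred independent increments. The maximum moves only when |s (Suc k)| becomes its new value, and
  |.| lies above its tangent at s k.\<close>

lemma doob_pathwise:
  fixes s :: "nat \<Rightarrow> real"
  assumes p: "2 \<le> p" and "s 0 = 0"
  shows "(1 - 1 / p) * run_max s k powr p \<le> \<bar>s k\<bar> * run_max s k powr (p - 1)
           - (\<Sum>i<k. run_max s i powr (p - 1) * sgn (s i) * (s (Suc i) - s i))"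
proof (induction k)
  case 0
  then show ?case using assms by simp
next
  case (Suc k)
  define m m' where "m = run_max s k" and "m' = run_max s (Suc k)"
  have m: "0 \<le> m" by (simp add: m_def)
  have 1: "(1 - 1 / p) * (m' powr p - m powr p) \<le> \<bar>s (Suc k)\<bar> * (m' powr (p - 1) - m powr (p - 1))"
  proof (cases "\<bar>s (Suc k)\<bar> \<le> m")
    case True
    then show ?thesis by (simp add: m'_def m_def)
  next
    case False
    then have m': "m' = \<bar>s (Suc k)\<bar>" "m' > 0" using m by (auto simp: m'_def m_def)
    have "m' * m powr (p - 1) \<le> m' powr p / p + (1 - 1 / p) * m powr p"
      by (rule powr_tangent_le) (use p m m' in auto)
    moreover have "m' * m' powr (p - 1) = m' powr p" using m' by (simp add: powr_diff)
    ultimately show ?thesis using m'(1) by (simp add: algebra_simps)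
  qed
  have "sgn (s k) * (s (Suc k) - s k) \<le> \<bar>s (Suc k)\<bar> - \<bar>s k\<bar>"
    by (auto simp: sgn_real_def)
  then have "m powr (p - 1) * (sgn (s k) * (s (Suc k) - s k)) \<le> m powr (p - 1) * (\<bar>s (Suc k)\<bar> - \<bar>s k\<bar>)"
    by (intro mult_left_mono) auto
  with 1 Suc show ?case unfolding m_def[symmetric] m'_def[symmetric]
    by (simp add: algebra_simps m_def[symmetric])
qed

text \<open>After doubling, Young's inequality for 2|s k| absorbs one of the two copies of (1 - 1/p)
  m^p. Then p >= 2 gives 1 - 1/p >= 1/2 and 2/p <= 1, hence the factors 4 and 2^p.\<close>

lemma doob_pathwise_absorbed:
  fixes s :: "nat \<Rightarrow> real"
  assumes p: "2 \<le> p" and "s 0 = 0"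
  shows "run_max s k powr p \<le> 2 powr p * \<bar>s k\<bar> powr p
           - 4 * (\<Sum>i<k. run_max s i powr (p - 1) * sgn (s i) * (s (Suc i) - s i))"
proof -
  define m X D where "m = run_max s k" and "X = \<bar>s k\<bar>"
    and "D = (\<Sum>i<k. run_max s i powr (p - 1) * sgn (s i) * (s (Suc i) - s i))"
  have 1: "(1 - 1 / p) * m powr p \<le> X * m powr (p - 1) - D"
    using doob_pathwise[of p s k] assms by (simp add: m_def X_def D_def)
  have "(2 * X) * m powr (p - 1) \<le> (2 * X) powr p / p + (1 - 1 / p) * m powr p"
    by (rule powr_tangent_le) (use p in \<open>auto simp: X_def m_def\<close>)
  with 1 have 2: "(1 - 1 / p) * m powr p \<le> 2 powr p * X powr p / p - 2 * D"
    by (simp add: powr_mult X_def)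
  have "m powr p / 2 \<le> (1 - 1 / p) * m powr p"
    using mult_right_mono[of "1 / 2" "1 - 1 / p" "m powr p"] p by (simp add: field_simps)
  moreover have "2 powr p * X powr p / p \<le> 2 powr p * X powr p / 2"
    using p by (intro divide_left_mono) auto
  ultimately show ?thesis using 2 unfolding m_def X_def D_def by linarith
qed

section \<open>Moments and maxima of sums of independent centred variables\<close>

context prob_space
begin

text \<open>Independence of disjoint blocks, the second being a single index. It serves both the
  sums of noise terms and the value of \<open>L\<close> at the next evaluation point.\<close>

lemma indep_var_past:
  assumes X: "indep_vars (\<lambda>_. borel) X I" and A: "A \<subseteq> I" "i \<in> I" "i \<notin> A"
    and F: "F \<in> measurable (PiM A (\<lambda>_. borel)) M1" and G: "G \<in> measurable borel M2"
  shows "indep_var M1 (\<lambda>\<omega>. F (\<lambda>i\<in>A. X i \<omega>)) M2 (\<lambda>\<omega>. G (X i \<omega>))"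
proof -
  have "indep_var M1 (F \<circ> (\<lambda>\<omega>. \<lambda>i\<in>A. X i \<omega>)) M2 ((\<lambda>v. G (v i)) \<circ> (\<lambda>\<omega>. \<lambda>i\<in>{i}. X i \<omega>))"
    using A F G by (intro indep_var_compose[OF indep_var_restrict[OF X]]) auto
  then show ?thesis by (simp add: comp_def)
qed

text \<open>Martingale differences without conditional expectation: a function of the past is
  independent of \<open>\<xi> k\<close>, so the mean factorizes and one factor is 0.\<close>

lemma integral_mult_past_eq_0:
  fixes \<xi> :: "nat \<Rightarrow> 'a \<Rightarrow> real"
  assumes ind: "indep_vars (\<lambda>_. borel) \<xi> {..<N}" and k: "k < N"
    and F: "F \<in> borel_measurable (PiM {..<k} (\<lambda>_. borel))"
    and int: "integrable M (\<lambda>\<omega>. F (\<lambda>i\<in>{..<k}. \<xi> i \<omega>))" "integrable M (\<xi> k)"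
    and mean: "(\<integral>\<omega>. \<xi> k \<omega> \<partial>M) = 0"
  shows "integrable M (\<lambda>\<omega>. F (\<lambda>i\<in>{..<k}. \<xi> i \<omega>) * \<xi> k \<omega>)"
    and "(\<integral>\<omega>. F (\<lambda>i\<in>{..<k}. \<xi> i \<omega>) * \<xi> k \<omega> \<partial>M) = 0"
proof -
  have *: "indep_var borel (\<lambda>\<omega>. F (\<lambda>i\<in>{..<k}. \<xi> i \<omega>)) borel (\<lambda>\<omega>. \<xi> k \<omega>)"
    using indep_var_past[OF ind, of "{..<k}" k F borel "\<lambda>x. x" borel] k F by auto
  show "integrable M (\<lambda>\<omega>. F (\<lambda>i\<in>{..<k}. \<xi> i \<omega>) * \<xi> k \<omega>)"
    using indep_var_integrable[OF *] int by simp
  show "(\<integral>\<omega>. F (\<lambda>i\<in>{..<k}. \<xi> i \<omega>) * \<xi> k \<omega> \<partial>M) = 0"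
    using indep_var_lebesgue_integral[OF *] int mean by simp
qed

text \<open>The exponential bounds (1 + smooth_const p / N)^N, accumulated over N steps; 2 *
  smooth_const p is the weight of each new summand.\<close>

definition (in -) moment_const :: "real \<Rightarrow> real" where
  "moment_const p = 2 * smooth_const p * exp (smooth_const p)"

context
  fixes \<xi> :: "nat \<Rightarrow> 'a \<Rightarrow> real" and N :: nat and p :: real and S :: "nat \<Rightarrow> 'a \<Rightarrow> real"
  assumes p: "2 \<le> p" and ind: "indep_vars (\<lambda>_. borel) \<xi> {..<N}"
    and mean: "\<And>i. i < N \<Longrightarrow> (\<integral>\<omega>. \<xi> i \<omega> \<partial>M) = 0"
    and int: "\<And>i. i < N \<Longrightarrow> integrable M (\<lambda>\<omega>. \<bar>\<xi> i \<omega>\<bar> powr p)"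
  defines "S \<equiv> \<lambda>k \<omega>. \<Sum>i<k. \<xi> i \<omega>"
begin

lemma \<xi>_measurable [measurable]: "i < N \<Longrightarrow> \<xi> i \<in> borel_measurable M"
  using ind by (auto simp: indep_vars_def)

lemma S_measurable [measurable]: "k \<le> N \<Longrightarrow> S k \<in> borel_measurable M"
  unfolding S_def by (intro borel_measurable_sum) auto

text \<open>One dominating variable Z, the sum of all |\<xi> i|, serves the integrability claims of
  this context: Z^p is integrable by the power-mean inequality, and Z^q <= 1 + Z^p covers lower
  exponents.\<close>

lemma integrable_dominated_powr:
  assumes q: "0 \<le> q" "q \<le> p" and [measurable]: "g \<in> borel_measurable M"
    and le: "\<And>\<omega>. \<omega> \<in> space M \<Longrightarrow> \<bar>g \<omega>\<bar> \<le> (\<Sum>i<N. \<bar>\<xi> i \<omega>\<bar>) powr q"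
  shows "integrable M g"
proof (rule Bochner_Integration.integrable_bound)
  show "integrable M (\<lambda>\<omega>. 1 + real N powr (p - 1) * (\<Sum>i<N. \<bar>\<xi> i \<omega>\<bar> powr p))"
    using int by (intro Bochner_Integration.integrable_add integrable_mult_right integrable_sum) auto
  show "AE \<omega> in M. norm (g \<omega>) \<le> norm (1 + real N powr (p - 1) * (\<Sum>i<N. \<bar>\<xi> i \<omega>\<bar> powr p))"
  proof (rule AE_I2)
    fix \<omega> assume w: "\<omega> \<in> space M"
    define Z where "Z = (\<Sum>i<N. \<bar>\<xi> i \<omega>\<bar>)"
    have Z: "Z \<ge> 0" by (auto simp: Z_def intro: sum_nonneg)
    have "Z powr q \<le> 1 + Z powr p"
    proof (cases "Z \<le> 1")
      case True
      then have "Z powr q \<le> 1" using q Z by (intro powr_le1) auto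
      then show ?thesis by (simp add: add_increasing2)
    next
      case False
      then have "Z powr q \<le> Z powr p" using q by (intro powr_mono) auto
      then show ?thesis by simp
    qed
    also have "Z powr p \<le> real N powr (p - 1) * (\<Sum>i<N. \<bar>\<xi> i \<omega>\<bar> powr p)"
      using powr_sum_le[of p "{..<N}" "\<lambda>i. \<bar>\<xi> i \<omega>\<bar>"] p by (simp add: Z_def)
    finally show "norm (g \<omega>) \<le> norm (1 + real N powr (p - 1) * (\<Sum>i<N. \<bar>\<xi> i \<omega>\<bar> powr p))"
      using le[OF w] by (simp add: Z_def)
  qed
qed simp

lemma abs_S_le: "k \<le> N \<Longrightarrow> \<bar>S k \<omega>\<bar> \<le> (\<Sum>i<N. \<bar>\<xi> i \<omega>\<bar>)"
  unfolding S_def by (rule order_trans[OF sum_abs]) (auto intro: sum_mono2)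

lemma run_max_S_le: "k \<le> N \<Longrightarrow> run_max (\<lambda>k. S k \<omega>) k \<le> (\<Sum>i<N. \<bar>\<xi> i \<omega>\<bar>)"
  by (rule run_max_le) (auto intro: abs_S_le)

lemma integrable_\<xi>: "i < N \<Longrightarrow> integrable M (\<xi> i)"
  by (rule integrable_dominated_powr[of 1]) (use p in \<open>auto intro!: member_le_sum simp: sum_nonneg\<close>)

lemma integrable_S_powr: "k \<le> N \<Longrightarrow> integrable M (\<lambda>\<omega>. \<bar>S k \<omega>\<bar> powr p)"
  by (rule integrable_dominated_powr[of p]) (use p in \<open>auto intro!: powr_mono2 abs_S_le\<close>)

lemma integrable_run_max_powr: "k \<le> N \<Longrightarrow> integrable M (\<lambda>\<omega>. run_max (\<lambda>k. S k \<omega>) k powr p)"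
  by (rule integrable_dominated_powr[of p]) (use p in \<open>auto intro!: powr_mono2 run_max_S_le\<close>)

lemma S_restrict: "i \<le> k \<Longrightarrow> (\<Sum>j<i. (\<lambda>i\<in>{..<k}. \<xi> i \<omega>) j) = S i \<omega>"
  by (auto simp: S_def)

text \<open>The linear term of the expansion has mean 0. The quadratic term is split with weight N,
  so that one step multiplies the moment by 1 + O(1/N) only.\<close>

lemma moment_step:
  assumes k: "k < N"
  shows "(\<integral>\<omega>. \<bar>S (Suc k) \<omega>\<bar> powr p \<partial>M) \<le> (1 + smooth_const p / N) * (\<integral>\<omega>. \<bar>S k \<omega>\<bar> powr p \<partial>M)
     + 2 * smooth_const p * real N powr (p / 2 - 1) * (\<integral>\<omega>. \<bar>\<xi> k \<omega>\<bar> powr p \<partial>M)"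
proof -
  define c where "c = smooth_const p"
  have c: "c > 0" using p by (simp add: c_def smooth_const_pos)
  define F where "F v = \<bar>\<Sum>j<k. v j\<bar> powr (p - 1) * sgn (\<Sum>j<k. v j)" for v :: "nat \<Rightarrow> real"
  have F: "F \<in> borel_measurable (PiM {..<k} (\<lambda>_. borel))"
    unfolding F_def by measurable
  have F_eq: "F (\<lambda>i\<in>{..<k}. \<xi> i \<omega>) = \<bar>S k \<omega>\<bar> powr (p - 1) * sgn (S k \<omega>)" for \<omega>
    unfolding F_def S_restrict[OF order_refl] ..
  have Fint: "integrable M (\<lambda>\<omega>. F (\<lambda>i\<in>{..<k}. \<xi> i \<omega>))"
    unfolding F_eq
  proof (rule integrable_dominated_powr[of "p - 1"])
    show "(\<lambda>\<omega>. \<bar>S k \<omega>\<bar> powr (p - 1) * sgn (S k \<omega>)) \<in> borel_measurable M"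
      using k by simp
    show "\<bar>\<bar>S k \<omega>\<bar> powr (p - 1) * sgn (S k \<omega>)\<bar> \<le> (\<Sum>i<N. \<bar>\<xi> i \<omega>\<bar>) powr (p - 1)" for \<omega>
    proof -
      have "\<bar>\<bar>S k \<omega>\<bar> powr (p - 1) * sgn (S k \<omega>)\<bar> \<le> \<bar>S k \<omega>\<bar> powr (p - 1)"
        by (auto simp: abs_mult sgn_real_def)
      also have "\<dots> \<le> (\<Sum>i<N. \<bar>\<xi> i \<omega>\<bar>) powr (p - 1)"
        using p k abs_S_le[of k] by (intro powr_mono2) auto
      finally show ?thesis .
    qed
  qed (use p in auto)
  note mart = integral_mult_past_eq_0[OF ind k F Fint integrable_\<xi>[OF k] mean[OF k], unfolded F_eq]
  have le: "\<bar>S (Suc k) \<omega>\<bar> powr p \<le> (1 + c / N) * \<bar>S k \<omega>\<bar> powr p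
      + p * (\<bar>S k \<omega>\<bar> powr (p - 1) * sgn (S k \<omega>) * \<xi> k \<omega>)
      + 2 * c * real N powr (p / 2 - 1) * \<bar>\<xi> k \<omega>\<bar> powr p" for \<omega>
  proof -
    have "\<bar>S (Suc k) \<omega>\<bar> powr p \<le> \<bar>S k \<omega>\<bar> powr p + p * (\<bar>S k \<omega>\<bar> powr (p - 1) * sgn (S k \<omega>)) * \<xi> k \<omega>
         + c * (\<bar>S k \<omega>\<bar> powr (p - 2) * (\<xi> k \<omega>)\<^sup>2 + \<bar>\<xi> k \<omega>\<bar> powr p)"
      using abs_add_powr_le[OF p, of "S k \<omega>" "\<xi> k \<omega>"] by (simp add: S_def c_def)
    moreover have "\<bar>S k \<omega>\<bar> powr (p - 2) * (\<xi> k \<omega>)\<^sup>2 \<le> \<bar>S k \<omega>\<bar> powr p / N + real N powr (p / 2 - 1) * \<bar>\<xi> k \<omega>\<bar> powr p"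
      using powr_weighted_le[of p "real N" "\<bar>S k \<omega>\<bar>" "\<bar>\<xi> k \<omega>\<bar>"] p k by simp
    \<comment> \<open>N^(p/2 - 1) >= 1 merges the pure p-th power with the one from the weighted
      split, hence the factor 2.\<close>
    moreover have "1 * \<bar>\<xi> k \<omega>\<bar> powr p \<le> real N powr (p / 2 - 1) * \<bar>\<xi> k \<omega>\<bar> powr p"
      using p k by (intro mult_right_mono ge_one_powr_ge_zero) auto
    ultimately have "\<bar>S (Suc k) \<omega>\<bar> powr p \<le> \<bar>S k \<omega>\<bar> powr p + p * (\<bar>S k \<omega>\<bar> powr (p - 1) * sgn (S k \<omega>)) * \<xi> k \<omega>
         + c * (\<bar>S k \<omega>\<bar> powr p / N + 2 * (real N powr (p / 2 - 1) * \<bar>\<xi> k \<omega>\<bar> powr p))"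
      using c by (smt (verit) mult_left_mono)
    then show ?thesis by (simp add: algebra_simps)
  qed
  have "(\<integral>\<omega>. \<bar>S (Suc k) \<omega>\<bar> powr p \<partial>M) \<le> (\<integral>\<omega>. (1 + c / N) * \<bar>S k \<omega>\<bar> powr p
      + p * (\<bar>S k \<omega>\<bar> powr (p - 1) * sgn (S k \<omega>) * \<xi> k \<omega>)
      + 2 * c * real N powr (p / 2 - 1) * \<bar>\<xi> k \<omega>\<bar> powr p \<partial>M)"
    using k le mart(1) int[OF k]
    by (intro integral_mono integrable_S_powr Bochner_Integration.integrable_add integrable_mult_right) auto
  also have "\<dots> = (1 + c / N) * (\<integral>\<omega>. \<bar>S k \<omega>\<bar> powr p \<partial>M)
     + 2 * c * real N powr (p / 2 - 1) * (\<integral>\<omega>. \<bar>\<xi> k \<omega>\<bar> powr p \<partial>M)"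
    using k mart int[OF k] by (simp add: integrable_S_powr)
  finally show ?thesis by (simp add: c_def)
qed

text \<open>N steps cost (1 + c/N)^N <= exp c. For N summands of comparable size the bound has order
  N^(p/2), the square-root fluctuation.\<close>

lemma moment_bound:
  "(\<integral>\<omega>. \<bar>S N \<omega>\<bar> powr p \<partial>M) \<le>
     moment_const p * real N powr (p / 2 - 1) * (\<Sum>i<N. \<integral>\<omega>. \<bar>\<xi> i \<omega>\<bar> powr p \<partial>M)"
proof -
  define c where "c = smooth_const p"
  have c: "c > 0" using p by (simp add: c_def smooth_const_pos)
  define q where "q = 1 + c / N"
  have q: "1 \<le> q" using c by (simp add: q_def)
  define e where "e i = (\<integral>\<omega>. \<bar>\<xi> i \<omega>\<bar> powr p \<partial>M)" for i
  have e: "e i \<ge> 0" for i by (simp add: e_def)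
  define w where "w = 2 * c * real N powr (p / 2 - 1)"
  have w: "w \<ge> 0" using c by (simp add: w_def)
  have "(\<integral>\<omega>. \<bar>S k \<omega>\<bar> powr p \<partial>M) \<le> q ^ k * (w * (\<Sum>i<k. e i))" if "k \<le> N" for k
    using that
  proof (induction k)
    case 0
    then show ?case by (simp add: S_def)
  next
    case (Suc k)
    have "(\<integral>\<omega>. \<bar>S (Suc k) \<omega>\<bar> powr p \<partial>M) \<le> q * (\<integral>\<omega>. \<bar>S k \<omega>\<bar> powr p \<partial>M) + w * e k"
      using moment_step[of k] Suc by (simp add: q_def c_def w_def e_def)
    also have "\<dots> \<le> q * (q ^ k * (w * (\<Sum>i<k. e i))) + q ^ Suc k * (w * e k)"
    proof (rule add_mono)
      show "w * e k \<le> q ^ Suc k * (w * e k)"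
        using mult_right_mono[OF one_le_power[OF q, of "Suc k"], of "w * e k"] w e by simp
    qed (use Suc q in auto)
    finally show ?case by (simp add: algebra_simps)
  qed
  then have "(\<integral>\<omega>. \<bar>S N \<omega>\<bar> powr p \<partial>M) \<le> q ^ N * (w * (\<Sum>i<N. e i))" by simp
  also have "\<dots> \<le> exp c * (w * (\<Sum>i<N. e i))"
  proof (intro mult_right_mono)
    have "q ^ N \<le> exp (c / N) ^ N" using q by (intro power_mono) (auto simp: q_def)
    also have "\<dots> \<le> exp c" using c by (cases "N = 0") (auto simp: exp_of_nat_mult[symmetric])
    finally show "q ^ N \<le> exp c" .
  qed (use w e in \<open>auto intro!: mult_nonneg_nonneg sum_nonneg\<close>)
  finally show ?thesis by (simp add: w_def c_def e_def moment_const_def mult_ac)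
qed

text \<open>The pathwise Doob bound is integrated; every \<open>D k\<close> is a function of the
  past times \<open>\<xi> k\<close> and has mean 0.\<close>

lemma maximal_moment_bound_real:
  "(\<integral>\<omega>. run_max (\<lambda>k. S k \<omega>) N powr p \<partial>M) \<le>
     2 powr p * moment_const p * real N powr (p / 2 - 1) * (\<Sum>i<N. \<integral>\<omega>. \<bar>\<xi> i \<omega>\<bar> powr p \<partial>M)"
proof -
  define D where "D k \<omega> = run_max (\<lambda>k. S k \<omega>) k powr (p - 1) * sgn (S k \<omega>) * \<xi> k \<omega>" for k \<omega>
  have mart: "integrable M (D k)" "(\<integral>\<omega>. D k \<omega> \<partial>M) = 0" if k: "k < N" for k
  proof -
    \<comment> \<open>\<open>F\<close> rebuilds running maximum and sign from the first k variables
      alone, the form that \<open>integral_mult_past_eq_0\<close> expects.\<close>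
    define F where "F v = run_max (\<lambda>i. \<Sum>j<i. v j) k powr (p - 1) * sgn (\<Sum>j<k. v j)" for v :: "nat \<Rightarrow> real"
    have F: "F \<in> borel_measurable (PiM {..<k} (\<lambda>_. borel))"
      unfolding F_def
      by (intro borel_measurable_times powr_real_measurable borel_measurable_run_max
          measurable_compose[OF _ borel_measurable_sgn] borel_measurable_sum) auto
    have F_eq: "F (\<lambda>i\<in>{..<k}. \<xi> i \<omega>) = run_max (\<lambda>k. S k \<omega>) k powr (p - 1) * sgn (S k \<omega>)" for \<omega>
      unfolding F_def S_restrict[OF order_refl]
      by (subst run_max_cong[of k _ "\<lambda>k. S k \<omega>"]) (auto simp: S_def)
    have Fint: "integrable M (\<lambda>\<omega>. F (\<lambda>i\<in>{..<k}. \<xi> i \<omega>))"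
      unfolding F_eq
    proof (rule integrable_dominated_powr[of "p - 1"])
      show "(\<lambda>\<omega>. run_max (\<lambda>k. S k \<omega>) k powr (p - 1) * sgn (S k \<omega>)) \<in> borel_measurable M"
        using k by simp
      show "\<bar>run_max (\<lambda>k. S k \<omega>) k powr (p - 1) * sgn (S k \<omega>)\<bar> \<le> (\<Sum>i<N. \<bar>\<xi> i \<omega>\<bar>) powr (p - 1)" for \<omega>
      proof -
        have "\<bar>run_max (\<lambda>k. S k \<omega>) k powr (p - 1) * sgn (S k \<omega>)\<bar> \<le> run_max (\<lambda>k. S k \<omega>) k powr (p - 1)"
          by (auto simp: abs_mult sgn_real_def)
        also have "\<dots> \<le> (\<Sum>i<N. \<bar>\<xi> i \<omega>\<bar>) powr (p - 1)"
          using p k run_max_S_le[of k] by (intro powr_mono2) auto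
        finally show ?thesis .
      qed
    qed (use p in auto)
    show "integrable M (D k)" "(\<integral>\<omega>. D k \<omega> \<partial>M) = 0"
      using integral_mult_past_eq_0[OF ind k F Fint integrable_\<xi>[OF k] mean[OF k], unfolded F_eq]
      by (simp_all add: D_def[abs_def])
  qed
  have le: "run_max (\<lambda>k. S k \<omega>) N powr p \<le> 2 powr p * \<bar>S N \<omega>\<bar> powr p - 4 * (\<Sum>k<N. D k \<omega>)" for \<omega>
    using doob_pathwise_absorbed[OF p, of "\<lambda>k. S k \<omega>" N] by (simp add: D_def S_def)
  have "(\<integral>\<omega>. run_max (\<lambda>k. S k \<omega>) N powr p \<partial>M)
      \<le> (\<integral>\<omega>. 2 powr p * \<bar>S N \<omega>\<bar> powr p - 4 * (\<Sum>k<N. D k \<omega>) \<partial>M)"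
    using le mart(1)
    by (intro integral_mono integrable_run_max_powr integrable_S_powr Bochner_Integration.integrable_diff
        integrable_mult_right Bochner_Integration.integrable_sum) auto
  also have "\<dots> = (\<integral>\<omega>. 2 powr p * \<bar>S N \<omega>\<bar> powr p \<partial>M) - (\<integral>\<omega>. 4 * (\<Sum>k<N. D k \<omega>) \<partial>M)"
    using mart(1)
    by (intro Bochner_Integration.integral_diff integrable_mult_right integrable_S_powr
        Bochner_Integration.integrable_sum) auto
  also have "(\<integral>\<omega>. 4 * (\<Sum>k<N. D k \<omega>) \<partial>M) = 0"
    using mart by (simp add: Bochner_Integration.integral_sum)
  also have "(\<integral>\<omega>. 2 powr p * \<bar>S N \<omega>\<bar> powr p \<partial>M) - 0 = 2 powr p * (\<integral>\<omega>. \<bar>S N \<omega>\<bar> powr p \<partial>M)"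
    by simp
  also have "\<dots> \<le> 2 powr p * (moment_const p * real N powr (p / 2 - 1) * (\<Sum>i<N. \<integral>\<omega>. \<bar>\<xi> i \<omega>\<bar> powr p \<partial>M))"
    using moment_bound by (intro mult_left_mono) auto
  finally show ?thesis by (simp add: mult.assoc)
qed

end

text \<open>d^(p-1) is the power-mean factor over the d coordinates; one more d comes from adding
  their equal bounds.\<close>

definition (in -) maximal_const :: "real \<Rightarrow> real \<Rightarrow> real" where
  "maximal_const d p = d powr p * (2 powr p * moment_const p)"

text \<open>Coordinatewise reduction: the norm is at most the sum of the coordinate moduli, and each
  coordinate family is again independent and centred.\<close>

lemma maximal_moment_bound:
  fixes \<xi> :: "nat \<Rightarrow> 'a \<Rightarrow> 'b::euclidean_space"
  assumes p: "2 \<le> p" and ind: "indep_vars (\<lambda>_. borel) \<xi> {..<N}"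
    and mean: "\<And>i. i < N \<Longrightarrow> (\<integral>\<omega>. \<xi> i \<omega> \<partial>M) = 0"
    and int: "\<And>i. i < N \<Longrightarrow> integrable M (\<lambda>\<omega>. norm (\<xi> i \<omega>) powr p)"
  shows "(\<integral>\<^sup>+\<omega>. ennreal (run_max (\<lambda>k. \<Sum>i<k. \<xi> i \<omega>) N powr p) \<partial>M) \<le>
     ennreal (maximal_const DIM('b) p * real N powr (p / 2 - 1) * (\<Sum>i<N. \<integral>\<omega>. norm (\<xi> i \<omega>) powr p \<partial>M))"
proof -
  define d where "d = real DIM('b)"
  have d: "d > 0" by (simp add: d_def)
  define R where "R b \<omega> = run_max (\<lambda>k. \<Sum>i<k. \<xi> i \<omega> \<bullet> b) N powr p" for b \<omega>
  have R: "R b \<omega> \<ge> 0" for b \<omega> by (simp add: R_def)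
  define E where "E = (\<Sum>i<N. \<integral>\<omega>. norm (\<xi> i \<omega>) powr p \<partial>M)"
  define w where "w = 2 powr p * moment_const p * real N powr (p / 2 - 1)"
  have w: "w \<ge> 0" using smooth_const_pos[OF p] by (simp add: w_def moment_const_def)
  have meas [measurable]: "\<xi> i \<in> borel_measurable M" if "i < N" for i
    using ind that by (auto simp: indep_vars_def)
  have comp: "integrable M (R b)" "(\<integral>\<omega>. R b \<omega> \<partial>M) \<le> w * E" if b: "b \<in> Basis" for b :: 'b
  proof -
    have le: "\<bar>\<xi> i \<omega> \<bullet> b\<bar> powr p \<le> norm (\<xi> i \<omega>) powr p" for i \<omega>
      using p b by (intro powr_mono2) (auto simp: Basis_le_norm)
    have ind': "indep_vars (\<lambda>_. borel) (\<lambda>i \<omega>. \<xi> i \<omega> \<bullet> b) {..<N}"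
      by (rule indep_vars_compose2[OF ind]) auto
    have int': "integrable M (\<lambda>\<omega>. \<bar>\<xi> i \<omega> \<bullet> b\<bar> powr p)" if "i < N" for i
      by (rule Bochner_Integration.integrable_bound[OF int[OF that]]) (use le that in auto)
    have vint: "integrable M (\<xi> i)" if i: "i < N" for i
    proof (rule Bochner_Integration.integrable_bound)
      show "integrable M (\<lambda>\<omega>. 1 + norm (\<xi> i \<omega>) powr p)" using int[OF i] by simp
      have "z \<le> 1 + z powr p" if "0 \<le> z" for z :: real
        using powr_mono[of 1 p z] that p by (cases "z \<le> 1") (auto simp: add_increasing2)
      then show "AE \<omega> in M. norm (\<xi> i \<omega>) \<le> norm (1 + norm (\<xi> i \<omega>) powr p)" by auto
    qed (use i in simp)
    have mean': "(\<integral>\<omega>. \<xi> i \<omega> \<bullet> b \<partial>M) = 0" if "i < N" for i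
      using mean[OF that] vint[OF that] by simp
    show "integrable M (R b)" unfolding R_def
      by (rule integrable_run_max_powr[OF p ind' mean' int']) auto
    have "(\<integral>\<omega>. R b \<omega> \<partial>M) \<le> w * (\<Sum>i<N. \<integral>\<omega>. \<bar>\<xi> i \<omega> \<bullet> b\<bar> powr p \<partial>M)"
      unfolding R_def w_def by (rule maximal_moment_bound_real[OF p ind' mean' int'])
    also have "\<dots> \<le> w * E"
      unfolding E_def using w le int int' by (intro mult_left_mono sum_mono integral_mono) auto
    finally show "(\<integral>\<omega>. R b \<omega> \<partial>M) \<le> w * E" .
  qed
  have le: "run_max (\<lambda>k. \<Sum>i<k. \<xi> i \<omega>) N powr p \<le> d powr (p - 1) * (\<Sum>b\<in>Basis. R b \<omega>)" for \<omega>
  proof -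
    have "run_max (\<lambda>k. \<Sum>i<k. \<xi> i \<omega>) N \<le> (\<Sum>b\<in>Basis. run_max (\<lambda>k. \<Sum>i<k. \<xi> i \<omega> \<bullet> b) N)"
    proof (rule run_max_le)
      fix k assume k: "k \<le> N"
      have "norm (\<Sum>i<k. \<xi> i \<omega>) \<le> (\<Sum>b\<in>Basis. \<bar>(\<Sum>i<k. \<xi> i \<omega>) \<bullet> b\<bar>)" by (rule norm_le_l1)
      also have "\<dots> \<le> (\<Sum>b\<in>Basis. run_max (\<lambda>k. \<Sum>i<k. \<xi> i \<omega> \<bullet> b) N)"
        using norm_le_run_max[OF k, of "\<lambda>k. \<Sum>i<k. \<xi> i \<omega> \<bullet> b" for b :: 'b]
        by (intro sum_mono) (simp add: inner_sum_left)
      finally show "norm (\<Sum>i<k. \<xi> i \<omega>) \<le> \<dots>" .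
    qed
    then have "run_max (\<lambda>k. \<Sum>i<k. \<xi> i \<omega>) N powr p \<le> (\<Sum>b\<in>Basis. run_max (\<lambda>k. \<Sum>i<k. \<xi> i \<omega> \<bullet> b) N) powr p"
      using p by (intro powr_mono2) auto
    also have "\<dots> \<le> d powr (p - 1) * (\<Sum>b\<in>Basis. R b \<omega>)"
      unfolding R_def d_def by (rule powr_sum_le) (use p in auto)
    finally show ?thesis .
  qed
  have "(\<integral>\<^sup>+\<omega>. ennreal (run_max (\<lambda>k. \<Sum>i<k. \<xi> i \<omega>) N powr p) \<partial>M)
      \<le> (\<integral>\<^sup>+\<omega>. ennreal (d powr (p - 1) * (\<Sum>b\<in>Basis. R b \<omega>)) \<partial>M)"
    using le by (intro nn_integral_mono ennreal_leI) auto
  also have "\<dots> = ennreal (\<integral>\<omega>. d powr (p - 1) * (\<Sum>b\<in>Basis. R b \<omega>) \<partial>M)"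
    using R by (intro nn_integral_eq_integral integrable_mult_right Bochner_Integration.integrable_sum comp(1))
      (auto intro!: sum_nonneg mult_nonneg_nonneg)
  also have "(\<integral>\<omega>. d powr (p - 1) * (\<Sum>b\<in>Basis. R b \<omega>) \<partial>M) = d powr (p - 1) * (\<Sum>b\<in>Basis. \<integral>\<omega>. R b \<omega> \<partial>M)"
    using comp(1) by simp
  also have "\<dots> \<le> d powr (p - 1) * (\<Sum>b\<in>(Basis :: 'b set). w * E)"
    using comp(2) by (intro mult_left_mono sum_mono) auto
  also have "\<dots> = maximal_const d p * real N powr (p / 2 - 1) * E"
    using d by (simp add: w_def maximal_const_def powr_diff d_def)
  finally show ?thesis by (simp add: d_def E_def ennreal_leI)
qed

end

section \<open>The fundamental theorem of calculus for absolutely continuous functions\<close>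

text \<open>Frees the definition from index sets {..<m}: the pieces of a tagged division are indexed
  by pairs of tag and interval.\<close>

lemma absolutely_continuous_onD:
  fixes x :: "real \<Rightarrow> 'a::real_normed_vector"
  assumes "absolutely_continuous_on S x" "0 < \<epsilon>"
  shows "\<exists>\<delta>>0. \<forall>I (u :: 'i \<Rightarrow> real) v. finite I \<longrightarrow> (\<forall>i\<in>I. u i \<le> v i \<and> {u i..v i} \<subseteq> S) \<longrightarrow>
       disjoint_family_on (\<lambda>i. {u i<..<v i}) I \<longrightarrow> (\<Sum>i\<in>I. v i - u i) < \<delta> \<longrightarrow>
       (\<Sum>i\<in>I. norm (x (v i) - x (u i))) < \<epsilon>"
proof -
  obtain \<delta> where \<delta>: "\<delta> > 0" "\<forall>(m::nat) u v. (\<forall>i<m. u i \<le> v i \<and> {u i..v i} \<subseteq> S) \<and>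
        disjoint_family_on (\<lambda>i. {u i<..<v i}) {..<m} \<and>
        (\<Sum>i<m. v i - u i) < \<delta> \<longrightarrow> (\<Sum>i<m. norm (x (v i) - x (u i))) < \<epsilon>"
    using assms(1)[unfolded absolutely_continuous_on_def, rule_format, OF assms(2)] by blast
  have "(\<Sum>i\<in>I. norm (x (v i) - x (u i))) < \<epsilon>"
    if I: "finite I" "\<forall>i\<in>I. u i \<le> v i \<and> {u i..v i} \<subseteq> S"
      "disjoint_family_on (\<lambda>i. {u i<..<v i}) I" "(\<Sum>i\<in>I. v i - u i) < \<delta>"
    for I and u v :: "'i \<Rightarrow> real"
  proof -
    obtain h where h: "bij_betw h {..<card I} I"
      using ex_bij_betw_nat_finite[OF I(1)] atLeast0LessThan by metis
    have hI: "h i \<in> I" if "i < card I" for i using h that by (auto simp: bij_betw_def)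
    have "(\<Sum>i<card I. norm (x (v (h i)) - x (u (h i)))) < \<epsilon>"
    proof (rule \<delta>(2)[rule_format], intro conjI)
      show "disjoint_family_on (\<lambda>i. {u (h i)<..<v (h i)}) {..<card I}"
        using I(3) h unfolding disjoint_family_on_def bij_betw_def inj_on_def by blast
      show "(\<Sum>i<card I. v (h i) - u (h i)) < \<delta>"
        using sum.reindex_bij_betw[OF h, of "\<lambda>i. v i - u i"] I(4) by simp
      show "\<forall>i<card I. u (h i) \<le> v (h i) \<and> {u (h i)..v (h i)} \<subseteq> S" using I(2) hI by blast
    qed
    then show ?thesis
      using sum.reindex_bij_betw[OF h, of "\<lambda>i. norm (x (v i) - x (u i))"] by simp
  qed
  with \<delta>(1) show ?thesis by blast
qed

lemma absolutely_continuous_on_imp_continuous_on: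
  fixes x :: "real \<Rightarrow> 'a::real_normed_vector"
  assumes "absolutely_continuous_on {a..b} x"
  shows "continuous_on {a..b} x"
  unfolding continuous_on_iff
proof (intro ballI allI impI)
  fix t \<epsilon> :: real assume t: "t \<in> {a..b}" and "0 < \<epsilon>"
  obtain \<delta> where \<delta>: "\<delta> > 0" and *:
    "\<forall>I (u :: unit \<Rightarrow> real) v. finite I \<longrightarrow> (\<forall>i\<in>I. u i \<le> v i \<and> {u i..v i} \<subseteq> {a..b}) \<longrightarrow>
       disjoint_family_on (\<lambda>i. {u i<..<v i}) I \<longrightarrow> (\<Sum>i\<in>I. v i - u i) < \<delta> \<longrightarrow>
       (\<Sum>i\<in>I. norm (x (v i) - x (u i))) < \<epsilon>"
    using absolutely_continuous_onD[OF assms \<open>0 < \<epsilon>\<close>] by blast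
  have "dist (x s) (x t) < \<epsilon>" if s: "s \<in> {a..b}" "dist s t < \<delta>" for s
    using *[rule_format, of UNIV "\<lambda>_. min s t" "\<lambda>_. max s t"] s t
    by (cases "s \<le> t") (auto simp: dist_norm disjoint_family_on_def norm_minus_commute)
  with \<delta> show "\<exists>\<delta>>0. \<forall>s\<in>{a..b}. dist s t < \<delta> \<longrightarrow> dist (x s) (x t) < \<epsilon>" by blast
qed

text \<open>Straddle lemma: the increment is split at t, and the two errors add up because v - u =
  (v - t) + (t - u).\<close>

lemma interval_increment_bound:
  fixes x :: "real \<Rightarrow> 'a::real_normed_vector"
  assumes "(x has_vector_derivative d) (at t)" "0 < \<epsilon>"
  obtains \<delta> where "0 < \<delta>" "\<And>u v. u \<le> t \<Longrightarrow> t \<le> v \<Longrightarrow> {u..v} \<subseteq> ball t \<delta> \<Longrightarrow>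
    norm ((v - u) *\<^sub>R d - (x v - x u)) \<le> \<epsilon> * (v - u)"
proof -
  obtain \<delta> where \<delta>: "\<delta> > 0" "\<And>y. norm (y - t) < \<delta> \<Longrightarrow> norm (x y - x t - (y - t) *\<^sub>R d) \<le> \<epsilon> * norm (y - t)"
    using assms unfolding has_vector_derivative_def has_derivative_at_alt by metis
  show thesis
  proof (rule that[OF \<delta>(1)])
    fix u v assume uv: "u \<le> t" "t \<le> v" "{u..v} \<subseteq> ball t \<delta>"
    have "u \<in> {u..v}" "v \<in> {u..v}" using uv by auto
    then have "u \<in> ball t \<delta>" "v \<in> ball t \<delta>" using uv(3) by blast+
    then have "norm (x u - x t - (u - t) *\<^sub>R d) \<le> \<epsilon> * (t - u)" "norm (x v - x t - (v - t) *\<^sub>R d) \<le> \<epsilon> * (v - t)"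
      using \<delta>(2)[of u] \<delta>(2)[of v] uv by (auto simp: dist_real_def abs_minus_commute)
    moreover have "(v - u) *\<^sub>R d - (x v - x u) = (x u - x t - (u - t) *\<^sub>R d) - (x v - x t - (v - t) *\<^sub>R d)"
      by (simp add: algebra_simps)
    ultimately show "norm ((v - u) *\<^sub>R d - (x v - x u)) \<le> \<epsilon> * (v - u)"
      by (smt (verit) norm_triangle_ineq4 distrib_left right_diff_distrib)
  qed
qed

text \<open>Points where the derivative is missing form a null set \<open>E\<close>. The gauge keeps the intervals
  tagged in \<open>E\<close> inside an open set of small measure, where absolute continuity bounds the increments,
  so no covering theorem is needed.\<close>

theorem absolutely_continuous_has_integral:
  fixes x :: "real \<Rightarrow> 'a::euclidean_space"
  assumes ac: "absolutely_continuous_on {a..b} x" and ab: "a \<le> b"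
    and E: "negligible E" and der: "\<And>t. t \<in> {a..b} - E \<Longrightarrow> (x has_vector_derivative g t) (at t)"
  shows "(g has_integral (x b - x a)) {a..b}"
proof -
  \<comment> \<open>With the value 0 on \<open>E\<close>, a piece tagged there contributes only its
    increment of x; the change on a negligible set is undone at the end.\<close>
  define g0 where "g0 t = (if t \<in> E then 0 else g t)" for t
  have "(g0 has_integral (x b - x a)) {a..b}"
    unfolding has_integral_real
  proof (intro allI impI)
    fix \<epsilon> :: real assume e: "0 < \<epsilon>"
    \<comment> \<open>The summand 1 keeps the denominator positive when a = b; the other half of
      \<epsilon> is reserved for the pieces tagged in \<open>E\<close>.\<close>
    define \<eta> where "\<eta> = \<epsilon> / (2 * (b - a + 1))"
    have eta: "\<eta> > 0" "\<eta> * (b - a) < \<epsilon> / 2" using e ab by (auto simp: \<eta>_def field_simps)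
    obtain \<delta> where \<delta>: "\<delta> > 0" and small: 
      "\<forall>I (u :: real \<times> real set \<Rightarrow> real) v. finite I \<longrightarrow> (\<forall>i\<in>I. u i \<le> v i \<and> {u i..v i} \<subseteq> {a..b}) \<longrightarrow>
       disjoint_family_on (\<lambda>i. {u i<..<v i}) I \<longrightarrow> (\<Sum>i\<in>I. v i - u i) < \<delta> \<longrightarrow>
       (\<Sum>i\<in>I. norm (x (v i) - x (u i))) < \<epsilon> / 2"
      using absolutely_continuous_onD[OF ac half_gt_zero[OF e]] by blast
    have Eleb: "E \<in> sets lebesgue" "emeasure lebesgue E = 0"
      using E by (auto simp: negligible_iff_null_sets)
    obtain U where U: "open U" "E \<subseteq> U" "U - E \<in> lmeasurable" "emeasure lebesgue (U - E) < ennreal \<delta>"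
      using sets_lebesgue_outer_open[OF Eleb(1) \<delta>] by blast
    have Uleb: "U \<in> sets lebesgue" using U(1) by auto
    have "emeasure lebesgue U \<le> emeasure lebesgue (U - E) + emeasure lebesgue E"
      using U Eleb(1) Uleb emeasure_subadditive[of "U - E" lebesgue E] by (simp add: Un_absorb2)
    then have Ud: "emeasure lebesgue U < ennreal \<delta>" using U(4) Eleb(2) by (simp add: order_le_less_trans)
    have "\<exists>\<rho>. (t \<in> {a..b} - E \<longrightarrow> 0 < \<rho> \<and> (\<forall>u v. u \<le> t \<longrightarrow> t \<le> v \<longrightarrow> {u..v} \<subseteq> ball t \<rho> \<longrightarrow>
        norm ((v - u) *\<^sub>R g t - (x v - x u)) \<le> \<eta> * (v - u)))" for t
      using interval_increment_bound[OF der[of t] eta(1)] by metis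
    then obtain \<rho> where \<rho>: "\<And>t. t \<in> {a..b} - E \<Longrightarrow> 0 < \<rho> t" "\<And>t u v. t \<in> {a..b} - E \<Longrightarrow> u \<le> t \<Longrightarrow> t \<le> v \<Longrightarrow>
        {u..v} \<subseteq> ball t (\<rho> t) \<Longrightarrow> norm ((v - u) *\<^sub>R g t - (x v - x u)) \<le> \<eta> * (v - u)"
      by metis
    define G where "G t = (if t \<in> E then U else if t \<in> {a..b} then ball t (\<rho> t) else ball t 1)" for t
    have gauge: "gauge G" unfolding gauge_def G_def using U(1,2) \<rho>(1) by auto
    show "\<exists>\<gamma>. gauge \<gamma> \<and> (\<forall>\<D>. \<D> tagged_division_of {a..b} \<and> \<gamma> fine \<D> \<longrightarrow>
        norm ((\<Sum>(t, k)\<in>\<D>. measure lborel k *\<^sub>R g0 t) - (x b - x a)) < \<epsilon>)"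
    proof (intro exI[of _ G] conjI gauge allI impI, elim conjE)
      fix D assume D: "D tagged_division_of {a..b}" and fine: "G fine D"
      note Dp = tagged_division_ofD[OF D]
      define l where "l i = Inf (snd i)" for i :: "real \<times> real set"
      define r where "r i = Sup (snd i)" for i :: "real \<times> real set"
      have piece: "snd i = {l i..r i} \<and> l i \<le> fst i \<and> fst i \<le> r i \<and> {l i..r i} \<subseteq> {a..b} \<and> {l i..r i} \<subseteq> G (fst i)
          \<and> measure lborel (snd i) = r i - l i" if "i \<in> D" for i
      proof -
        obtain t k where i: "i = (t, k)" by (cases i)
        have tk: "(t, k) \<in> D" using that i by simp
        obtain c d where k: "k = cbox c d" using Dp(4)[OF tk] by auto
        have t: "t \<in> k" "k \<subseteq> {a..b}" using Dp(2,3)[OF tk] by auto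
        then have cd: "c \<le> d" using k by auto
        have "k \<subseteq> G t" using fine tk by (auto simp: fine_def)
        then show ?thesis using k t cd by (auto simp: i l_def r_def)
      qed
      have cont: "measure lborel (snd i) = r i - l i" if "i \<in> D" for i
        using piece[OF that] by blast
      have fin: "finite D" by (rule Dp(1))
      have disj: "disjoint_family_on (\<lambda>i. {l i<..<r i}) D"
        unfolding disjoint_family_on_def
      proof (intro ballI impI)
        fix i j assume ij: "i \<in> D" "j \<in> D" "i \<noteq> j"
        have "interior (snd i) \<inter> interior (snd j) = {}"
          using Dp(5)[of "fst i" "snd i" "fst j" "snd j"] ij by auto
        moreover have "interior (snd i) = {l i<..<r i}" "interior (snd j) = {l j<..<r j}"
          using piece[OF ij(1)] piece[OF ij(2)] interior_atLeastAtMost_real by metis+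
        ultimately show "{l i<..<r i} \<inter> {l j<..<r j} = {}" by simp
      qed
      define A B where "A = {i \<in> D. fst i \<in> E}" and "B = {i \<in> D. fst i \<notin> E}"
      have AB: "D = A \<union> B" "A \<inter> B = {}" "finite A" "finite B" using fin by (auto simp: A_def B_def)
      have total: "(\<Sum>i\<in>D. x (r i) - x (l i)) = x b - x a"
        using additive_tagged_division_1[OF ab D, of x] by (simp add: l_def r_def split_def)
      have sumA: "(\<Sum>i\<in>A. norm (x (r i) - x (l i))) < \<epsilon> / 2"
      proof (rule small[rule_format, OF AB(3)])
        show "disjoint_family_on (\<lambda>i. {l i<..<r i}) A"
          using disj by (rule disjoint_family_on_mono[rotated]) (auto simp: A_def)
        \<comment> \<open>The pieces tagged in \<open>E\<close> have disjoint interiors inside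
          \<open>U\<close>, so their total length is at most the measure of
          \<open>U\<close>.\<close>
        have "ennreal (\<Sum>i\<in>A. r i - l i) = (\<Sum>i\<in>A. emeasure lebesgue {l i<..<r i})"
          using piece by (subst sum_ennreal[symmetric]) (force simp: A_def intro!: sum.cong)+
        also have "\<dots> = emeasure lebesgue (\<Union>i\<in>A. {l i<..<r i})"
          using disj AB(1,3) by (intro sum_emeasure) (auto intro: disjoint_family_on_mono)
        also have "\<dots> \<le> emeasure lebesgue U"
        proof (rule emeasure_mono[OF _ Uleb])
          show "(\<Union>i\<in>A. {l i<..<r i}) \<subseteq> U"
          proof (rule UN_least)
            fix i assume "i \<in> A"
            then show "{l i<..<r i} \<subseteq> U"
              using piece[of i] greaterThanLessThan_subseteq_atLeastAtMost_iff[of "l i" "r i" "l i" "r i"]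
              by (auto simp: A_def G_def)
          qed
        qed
        finally have "ennreal (\<Sum>i\<in>A. r i - l i) < ennreal \<delta>" using Ud by simp
        then show "(\<Sum>i\<in>A. r i - l i) < \<delta>" by (meson ennreal_leI leD leI)
      qed (use piece in \<open>force simp: A_def\<close>)
      have sumB: "(\<Sum>i\<in>B. norm ((r i - l i) *\<^sub>R g (fst i) - (x (r i) - x (l i)))) \<le> \<eta> * (b - a)"
      proof -
        have "(\<Sum>i\<in>B. norm ((r i - l i) *\<^sub>R g (fst i) - (x (r i) - x (l i)))) \<le> (\<Sum>i\<in>B. \<eta> * (r i - l i))"
        proof (rule sum_mono)
          fix i assume i: "i \<in> B"
          then have *: "i \<in> D" "fst i \<notin> E" by (auto simp: B_def)
          then have "fst i \<in> {a..b}" using piece[of i] by auto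
          then show "norm ((r i - l i) *\<^sub>R g (fst i) - (x (r i) - x (l i))) \<le> \<eta> * (r i - l i)"
            using piece[OF *(1)] *(2) by (intro \<rho>(2)) (auto simp: G_def)
        qed
        also have "\<dots> \<le> (\<Sum>i\<in>D. \<eta> * (r i - l i))"
          using fin eta piece by (intro sum_mono2) (force simp: B_def)+
        also have "\<dots> = \<eta> * (b - a)"
          using additive_tagged_division_1[OF ab D, of "\<lambda>t. t"] by (simp add: l_def r_def split_def sum_distrib_left[symmetric])
        finally show ?thesis .
      qed
      have "(\<Sum>(t, k)\<in>D. measure lborel k *\<^sub>R g0 t) = (\<Sum>i\<in>D. (r i - l i) *\<^sub>R g0 (fst i))"
        using cont by (simp add: split_def cong: sum.cong)
      also have "\<dots> - (x b - x a) = (\<Sum>i\<in>D. (r i - l i) *\<^sub>R g0 (fst i) - (x (r i) - x (l i)))"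
        by (simp only: sum_subtractf[where g="\<lambda>i. x (r i) - x (l i)"] total)
      also have "\<dots> = (\<Sum>i\<in>A. - (x (r i) - x (l i))) + (\<Sum>i\<in>B. (r i - l i) *\<^sub>R g (fst i) - (x (r i) - x (l i)))"
        unfolding AB(1) sum.union_disjoint[OF AB(3,4,2)]
        by (intro arg_cong2[where f="(+)"] sum.cong) (auto simp: A_def B_def g0_def)
      finally have "norm ((\<Sum>(t, k)\<in>D. measure lborel k *\<^sub>R g0 t) - (x b - x a)) \<le>
          (\<Sum>i\<in>A. norm (x (r i) - x (l i))) + (\<Sum>i\<in>B. norm ((r i - l i) *\<^sub>R g (fst i) - (x (r i) - x (l i))))"
        by (auto intro!: order_trans[OF norm_triangle_ineq] add_mono order_trans[OF norm_sum] simp: norm_minus_commute)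
      then show "norm ((\<Sum>(t, k)\<in>D. measure lborel k *\<^sub>R g0 t) - (x b - x a)) < \<epsilon>"
        using sumA sumB eta(2) by linarith
    qed
  qed
  then show ?thesis by (rule has_integral_spike[OF E, rotated]) (simp add: g0_def)
qed

section \<open>Measurability, uniform distribution and discrete Gronwall\<close>

text \<open>Caratheodory functions: w is approximated by simple functions \<open>s i\<close>. For
  fixed i the composite consists of finitely many measurable pieces, and continuity in w passes to
  the limit.\<close>

lemma caratheodory_measurable:
  fixes F :: "'t \<Rightarrow> 'b::{metric_space, second_countable_topology} \<Rightarrow> 'c::metric_space"
  assumes meas: "\<And>w. (\<lambda>t. F t w) \<in> borel_measurable M"
    and cont: "\<And>t. t \<in> space M \<Longrightarrow> continuous_on UNIV (F t)"
  shows "(\<lambda>(t, w). F t w) \<in> borel_measurable (M \<Otimes>\<^sub>M borel)"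
proof -
  have "(\<lambda>w::'b. w) \<in> borel_measurable borel" by simp
  from borel_measurable_implies_sequence_metric[OF this, of undefined]
  obtain s :: "nat \<Rightarrow> 'b \<Rightarrow> 'b" where s': "(\<forall>i. simple_function borel (s i)) \<and>
      (\<forall>w\<in>space borel. (\<lambda>i. s i w) \<longlonglongrightarrow> w) \<and>
      (\<forall>i. \<forall>w\<in>space borel. dist (s i w) undefined \<le> 2 * dist w undefined)" by blast
  then have s: "\<And>i. simple_function borel (s i)" "\<And>w. (\<lambda>i. s i w) \<longlonglongrightarrow> w" by auto
  show ?thesis
  proof (rule borel_measurable_LIMSEQ_metric[where f="\<lambda>i (t, w). F t (s i w)"])
    fix i
    have fin: "finite (range (s i))" using s(1)[of i] by (simp add: simple_function_def)
    have "s i \<in> measurable borel (count_space (range (s i)))"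
      using s(1)[of i] fin by (subst measurable_count_space_eq2) (auto simp: simple_function_def)
    then have "(\<lambda>z. s i (snd z)) \<in> measurable (M \<Otimes>\<^sub>M borel) (count_space (range (s i)))"
      by (rule measurable_compose[OF measurable_snd])
    then have "(\<lambda>z. F (fst z) (s i (snd z))) \<in> borel_measurable (M \<Otimes>\<^sub>M borel)"
      by (rule measurable_compose_countable'[where f="\<lambda>v z. F (fst z) v", rotated])
        (rule countable_finite[OF fin], rule measurable_compose[OF measurable_fst meas])
    then show "(\<lambda>(t, w). F t (s i w)) \<in> borel_measurable (M \<Otimes>\<^sub>M borel)"
      by (simp add: split_def)
  next
    fix z assume z: "z \<in> space (M \<Otimes>\<^sub>M (borel :: 'b measure))"
    then have "continuous_on UNIV (F (fst z))" by (intro cont) (auto simp: space_pair_measure)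
    then have "(\<lambda>i. F (fst z) (s i (snd z))) \<longlonglongrightarrow> F (fst z) (snd z)"
      using s(2) by (auto intro: continuous_on_tendsto_compose)
    then show "(\<lambda>i. case z of (t, w) \<Rightarrow> F t (s i w)) \<longlonglongrightarrow> (case z of (t, w) \<Rightarrow> F t w)"
      by (simp add: split_def)
  qed
qed

section \<open>Independent products and functions of a uniform variable\<close>

context prob_space
begin

text \<open>The joint law is the product of the marginals, so Tonelli applies without integrability;
  the moments to which it is applied are not yet known to be finite.\<close>

lemma indep_var_nn_integral_mult:
  fixes X Y :: "'a \<Rightarrow> ennreal"
  assumes "indep_var borel X borel Y"
  shows "(\<integral>\<^sup>+\<omega>. X \<omega> * Y \<omega> \<partial>M) = (\<integral>\<^sup>+\<omega>. X \<omega> \<partial>M) * (\<integral>\<^sup>+\<omega>. Y \<omega> \<partial>M)"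
proof -
  have rv [measurable]: "X \<in> borel_measurable M" "Y \<in> borel_measurable M"
    and eq: "distr M borel X \<Otimes>\<^sub>M distr M borel Y = distr M (borel \<Otimes>\<^sub>M borel) (\<lambda>\<omega>. (X \<omega>, Y \<omega>))"
    using assms unfolding indep_var_distribution_eq by auto
  interpret Y: prob_space "distr M borel Y" by (rule prob_space_distr) fact
  have "(\<integral>\<^sup>+\<omega>. X \<omega> * Y \<omega> \<partial>M) = (\<integral>\<^sup>+z. fst z * snd z \<partial>distr M (borel \<Otimes>\<^sub>M borel) (\<lambda>\<omega>. (X \<omega>, Y \<omega>)))"
    by (subst nn_integral_distr) auto
  also have "\<dots> = (\<integral>\<^sup>+x. \<integral>\<^sup>+y. x * y \<partial>distr M borel Y \<partial>distr M borel X)"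
    unfolding eq[symmetric] by (subst Y.nn_integral_fst[symmetric]) auto
  also have "\<dots> = (\<integral>\<^sup>+\<omega>. X \<omega> \<partial>M) * (\<integral>\<^sup>+\<omega>. Y \<omega> \<partial>M)"
    by (simp add: nn_integral_cmult nn_integral_multc nn_integral_distr)
  finally show ?thesis .
qed

text \<open>Jensen's inequality, by integrating the tangent of t^p at the mean.\<close>

lemma expectation_powr_le:
  fixes Z :: "'a \<Rightarrow> real"
  assumes p: "1 \<le> p" and Z: "integrable M Z" "integrable M (\<lambda>\<omega>. Z \<omega> powr p)" "\<And>\<omega>. 0 \<le> Z \<omega>"
  shows "expectation Z powr p \<le> expectation (\<lambda>\<omega>. Z \<omega> powr p)"
proof -
  define m where "m = expectation Z"
  have m: "m \<ge> 0" unfolding m_def using Z(3) by (simp add: integral_nonneg_AE)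
  have "m powr p = m * m powr (p - 1)"
    using m p by (cases "m = 0") (auto simp: powr_diff)
  also have "\<dots> = expectation (\<lambda>\<omega>. Z \<omega> * m powr (p - 1))" using Z(1) by (simp add: m_def)
  also have "\<dots> \<le> expectation (\<lambda>\<omega>. Z \<omega> powr p / p + (1 - 1 / p) * m powr p)"
    using Z m p by (intro integral_mono powr_tangent_le) auto
  also have "\<dots> = expectation (\<lambda>\<omega>. Z \<omega> powr p) / p + (1 - 1 / p) * m powr p"
    using Z(2) by (simp add: prob_space)
  finally have "m powr p / p \<le> expectation (\<lambda>\<omega>. Z \<omega> powr p) / p" by (simp add: algebra_simps)
  then show ?thesis using p by (simp add: m_def divide_le_cancel)
qed

text \<open>The half-open cell makes consecutive cells disjoint, so that their indicators add up;
  the endpoint dropped from [0,1] is a null set.\<close>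

lemma uniform_affine_nn_integral:
  fixes \<phi> :: "real \<Rightarrow> ennreal"
  assumes U: "distributed M lborel U (\<lambda>u. indicator {0..1} u)" and h: "0 < h"
    and [measurable]: "\<phi> \<in> borel_measurable borel"
  shows "ennreal h * (\<integral>\<^sup>+\<omega>. \<phi> (c + h * U \<omega>) \<partial>M) = (\<integral>\<^sup>+u. \<phi> u * indicator {c<..c + h} u \<partial>lborel)"
proof -
  have "(\<integral>\<^sup>+\<omega>. \<phi> (c + h * U \<omega>) \<partial>M) = (\<integral>\<^sup>+u. indicator {0..1} u * \<phi> (c + h * u) \<partial>lborel)"
    by (rule distributed_nn_integral[OF U, symmetric]) simp
  also have "\<dots> = (\<integral>\<^sup>+u. \<phi> (c + h * u) * indicator {c<..c + h} (c + h * u) \<partial>lborel)"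
  proof (rule nn_integral_cong_AE)
    show "AE u in lborel. indicator {0..1} u * \<phi> (c + h * u) = \<phi> (c + h * u) * indicator {c<..c + h} (c + h * u)"
      using AE_lborel_singleton[of "0::real"]
      by eventually_elim (use h in \<open>auto simp: indicator_def zero_less_mult_iff\<close>)
  qed
  finally show ?thesis
    using h nn_integral_real_affine[of "\<lambda>u. \<phi> u * indicator {c<..c + h} u" h c] by simp
qed

text \<open>Vector-valued counterpart, over the closed cell that occurs in the integral equation for
  x.\<close>

lemma uniform_affine_integral:
  fixes \<phi> :: "real \<Rightarrow> 'b::euclidean_space"
  assumes U: "distributed M lborel U (\<lambda>u. indicator {0..1} u)" and h: "0 < h"
    and [measurable]: "\<phi> \<in> borel_measurable borel"
  shows "h *\<^sub>R (\<integral>\<omega>. \<phi> (c + h * U \<omega>) \<partial>M) = (LINT u:{c..c + h}|lborel. \<phi> u)"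
proof -
  have [measurable]: "U \<in> borel_measurable M" using distributed_measurable[OF U] by simp
  have "(\<integral>\<omega>. \<phi> (c + h * U \<omega>) \<partial>M) = (\<integral>u. \<phi> (c + h * u) \<partial>distr M lborel U)"
    by (subst integral_distr) auto
  also have "distr M lborel U = density lborel (\<lambda>u. ennreal (indicator {0..1} u))"
    using distributed_distr_eq_density[OF U] by (simp add: ennreal_indicator)
  also have "(\<integral>u. \<phi> (c + h * u) \<partial>\<dots>) = (\<integral>u. indicator {0..1} u *\<^sub>R \<phi> (c + h * u) \<partial>lborel)"
    by (subst integral_density) auto
  also have "\<dots> = (\<integral>u. indicator {c..c + h} (c + h * u) *\<^sub>R \<phi> (c + h * u) \<partial>lborel)"
    using h by (intro Bochner_Integration.integral_cong) (auto simp: indicator_def zero_le_mult_iff)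
  finally show ?thesis
    using h lborel_integral_real_affine[of h "\<lambda>u. indicator {c..c + h} u *\<^sub>R \<phi> u" c]
    by (simp add: set_lebesgue_integral_def)
qed

lemma AE_uniform_mem:
  assumes U: "distributed M lborel U (\<lambda>u. indicator {0..1::real} u)"
  shows "AE \<omega> in M. U \<omega> \<in> {0..1}"
  by (subst distributed_AE2[OF U]) (auto simp: indicator_def)

text \<open>The law of c + h U is absolutely continuous, so a random evaluation point almost surely
  avoids a given null set of times.\<close>

lemma AE_uniform_affine:
  assumes U: "distributed M lborel U (\<lambda>u. indicator {0..1} u)" and h: "0 < (h::real)"
    and Q: "AE u in lborel. Q u" and [measurable]: "Measurable.pred borel Q"
  shows "AE \<omega> in M. Q (c + h * U \<omega>)"
proof -
  have "AE u in lborel. Q (c + h * u)"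
    using Q h by (subst (asm) lborel_real_affine[of h c]) (auto simp: AE_density AE_distr_iff)
  then show ?thesis by (subst distributed_AE2[OF U]) auto
qed

end

section \<open>Discrete Gronwall inequality in \<open>ennreal\<close>\<close>

lemma sum_prod_one_plus:
  fixes A :: "'a::comm_semiring_1"
  shows "A + (\<Sum>i<(k::nat). b i * (A * (\<Prod>l<i. 1 + b l))) = A * (\<Prod>i<k. 1 + b i)"
  by (induction k) (simp_all add: add.assoc[symmetric] distrib_left distrib_right mult_ac)

text \<open>By \<open>sum_prod_one_plus\<close> the right-hand side solves the recursion with
  equality, and strong induction compares \<open>a\<close> with it. No term of \<open>a\<close> has
  to be finite.\<close>

lemma gronwall_ennreal:
  fixes a b :: "nat \<Rightarrow> ennreal"
  assumes "\<And>k. k \<le> N \<Longrightarrow> a k \<le> A + (\<Sum>i<k. b i * a i)" and "k \<le> N"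
  shows "a k \<le> A * (\<Prod>i<k. 1 + b i)"
  using \<open>k \<le> N\<close>
proof (induction k rule: less_induct)
  case (less k)
  have "a k \<le> A + (\<Sum>i<k. b i * a i)" by (rule assms(1)[OF less.prems])
  also have "\<dots> \<le> A + (\<Sum>i<k. b i * (A * (\<Prod>l<i. 1 + b l)))"
    using less by (intro add_left_mono sum_mono mult_left_mono) auto
  also have "\<dots> = A * (\<Prod>i<k. 1 + b i)"
    by (rule sum_prod_one_plus)
  finally show ?case .
qed

text \<open>The bound on the sum forces each \<open>b i\<close> to be finite; then 1 + t <= exp t
  applies in the reals.\<close>

lemma prod_one_plus_le_exp:
  fixes b :: "nat \<Rightarrow> ennreal"
  assumes "(\<Sum>i<k. b i) \<le> ennreal B" "0 \<le> B"
  shows "(\<Prod>i<k. 1 + b i) \<le> ennreal (exp B)"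
proof -
  define c where "c i = enn2real (b i)" for i
  have fin: "b i = ennreal (c i)" if "i < k" for i
  proof -
    have "b i \<le> (\<Sum>i<k. b i)" using that by (intro member_le_sum) auto
    also have "\<dots> < \<infinity>" using assms(1) by (simp add: order_le_less_trans)
    finally show ?thesis by (simp add: c_def)
  qed
  have c: "c i \<ge> 0" for i by (simp add: c_def)
  have "ennreal (\<Sum>i<k. c i) = (\<Sum>i<k. ennreal (c i))" using c by (intro sum_ennreal[symmetric]) auto
  also have "\<dots> = (\<Sum>i<k. b i)" using fin by (intro sum.cong) auto
  finally have "ennreal (\<Sum>i<k. c i) \<le> ennreal B" using assms(1) by simp
  then have cB: "(\<Sum>i<k. c i) \<le> B" using assms(2) by (simp add: ennreal_le_iff)
  have "(\<Prod>i<k. 1 + b i) = (\<Prod>i<k. ennreal (1 + c i))"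
    using fin c by (intro prod.cong) (auto simp: ennreal_plus)
  also have "\<dots> = ennreal (\<Prod>i<k. 1 + c i)" using c by (intro prod_ennreal) (auto intro: add_nonneg_nonneg)
  also have "\<dots> \<le> ennreal (exp B)"
  proof (rule ennreal_leI)
    have "(\<Prod>i<k. 1 + c i) \<le> (\<Prod>i<k. exp (c i))" using c by (intro prod_mono) (auto intro: add_nonneg_nonneg)
    also have "\<dots> = exp (\<Sum>i<k. c i)" by (simp add: exp_sum)
    also have "\<dots> \<le> exp B" using cB by simp
    finally show "(\<Prod>i<k. 1 + c i) \<le> exp B" .
  qed
  finally show ?thesis .
qed

section \<open>Moments of the error for Borel data\<close>

lemma grid_time_Suc: "grid_time \<tau> N j (Suc i) = grid_time \<tau> N j i + \<tau> / real N"
  by (simp add: grid_time_def algebra_simps add_divide_distrib)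

lemma grid_time_last: "0 < N \<Longrightarrow> grid_time \<tau> N j N = grid_time \<tau> N (Suc j) 0"
  by (simp add: grid_time_def algebra_simps)

lemma grid_time_Suc_row: "grid_time \<tau> N (Suc j) i = grid_time \<tau> N j i + \<tau>"
  by (simp add: grid_time_def algebra_simps)

lemma grid_time_nonneg: "0 \<le> \<tau> \<Longrightarrow> 0 \<le> grid_time \<tau> N j i"
  by (simp add: grid_time_def)

lemma grid_time_le:
  assumes "0 < \<tau>" "i \<le> N" "j \<le> n"
  shows "grid_time \<tau> N j i \<le> real (n + 1) * \<tau>"
proof -
  have "real i * (\<tau> / real N) \<le> \<tau>"
    using assms by (cases "N = 0") (auto simp: divide_le_eq mult.commute mult_left_mono)
  moreover have "real j * \<tau> \<le> real n * \<tau>" using assms by simp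
  ultimately show ?thesis by (simp add: grid_time_def algebra_simps)
qed

text \<open>The indices of the random variables that enter into \<open>y\<^sub>k\<^sup>j\<close>.\<close>

definition past_indices :: "nat \<Rightarrow> nat \<Rightarrow> nat \<Rightarrow> (nat \<times> nat) set" where
  "past_indices N j k = {(j', k'). 1 \<le> k' \<and> (j' < j \<and> k' \<le> N \<or> j' = j \<and> k' \<le> k)}"

text \<open>Allows a realization to be replaced by its restriction to \<open>past_indices\<close>,
  the form in which independence is available. With k <= N, all that is read from earlier rows lies
  in their first N columns.\<close>

lemma rand_euler_cong:
  assumes "\<And>j' k'. (j', k') \<in> past_indices N j k \<Longrightarrow> g j' k' = g' j' k'" "k \<le> N"
  shows "rand_euler f \<tau> x\<^sub>0 N g j k = rand_euler f \<tau> x\<^sub>0 N g' j k"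
  using assms
proof (induction j arbitrary: k)
  case 0
  then show ?case by (induction k) (auto simp: past_indices_def)
next
  case (Suc j)
  note row = Suc.IH
  from Suc.prems show ?case
  proof (induction k)
    case 0
    have "rand_euler f \<tau> x\<^sub>0 N g j N = rand_euler f \<tau> x\<^sub>0 N g' j N"
      by (rule row) (use 0 in \<open>auto simp: past_indices_def\<close>)
    then show ?case by simp
  next
    case (Suc k)
    have "rand_euler f \<tau> x\<^sub>0 N g (Suc j) k = rand_euler f \<tau> x\<^sub>0 N g' (Suc j) k"
      by (rule Suc.IH) (use Suc.prems in \<open>auto simp: past_indices_def\<close>)
    moreover have "rand_euler f \<tau> x\<^sub>0 N g j k = rand_euler f \<tau> x\<^sub>0 N g' j k"
      by (rule row) (use Suc.prems in \<open>auto simp: past_indices_def\<close>)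
    moreover have "g (Suc j) (Suc k) = g' (Suc j) (Suc k)"
      by (rule Suc.prems) (auto simp: past_indices_def)
    ultimately show ?case by simp
  qed
qed

text \<open>The Borel setting of all moment estimates: bounds at every real time, Borel
  \<open>L\<close>, x continuous on the whole line. The differential equation enters only through
  the integral identity \<open>x_ftc\<close>; \<open>g\<close> names the right-hand side along x, so
  that integrability of its powers can be assumed.\<close>

locale rand_euler_error = prob_space M for M :: "'w measure" +
  fixes \<tau> p \<alpha> :: real and n :: nat and x\<^sub>0 :: "'b::euclidean_space"
    and f :: "real \<Rightarrow> 'b \<Rightarrow> 'b \<Rightarrow> 'b" and L :: "real \<Rightarrow> real" and x :: "real \<Rightarrow> 'b"
    and \<gamma> :: "nat \<Rightarrow> nat \<Rightarrow> 'w \<Rightarrow> real" and g :: "real \<Rightarrow> 'b"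
  assumes g_def: "\<And>t. g t = f t (x t) (x (t - \<tau>))"
    and tau: "0 < \<tau>" and p: "2 \<le> p" and alpha: "0 < \<alpha>" "\<alpha> \<le> 1"
    and f_meas: "(\<lambda>(t, w). f t (fst w) (snd w)) \<in> borel_measurable (borel \<Otimes>\<^sub>M borel)"
    and L_meas [measurable]: "L \<in> borel_measurable borel"
    and L_nonneg: "\<And>t. 0 \<le> L t"
    and L_int: "integrable lborel (\<lambda>t. L t powr p)"
    and f_hoelder: "\<And>t y\<^sub>1 y\<^sub>2 z\<^sub>1 z\<^sub>2. norm (f t y\<^sub>1 z\<^sub>1 - f t y\<^sub>2 z\<^sub>2) \<le> L t * (norm (y\<^sub>1 - y\<^sub>2) + norm (z\<^sub>1 - z\<^sub>2) powr \<alpha>)"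
    and x_cont: "continuous_on UNIV x"
    and x_init: "\<And>t. t \<le> 0 \<Longrightarrow> x t = x\<^sub>0"
    and g_int: "integrable lborel g" "integrable lborel (\<lambda>t. (norm (g t))\<^sup>2)" "integrable lborel (\<lambda>t. norm (g t) powr p)"
    and x_ftc: "\<And>s t. 0 \<le> s \<Longrightarrow> s \<le> t \<Longrightarrow> t \<le> real (n + 1) * \<tau> \<Longrightarrow> x t - x s = (LINT u:{s..t}|lborel. g u)"
    and indep: "indep_vars (\<lambda>_. borel) (\<lambda>(j, k). \<gamma> j k) (UNIV \<times> {1..})"
    and uniform: "\<And>j k. 1 \<le> k \<Longrightarrow> distributed M lborel (\<gamma> j k) (\<lambda>u. indicator {0..1} u)"
begin

lemma f_measurable [measurable (raw)]:
  assumes [measurable]: "a \<in> borel_measurable N" "b \<in> borel_measurable N" "c \<in> borel_measurable N"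
  shows "(\<lambda>\<omega>. f (a \<omega>) (b \<omega>) (c \<omega>)) \<in> borel_measurable N"
proof -
  have "(\<lambda>\<omega>. (a \<omega>, (b \<omega>, c \<omega>))) \<in> measurable N (borel \<Otimes>\<^sub>M borel)" by measurable
  from measurable_compose[OF this f_meas] show ?thesis by simp
qed

lemma x_measurable [measurable]: "x \<in> borel_measurable borel"
  using x_cont by (rule borel_measurable_continuous_onI)

lemma g_measurable [measurable]: "g \<in> borel_measurable borel"
  unfolding g_def[abs_def] by measurable

lemma \<gamma>_measurable [measurable]: "1 \<le> k \<Longrightarrow> \<gamma> j k \<in> borel_measurable M"
  using distributed_measurable[OF uniform[of k j]] by simp

text \<open>Integrating (1 / sqrt h + sqrt h |g|^2) / 2 over an interval of length at most h gives
  at most G * sqrt h.\<close>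

definition G :: real where "G = (1 + (\<integral>t. (norm (g t))\<^sup>2 \<partial>lborel)) / 2"

lemma G_pos: "0 < G"
proof -
  have "0 \<le> (\<integral>t. (norm (g t))\<^sup>2 \<partial>lborel)" by (rule integral_nonneg_AE) auto
  then show ?thesis unfolding G_def by (intro divide_pos_pos add_pos_nonneg) auto
qed

text \<open>By AM-GM, \<open>2 |g| \<le> 1 / sqrt h + sqrt h |g|\<^sup>2\<close>.\<close>

lemma x_increment_le:
  assumes "0 \<le> s" "s \<le> t" "t \<le> real (n + 1) * \<tau>" "t - s \<le> h" "0 < h"
  shows "norm (x t - x s) \<le> G * sqrt h"
proof -
  have am: "\<bar>z\<bar> \<le> (1 / sqrt h + sqrt h * z\<^sup>2) / 2" for z :: real
  proof -
    have "0 \<le> (1 - sqrt h * \<bar>z\<bar>)\<^sup>2" by simp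
    then have "2 * (sqrt h * \<bar>z\<bar>) \<le> 1 + h * z\<^sup>2"
      using assms(5) by (simp add: power2_diff power_mult_distrib)
    then have "2 * (sqrt h * \<bar>z\<bar>) / sqrt h \<le> (1 + h * z\<^sup>2) / sqrt h"
      using assms(5) by (intro divide_right_mono) auto
    moreover have "(1 + h * z\<^sup>2) / sqrt h = 1 / sqrt h + sqrt h * z\<^sup>2"
      using assms(5) real_div_sqrt[of h] by (simp add: add_divide_distrib flip: times_divide_eq_left)
    ultimately show ?thesis using assms(5) by simp
  qed
  have ind: "integrable lborel (indicator {s..t} :: real \<Rightarrow> real)"
    using assms(2) by (intro integrable_real_indicator) auto
  have "norm (x t - x s) \<le> (\<integral>u. norm (indicator {s..t} u *\<^sub>R g u) \<partial>lborel)"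
    unfolding x_ftc[OF assms(1-3)] set_lebesgue_integral_def by (rule integral_norm_bound)
  also have "\<dots> \<le> (\<integral>u. 1 / (2 * sqrt h) * indicator {s..t} u + sqrt h / 2 * (norm (g u))\<^sup>2 \<partial>lborel)"
  proof (rule integral_mono)
    show "integrable lborel (\<lambda>u. norm (indicator {s..t} u *\<^sub>R g u))"
      by (intro integrable_norm integrable_mult_indicator) (use g_int in auto)
    show "integrable lborel (\<lambda>u. 1 / (2 * sqrt h) * indicator {s..t} u + sqrt h / 2 * (norm (g u))\<^sup>2)"
      by (intro Bochner_Integration.integrable_add integrable_mult_right ind g_int(2))
    show "norm (indicator {s..t} u *\<^sub>R g u) \<le> 1 / (2 * sqrt h) * indicator {s..t} u + sqrt h / 2 * (norm (g u))\<^sup>2" for u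
      using am[of "norm (g u)"] assms(5) by (auto simp: indicator_def field_simps)
  qed
  also have "\<dots> = 1 / (2 * sqrt h) * (t - s) + sqrt h / 2 * (\<integral>u. (norm (g u))\<^sup>2 \<partial>lborel)"
  proof -
    have "(\<integral>u. 1 / (2 * sqrt h) * indicator {s..t} u + sqrt h / 2 * (norm (g u))\<^sup>2 \<partial>lborel) =
        (\<integral>u. 1 / (2 * sqrt h) * indicator {s..t} u \<partial>lborel) + (\<integral>u. sqrt h / 2 * (norm (g u))\<^sup>2 \<partial>lborel)"
      by (intro Bochner_Integration.integral_add integrable_mult_right ind g_int(2))
    then show ?thesis using assms(2) by simp
  qed
  also have "\<dots> \<le> 1 / (2 * sqrt h) * h + sqrt h / 2 * (\<integral>u. (norm (g u))\<^sup>2 \<partial>lborel)"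
    using assms by (intro add_right_mono mult_left_mono) auto
  also have "\<dots> = G * sqrt h"
    using assms(5) by (simp add: G_def real_div_sqrt algebra_simps add_divide_distrib)
  finally show ?thesis .
qed

section \<open>Error decomposition in a row, for fixed N\<close>

context
  fixes N :: nat and h :: real
  assumes N: "\<tau> \<le> real N"
  defines "h \<equiv> \<tau> / real N"
begin

lemma N_pos: "0 < N"
  using N tau by (cases N) auto

lemma h_pos: "0 < h"
  using tau N_pos by (simp add: h_def)

lemma h_le_1: "h \<le> 1"
  using N N_pos by (simp add: h_def divide_le_eq)

definition y :: "nat \<Rightarrow> nat \<Rightarrow> 'w \<Rightarrow> 'b" where
  "y j k \<omega> = rand_euler f \<tau> x\<^sub>0 N (\<lambda>j k. \<gamma> j k \<omega>) j k"

definition y_prev :: "nat \<Rightarrow> nat \<Rightarrow> 'w \<Rightarrow> 'b" where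
  "y_prev j k \<omega> = (case j of 0 \<Rightarrow> x\<^sub>0 | Suc j' \<Rightarrow> y j' k \<omega>)"

definition err :: "nat \<Rightarrow> nat \<Rightarrow> 'w \<Rightarrow> 'b" where
  "err j k \<omega> = x (grid_time \<tau> N j k) - y j k \<omega>"

text \<open>Evaluation point of the step from k to k + 1. Its random variable has index
  \<open>Suc k\<close> and so lies outside the past of \<open>y j k\<close>.\<close>

definition \<theta> :: "nat \<Rightarrow> nat \<Rightarrow> 'w \<Rightarrow> real" where
  "\<theta> j k \<omega> = grid_time \<tau> N j k + h * \<gamma> j (Suc k) \<omega>"

definition noise :: "nat \<Rightarrow> nat \<Rightarrow> 'w \<Rightarrow> 'b" where
  "noise j i \<omega> = (x (grid_time \<tau> N j (Suc i)) - x (grid_time \<tau> N j i)) - h *\<^sub>R g (\<theta> j i \<omega>)"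

definition drift :: "nat \<Rightarrow> nat \<Rightarrow> 'w \<Rightarrow> 'b" where
  "drift j i \<omega> = g (\<theta> j i \<omega>) - f (\<theta> j i \<omega>) (y j i \<omega>) (y_prev j i \<omega>)"

text \<open>The first G * sqrt h pays for moving x from the random point to the grid point. In later
  rows the delayed argument has a displacement of its own, to the power \<alpha>; in row 0 it is
  exactly \<open>x\<^sub>0\<close>.\<close>

definition delay_err :: "nat \<Rightarrow> nat \<Rightarrow> 'w \<Rightarrow> real" where
  "delay_err j i \<omega> = G * sqrt h +
     (case j of 0 \<Rightarrow> 0 | Suc j' \<Rightarrow> norm (err j' i \<omega>) powr \<alpha> + (G * sqrt h) powr \<alpha>)"

lemma delay_err_nonneg [simp]: "0 \<le> delay_err j i \<omega>"
  using G_pos h_pos by (auto simp: delay_err_def split: nat.split)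

lemma y_Suc: "y j (Suc k) \<omega> = y j k \<omega> + h *\<^sub>R f (\<theta> j k \<omega>) (y j k \<omega>) (y_prev j k \<omega>)"
  by (cases j) (simp_all add: y_def y_prev_def \<theta>_def h_def)

lemma err_0_0: "err 0 0 \<omega> = 0"
  using x_init[of 0] by (simp add: err_def y_def grid_time_def)

lemma err_Suc_0: "err (Suc j) 0 \<omega> = err j N \<omega>"
  using grid_time_last[OF N_pos] by (simp add: err_def y_def)

lemma err_eq: "err j k \<omega> = err j 0 \<omega> + (\<Sum>i<k. noise j i \<omega>) + h *\<^sub>R (\<Sum>i<k. drift j i \<omega>)"
proof (induction k)
  case (Suc k)
  have "err j (Suc k) \<omega> = err j k \<omega> + noise j k \<omega> + h *\<^sub>R drift j k \<omega>"
    by (simp add: err_def noise_def drift_def y_Suc algebra_simps)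
  then show ?case using Suc by (simp add: algebra_simps)
qed simp

text \<open>Errors are known at grid times while \<open>f\<close> is evaluated at the random time s,
  so x is first moved from s to the grid point, in the current and in the delayed argument.\<close>

lemma drift_le:
  assumes ji: "j \<le> n" "i < N" and \<gamma>01: "\<gamma> j (Suc i) \<omega> \<in> {0..1}"
  shows "norm (drift j i \<omega>) \<le> L (\<theta> j i \<omega>) * (norm (err j i \<omega>) + delay_err j i \<omega>)"
proof -
  define t where "t = grid_time \<tau> N j i"
  define s where "s = \<theta> j i \<omega>"
  have s: "t \<le> s" "s \<le> t + h" "s - t \<le> h"
    using \<gamma>01 h_pos by (auto simp: s_def t_def \<theta>_def mult_left_le)
  have t0: "0 \<le> t" using tau by (simp add: t_def grid_time_nonneg)
  have th: "t + h \<le> real (n + 1) * \<tau>"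
    using grid_time_le[of \<tau> "Suc i" N j n] ji tau by (simp add: grid_time_Suc t_def h_def)
  have "norm (x s - x t) \<le> G * sqrt h"
    using s t0 th h_pos by (intro x_increment_le) auto
  then have 1: "norm (x s - y j i \<omega>) \<le> norm (err j i \<omega>) + G * sqrt h"
    using norm_triangle_ineq[of "x s - x t" "x t - y j i \<omega>"] by (simp add: err_def t_def)
  have 2: "norm (x (s - \<tau>) - y_prev j i \<omega>) powr \<alpha>
      \<le> (case j of 0 \<Rightarrow> 0 | Suc j' \<Rightarrow> norm (err j' i \<omega>) powr \<alpha> + (G * sqrt h) powr \<alpha>)"
  proof (cases j)
    case 0
    \<comment> \<open>In row 0 the step ends by \<tau>, so s - \<tau> <= 0 and both delayed values
      are \<open>x\<^sub>0\<close>.\<close>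
    have "t + h \<le> \<tau>" using grid_time_le[of \<tau> "Suc i" N j 0] ji tau 0 by (simp add: grid_time_Suc t_def h_def)
    then show ?thesis using s x_init[of "s - \<tau>"] 0 alpha by (simp add: y_prev_def)
  next
    case (Suc j')
    define t' where "t' = grid_time \<tau> N j' i"
    have t': "t = t' + \<tau>" "0 \<le> t'" using tau by (auto simp: t_def t'_def Suc grid_time_Suc_row grid_time_nonneg)
    have "norm (x (s - \<tau>) - x t') \<le> G * sqrt h"
      using s t' th h_pos tau by (intro x_increment_le) auto
    then have "norm (x (s - \<tau>) - y j' i \<omega>) \<le> norm (err j' i \<omega>) + G * sqrt h"
      using norm_triangle_ineq[of "x (s - \<tau>) - x t'" "x t' - y j' i \<omega>"] by (simp add: err_def t'_def)
    then have "norm (x (s - \<tau>) - y j' i \<omega>) powr \<alpha> \<le> (norm (err j' i \<omega>) + G * sqrt h) powr \<alpha>"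
      using alpha by (intro powr_mono2) auto
    also have "\<dots> \<le> norm (err j' i \<omega>) powr \<alpha> + (G * sqrt h) powr \<alpha>"
      using alpha G_pos h_pos by (intro powr_add_le_add_powr) auto
    finally show ?thesis by (simp add: Suc y_prev_def)
  qed
  have "norm (drift j i \<omega>) \<le> L s * (norm (x s - y j i \<omega>) + norm (x (s - \<tau>) - y_prev j i \<omega>) powr \<alpha>)"
    unfolding drift_def g_def s_def by (rule f_hoelder)
  also have "\<dots> \<le> L s * (norm (err j i \<omega>) + delay_err j i \<omega>)"
    using 1 2 L_nonneg by (intro mult_left_mono) (auto simp: delay_err_def)
  finally show ?thesis by (simp add: s_def)
qed

section \<open>Measurability of the error as a function of the past\<close>

lemma rand_euler_measurable:
  assumes "past_indices N j k \<subseteq> A" "k \<le> N"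
  shows "(\<lambda>v. rand_euler f \<tau> x\<^sub>0 N (\<lambda>j k. v (j, k)) j k) \<in> borel_measurable (PiM A (\<lambda>_. borel))"
  using assms
proof (induction j arbitrary: k)
  case 0
  then show ?case
  proof (induction k)
    case (Suc k)
    have [measurable]: "(\<lambda>v. v (0, Suc k)) \<in> borel_measurable (PiM A (\<lambda>_. borel :: real measure))"
      by (rule measurable_component_singleton) (use Suc.prems in \<open>auto simp: past_indices_def\<close>)
    have [measurable]: "(\<lambda>v. rand_euler f \<tau> x\<^sub>0 N (\<lambda>j k. v (j, k)) 0 k) \<in> borel_measurable (PiM A (\<lambda>_. borel))"
      by (rule Suc.IH) (use Suc.prems in \<open>auto simp: past_indices_def\<close>)
    show ?case by simp
  qed simp
next
  case (Suc j)
  note row = Suc.IH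
  from Suc.prems show ?case
  proof (induction k)
    case 0
    have "past_indices N j N \<subseteq> A" using 0 by (auto simp: past_indices_def)
    then show ?case using row[of N] by simp
  next
    case (Suc k)
    have [measurable]: "(\<lambda>v. v (Suc j, Suc k)) \<in> borel_measurable (PiM A (\<lambda>_. borel :: real measure))"
      by (rule measurable_component_singleton) (use Suc.prems in \<open>auto simp: past_indices_def\<close>)
    have [measurable]: "(\<lambda>v. rand_euler f \<tau> x\<^sub>0 N (\<lambda>j k. v (j, k)) (Suc j) k) \<in> borel_measurable (PiM A (\<lambda>_. borel))"
      by (rule Suc.IH) (use Suc.prems in \<open>auto simp: past_indices_def\<close>)
    have [measurable]: "(\<lambda>v. rand_euler f \<tau> x\<^sub>0 N (\<lambda>j k. v (j, k)) j k) \<in> borel_measurable (PiM A (\<lambda>_. borel))"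
      by (rule row) (use Suc.prems in \<open>auto simp: past_indices_def\<close>)
    show ?case by simp
  qed
qed

text \<open>This makes the error at step \<open>i\<close> independent of the next evaluation point.\<close>

lemma err_function_of_past:
  assumes i: "i < N"
  obtains X where "X \<in> borel_measurable (PiM (past_indices N j i) (\<lambda>_. borel))"
    "\<And>\<omega>. norm (err j i \<omega>) + delay_err j i \<omega> = X (\<lambda>l\<in>past_indices N j i. (case l of (j, k) \<Rightarrow> \<gamma> j k) \<omega>)"
proof -
  define A where "A = past_indices N j i"
  define Y where "Y j' v = rand_euler f \<tau> x\<^sub>0 N (\<lambda>j k. v (j, k)) j' i" for j' and v :: "nat \<times> nat \<Rightarrow> real"
  define e where "e j' v = x (grid_time \<tau> N j' i) - Y j' v" for j' v
  define X where "X v = norm (e j v) + (G * sqrt h +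
     (case j of 0 \<Rightarrow> 0 | Suc j' \<Rightarrow> norm (e j' v) powr \<alpha> + (G * sqrt h) powr \<alpha>))" for v
  \<comment> \<open>Row j - 1 enters through the delayed error; since i < N, its past lies in that
    of row j.\<close>
  have sub: "past_indices N j' i \<subseteq> A" if "j = j' \<or> j = Suc j'" for j'
    using that i by (auto simp: A_def past_indices_def)
  have meas: "e j' \<in> borel_measurable (PiM A (\<lambda>_. borel))" if "j = j' \<or> j = Suc j'" for j'
    unfolding e_def Y_def using rand_euler_measurable[OF sub[OF that]] i by simp
  have "e j' (\<lambda>l\<in>A. (case l of (j, k) \<Rightarrow> \<gamma> j k) \<omega>) = err j' i \<omega>" if "j = j' \<or> j = Suc j'" for j' \<omega>
    unfolding e_def err_def Y_def y_def using sub[OF that] i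
    by (intro arg_cong2[where f="(-)"] refl rand_euler_cong) auto
  then have "norm (err j i \<omega>) + delay_err j i \<omega> = X (\<lambda>l\<in>A. (case l of (j, k) \<Rightarrow> \<gamma> j k) \<omega>)" for \<omega>
    unfolding X_def delay_err_def by (cases j) auto
  moreover have "X \<in> borel_measurable (PiM A (\<lambda>_. borel))"
  proof (cases j)
    case 0
    then show ?thesis using meas[of j] unfolding X_def by simp
  next
    case (Suc j')
    then show ?thesis using meas[of j] meas[of j'] unfolding X_def by simp
  qed
  ultimately show ?thesis using that by (simp add: A_def)
qed

lemma y_measurable [measurable]:
  assumes "k \<le> N"
  shows "y j k \<in> borel_measurable M"
proof -
  have "(\<lambda>\<omega>. \<lambda>l\<in>past_indices N j k. (case l of (j, k) \<Rightarrow> \<gamma> j k) \<omega>) \<in>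
      measurable M (PiM (past_indices N j k) (\<lambda>_. borel))"
    by (intro measurable_restrict) (auto simp: past_indices_def split: prod.splits)
  from measurable_compose[OF this rand_euler_measurable[OF order_refl assms]]
  have "(\<lambda>\<omega>. rand_euler f \<tau> x\<^sub>0 N (\<lambda>j' k'. (\<lambda>l\<in>past_indices N j k. (case l of (j, k) \<Rightarrow> \<gamma> j k) \<omega>) (j', k')) j k)
      \<in> borel_measurable M" .
  also have "(\<lambda>\<omega>. rand_euler f \<tau> x\<^sub>0 N (\<lambda>j' k'. (\<lambda>l\<in>past_indices N j k. (case l of (j, k) \<Rightarrow> \<gamma> j k) \<omega>) (j', k')) j k) = y j k"
    unfolding y_def by (intro ext rand_euler_cong assms) auto
  finally show ?thesis .
qed

lemma err_measurable [measurable]: "k \<le> N \<Longrightarrow> err j k \<in> borel_measurable M"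
  unfolding err_def[abs_def] by measurable

lemma \<theta>_measurable [measurable]: "\<theta> j i \<in> borel_measurable M"
  unfolding \<theta>_def[abs_def] by measurable

lemma noise_measurable [measurable]: "noise j i \<in> borel_measurable M"
  unfolding noise_def[abs_def] by measurable

lemma delay_err_measurable [measurable]: "i \<le> N \<Longrightarrow> delay_err j i \<in> borel_measurable M"
  unfolding delay_err_def[abs_def] by (cases j) auto

text \<open>The index (j, Suc i) is not in the past of the error, so the mean factorizes; times h,
  the mean of L^p at the random point is its integral over the cell.\<close>

lemma L_err_independent:
  assumes i: "i < N"
  shows "ennreal h * (\<integral>\<^sup>+\<omega>. ennreal (L (\<theta> j i \<omega>) powr p) * ennreal ((norm (err j i \<omega>) + delay_err j i \<omega>) powr p) \<partial>M) =
    (\<integral>\<^sup>+t. ennreal (L t powr p) * indicator {grid_time \<tau> N j i<..grid_time \<tau> N j (Suc i)} t \<partial>lborel) *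
    (\<integral>\<^sup>+\<omega>. ennreal ((norm (err j i \<omega>) + delay_err j i \<omega>) powr p) \<partial>M)"
proof -
  obtain X where [measurable]: "X \<in> borel_measurable (PiM (past_indices N j i) (\<lambda>_. borel))"
    and X: "\<And>\<omega>. norm (err j i \<omega>) + delay_err j i \<omega> = X (\<lambda>l\<in>past_indices N j i. (case l of (j, k) \<Rightarrow> \<gamma> j k) \<omega>)"
    using err_function_of_past[OF i] by blast
  have past: "past_indices N j i \<subseteq> UNIV \<times> {1..}" "(j, Suc i) \<in> UNIV \<times> {1..}" "(j, Suc i) \<notin> past_indices N j i"
    by (auto simp: past_indices_def)
  have "indep_var borel (\<lambda>\<omega>. (\<lambda>v. ennreal (X v powr p)) (\<lambda>l\<in>past_indices N j i. (case l of (j, k) \<Rightarrow> \<gamma> j k) \<omega>))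
     borel (\<lambda>\<omega>. (\<lambda>u. ennreal (L (grid_time \<tau> N j i + h * u) powr p)) ((case (j, Suc i) of (j, k) \<Rightarrow> \<gamma> j k) \<omega>))"
    by (rule indep_var_past[OF indep past]) auto
  from indep_var_nn_integral_mult[OF this]
  have "(\<integral>\<^sup>+\<omega>. ennreal (L (\<theta> j i \<omega>) powr p) * ennreal ((norm (err j i \<omega>) + delay_err j i \<omega>) powr p) \<partial>M) =
     (\<integral>\<^sup>+\<omega>. ennreal (L (grid_time \<tau> N j i + h * \<gamma> j (Suc i) \<omega>) powr p) \<partial>M) *
     (\<integral>\<^sup>+\<omega>. ennreal ((norm (err j i \<omega>) + delay_err j i \<omega>) powr p) \<partial>M)"
    by (simp add: X[symmetric] \<theta>_def mult.commute)
  moreover have "ennreal h * (\<integral>\<^sup>+\<omega>. ennreal (L (grid_time \<tau> N j i + h * \<gamma> j (Suc i) \<omega>) powr p) \<partial>M) =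
     (\<integral>\<^sup>+t. ennreal (L t powr p) * indicator {grid_time \<tau> N j i<..grid_time \<tau> N j (Suc i)} t \<partial>lborel)"
    using uniform_affine_nn_integral[OF uniform h_pos, of "Suc i" "\<lambda>t. ennreal (L t powr p)" "grid_time \<tau> N j i" j]
    by (simp add: grid_time_Suc h_def)
  ultimately show ?thesis by (simp add: mult.assoc[symmetric])
qed


text \<open>Indicators of adjacent half-open cells add up to that of one interval. This bounds the
  total Gronwall weight independently of N.\<close>

lemma nn_integral_increments_le:
  fixes \<phi> :: "real \<Rightarrow> ennreal"
  assumes [measurable]: "\<phi> \<in> borel_measurable borel"
  shows "(\<Sum>i<k. \<integral>\<^sup>+t. \<phi> t * indicator {grid_time \<tau> N j i<..grid_time \<tau> N j (Suc i)} t \<partial>lborel) \<le> (\<integral>\<^sup>+t. \<phi> t \<partial>lborel)"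
proof -
  have ind: "(\<Sum>i<k. indicator {grid_time \<tau> N j i<..grid_time \<tau> N j (Suc i)} t) =
      (indicator {grid_time \<tau> N j 0<..grid_time \<tau> N j k} t :: ennreal)" for t
  proof (induction k)
    case (Suc k)
    have "grid_time \<tau> N j 0 \<le> grid_time \<tau> N j k" "grid_time \<tau> N j k \<le> grid_time \<tau> N j (Suc k)"
      using tau by (auto simp: grid_time_def intro!: mult_right_mono divide_right_mono)
    then show ?case using Suc by (auto simp: indicator_def)
  qed simp
  have "(\<Sum>i<k. \<integral>\<^sup>+t. \<phi> t * indicator {grid_time \<tau> N j i<..grid_time \<tau> N j (Suc i)} t \<partial>lborel)
      = (\<integral>\<^sup>+t. \<phi> t * indicator {grid_time \<tau> N j 0<..grid_time \<tau> N j k} t \<partial>lborel)"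
    by (subst nn_integral_sum[symmetric]) (auto simp: ind[symmetric] sum_distrib_left)
  also have "\<dots> \<le> (\<integral>\<^sup>+t. \<phi> t \<partial>lborel)"
    by (intro nn_integral_mono) (auto simp: indicator_def)
  finally show ?thesis .
qed

section \<open>Moments of the quadrature error\<close>

definition g_cell :: "nat \<Rightarrow> nat \<Rightarrow> ennreal" where
  "g_cell j i = (\<integral>\<^sup>+t. ennreal (norm (g t) powr p) *
     indicator {grid_time \<tau> N j i<..grid_time \<tau> N j (Suc i)} t \<partial>lborel)"

lemma nn_integral_g_powr: "(\<integral>\<^sup>+t. ennreal (norm (g t) powr p) \<partial>lborel) = ennreal (\<integral>t. norm (g t) powr p \<partial>lborel)"
  using g_int(3) by (intro nn_integral_eq_integral) auto

lemma sum_g_cell_le: "(\<Sum>i<k. g_cell j i) \<le> ennreal (\<integral>t. norm (g t) powr p \<partial>lborel)"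
  unfolding g_cell_def nn_integral_g_powr[symmetric] by (rule nn_integral_increments_le) simp

lemma g_\<theta>_moment: "ennreal h * (\<integral>\<^sup>+\<omega>. ennreal (norm (g (\<theta> j i \<omega>)) powr p) \<partial>M) = g_cell j i"
  using uniform_affine_nn_integral[OF uniform h_pos, of "Suc i" "\<lambda>t. ennreal (norm (g t) powr p)" "grid_time \<tau> N j i" j]
  by (simp add: grid_time_Suc h_def \<theta>_def g_cell_def)

lemma g_\<theta>_integrable:
  "integrable M (\<lambda>\<omega>. norm (g (\<theta> j i \<omega>)) powr p)"
  "integrable M (\<lambda>\<omega>. g (\<theta> j i \<omega>))"
proof -
  have "g_cell j i \<le> ennreal (\<integral>t. norm (g t) powr p \<partial>lborel)"
    by (rule order_trans[OF _ sum_g_cell_le[where k="Suc i" and j=j]]) (auto intro: member_le_sum)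
  then have "ennreal h * (\<integral>\<^sup>+\<omega>. ennreal (norm (g (\<theta> j i \<omega>)) powr p) \<partial>M) < \<infinity>"
    unfolding g_\<theta>_moment by (simp add: order_le_less_trans)
  then have "(\<integral>\<^sup>+\<omega>. ennreal (norm (g (\<theta> j i \<omega>)) powr p) \<partial>M) < \<infinity>"
    using h_pos by (auto simp: ennreal_mult_less_top)
  then show 1: "integrable M (\<lambda>\<omega>. norm (g (\<theta> j i \<omega>)) powr p)"
    by (intro integrableI_bounded) auto
  show "integrable M (\<lambda>\<omega>. g (\<theta> j i \<omega>))"
  proof (rule Bochner_Integration.integrable_bound)
    show "integrable M (\<lambda>\<omega>. 1 + norm (g (\<theta> j i \<omega>)) powr p)" using 1 by simp
    have "z \<le> 1 + z powr p" if "0 \<le> z" for z :: real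
      using powr_mono[of 1 p z] that p by (cases "z \<le> 1") (auto simp: add_increasing2)
    then show "AE \<omega> in M. norm (g (\<theta> j i \<omega>)) \<le> norm (1 + norm (g (\<theta> j i \<omega>)) powr p)" by auto
  qed simp
qed

text \<open>The randomized quadrature is unbiased: the integral of \<open>g\<close> over a cell is h
  times the mean of \<open>g\<close> at a uniform point of it.\<close>

lemma increment_eq_expectation:
  assumes "j \<le> n" "i < N"
  shows "x (grid_time \<tau> N j (Suc i)) - x (grid_time \<tau> N j i) = h *\<^sub>R (\<integral>\<omega>. g (\<theta> j i \<omega>) \<partial>M)"
  using uniform_affine_integral[OF uniform h_pos, of "Suc i" g "grid_time \<tau> N j i" j]
    x_ftc[of "grid_time \<tau> N j i" "grid_time \<tau> N j (Suc i)"] grid_time_le[of \<tau> "Suc i" N j n] assms tau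
  by (simp add: \<theta>_def grid_time_nonneg grid_time_Suc h_def)

lemma noise_mean: "j \<le> n \<Longrightarrow> i < N \<Longrightarrow> (\<integral>\<omega>. noise j i \<omega> \<partial>M) = 0"
  unfolding noise_def[abs_def] increment_eq_expectation using g_\<theta>_integrable(2)[of j i]
  by (simp add: increment_eq_expectation prob_space)

text \<open>The noise is h times the deviation of \<open>g\<close> at the random point from its
  mean. By Jensen both parts have the same moment bound, giving 2^(p-1) * 2; one of the p factors h
  turns the moment into a cell integral.\<close>

lemma noise_moment:
  assumes "j \<le> n" "i < N"
  shows "integrable M (\<lambda>\<omega>. norm (noise j i \<omega>) powr p)"
    and "ennreal (\<integral>\<omega>. norm (noise j i \<omega>) powr p \<partial>M) \<le> ennreal (2 powr p * h powr (p - 1)) * g_cell j i"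
proof -
  define m where "m = (\<integral>\<omega>. norm (g (\<theta> j i \<omega>)) powr p \<partial>M)"
  have "norm (\<integral>\<omega>. g (\<theta> j i \<omega>) \<partial>M) powr p \<le> (\<integral>\<omega>. norm (g (\<theta> j i \<omega>)) \<partial>M) powr p"
    using p by (intro powr_mono2 integral_norm_bound) auto
  also have "\<dots> \<le> m"
    unfolding m_def using g_\<theta>_integrable[of j i] p by (intro expectation_powr_le) auto
  finally have E: "norm (\<integral>\<omega>. g (\<theta> j i \<omega>) \<partial>M) powr p \<le> m" .
  have le: "norm (noise j i \<omega>) powr p \<le> 2 powr (p - 1) * h powr p * (m + norm (g (\<theta> j i \<omega>)) powr p)" for \<omega>
  proof -
    have "noise j i \<omega> = h *\<^sub>R ((\<integral>\<omega>. g (\<theta> j i \<omega>) \<partial>M) - g (\<theta> j i \<omega>))"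
      using increment_eq_expectation[OF assms] by (simp add: noise_def scaleR_diff_right)
    then have "norm (noise j i \<omega>) \<le> h * (norm (\<integral>\<omega>. g (\<theta> j i \<omega>) \<partial>M) + norm (g (\<theta> j i \<omega>)))"
      using h_pos by (simp add: norm_triangle_ineq4)
    then have "norm (noise j i \<omega>) powr p \<le> (h * (norm (\<integral>\<omega>. g (\<theta> j i \<omega>) \<partial>M) + norm (g (\<theta> j i \<omega>)))) powr p"
      using p by (intro powr_mono2) auto
    also have "\<dots> = h powr p * (norm (\<integral>\<omega>. g (\<theta> j i \<omega>) \<partial>M) + norm (g (\<theta> j i \<omega>))) powr p"
      using h_pos by (simp add: powr_mult)
    also have "\<dots> \<le> h powr p * (2 powr (p - 1) * (norm (\<integral>\<omega>. g (\<theta> j i \<omega>) \<partial>M) powr p + norm (g (\<theta> j i \<omega>)) powr p))"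
      using p by (intro mult_left_mono powr_add_le) auto
    also have "\<dots> \<le> h powr p * (2 powr (p - 1) * (m + norm (g (\<theta> j i \<omega>)) powr p))"
      using E by (intro mult_left_mono add_right_mono) auto
    finally show ?thesis by (simp add: mult_ac)
  qed
  have int: "integrable M (\<lambda>\<omega>. 2 powr (p - 1) * h powr p * (m + norm (g (\<theta> j i \<omega>)) powr p))"
    using g_\<theta>_integrable(1)[of j i] by simp
  show noise_int: "integrable M (\<lambda>\<omega>. norm (noise j i \<omega>) powr p)"
  proof (rule Bochner_Integration.integrable_bound[OF int])
    show "AE \<omega> in M. norm (norm (noise j i \<omega>) powr p) \<le>
        norm (2 powr (p - 1) * h powr p * (m + norm (g (\<theta> j i \<omega>)) powr p))"
    proof (rule AE_I2)
      fix \<omega> show "norm (norm (noise j i \<omega>) powr p) \<le>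
          norm (2 powr (p - 1) * h powr p * (m + norm (g (\<theta> j i \<omega>)) powr p))"
        using order_trans[OF le[of \<omega>] abs_ge_self] by simp
    qed
  qed simp
  have "(\<integral>\<omega>. norm (noise j i \<omega>) powr p \<partial>M) \<le> (\<integral>\<omega>. 2 powr (p - 1) * h powr p * (m + norm (g (\<theta> j i \<omega>)) powr p) \<partial>M)"
    using le by (intro integral_mono noise_int int)
  also have "\<dots> = 2 powr (p - 1) * h powr p * (2 * m)"
    using g_\<theta>_integrable(1)[of j i] by (simp add: prob_space m_def)
  also have "\<dots> = 2 powr p * h powr (p - 1) * (h * m)"
    using h_pos by (simp add: powr_diff)
  finally have "ennreal (\<integral>\<omega>. norm (noise j i \<omega>) powr p \<partial>M) \<le> ennreal (2 powr p * h powr (p - 1)) * ennreal (h * m)"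
    by (subst ennreal_mult[symmetric]) (use h_pos in \<open>auto intro!: ennreal_leI simp: m_def\<close>)
  also have "ennreal (h * m) = g_cell j i"
    unfolding g_\<theta>_moment[symmetric] m_def using h_pos g_\<theta>_integrable(1)[of j i]
    by (simp add: ennreal_mult nn_integral_eq_integral)
  finally show "ennreal (\<integral>\<omega>. norm (noise j i \<omega>) powr p \<partial>M) \<le> ennreal (2 powr p * h powr (p - 1)) * g_cell j i" .
qed

definition noise_max :: "nat \<Rightarrow> 'w \<Rightarrow> real" where
  "noise_max j \<omega> = run_max (\<lambda>k. \<Sum>i<k. noise j i \<omega>) N"

lemma noise_max_measurable [measurable]: "noise_max j \<in> borel_measurable M"
  unfolding noise_max_def[abs_def] by (intro borel_measurable_run_max) auto

end

definition noise_const :: real where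
  "noise_const = maximal_const DIM('b) p * \<tau> powr (p / 2 - 1) * 2 powr p * (\<integral>t. norm (g t) powr p \<partial>lborel)"

lemma noise_const_nonneg: "0 \<le> noise_const"
  using smooth_const_pos[OF p]
  by (auto simp: noise_const_def maximal_const_def moment_const_def intro!: mult_nonneg_nonneg integral_nonneg_AE)

text \<open>Over a row the noise moments sum to O(h^(p-1)), and the maximal inequality multiplies by
  N^(p/2 - 1). Their product is \<tau>^(p/2 - 1) h^(p/2), which explains the power of \<tau> in
  \<open>noise_const\<close>.\<close>

lemma noise_max_moment:
  assumes N: "\<tau> \<le> real N" and j: "j \<le> n"
  shows "(\<integral>\<^sup>+\<omega>. ennreal (noise_max N j \<omega> powr p) \<partial>M) \<le> ennreal (noise_const * (\<tau> / real N) powr (p / 2))"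
proof -
  define h where "h = \<tau> / real N"
  have h: "h > 0" using h_pos[OF N] by (simp add: h_def)
  define \<Gamma> where "\<Gamma> = (\<integral>t. norm (g t) powr p \<partial>lborel)"
  have \<Gamma>: "\<Gamma> \<ge> 0" by (auto simp: \<Gamma>_def intro!: integral_nonneg_AE)
  define c where "c = maximal_const DIM('b) p"
  have c: "c \<ge> 0" using smooth_const_pos[OF p] by (simp add: c_def maximal_const_def moment_const_def)
  define E where "E = (\<Sum>i<N. \<integral>\<omega>. norm (noise N j i \<omega>) powr p \<partial>M)"
  have E0: "E \<ge> 0" unfolding E_def by (intro sum_nonneg integral_nonneg_AE) auto
  have ind: "indep_vars (\<lambda>_. borel) (\<lambda>i. noise N j i) {..<N}"
  proof -
    \<comment> \<open>Each noise term reads the single variable with index (j, Suc i), and these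
      blocks are disjoint.\<close>
    have "indep_vars (\<lambda>i. PiM {(j, Suc i)} (\<lambda>_. borel))
        (\<lambda>i \<omega>. \<lambda>l\<in>{(j, Suc i)}. (case l of (j, k) \<Rightarrow> \<gamma> j k) \<omega>) {..<N}"
      by (rule indep_vars_restrict[OF indep]) (auto simp: disjoint_family_on_def)
    then have "indep_vars (\<lambda>_. borel) (\<lambda>i \<omega>. (\<lambda>v. x (grid_time \<tau> N j (Suc i)) - x (grid_time \<tau> N j i) -
        h *\<^sub>R g (grid_time \<tau> N j i + h * v (j, Suc i))) (\<lambda>l\<in>{(j, Suc i)}. (case l of (j, k) \<Rightarrow> \<gamma> j k) \<omega>)) {..<N}"
      by (rule indep_vars_compose2) auto
    then show ?thesis
      by (simp add: noise_def[OF N, abs_def] \<theta>_def[OF N] h_def)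
  qed
  have "ennreal E = (\<Sum>i<N. ennreal (\<integral>\<omega>. norm (noise N j i \<omega>) powr p \<partial>M))"
    unfolding E_def by (intro sum_ennreal[symmetric] integral_nonneg_AE) auto
  also have "\<dots> \<le> (\<Sum>i<N. ennreal (2 powr p * h powr (p - 1)) * g_cell N j i)"
    using noise_moment(2)[OF N j] unfolding h_def by (intro sum_mono) auto
  also have "\<dots> \<le> ennreal (2 powr p * h powr (p - 1)) * ennreal \<Gamma>"
    unfolding sum_distrib_left[symmetric] \<Gamma>_def by (intro mult_left_mono sum_g_cell_le[OF N]) auto
  finally have "ennreal E \<le> ennreal (2 powr p * h powr (p - 1) * \<Gamma>)"
    using \<Gamma> by (simp add: ennreal_mult)
  then have E: "E \<le> 2 powr p * h powr (p - 1) * \<Gamma>"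
    using \<Gamma> by (subst (asm) ennreal_le_iff) auto
  have "(\<integral>\<^sup>+\<omega>. ennreal (noise_max N j \<omega> powr p) \<partial>M) \<le> ennreal (c * real N powr (p / 2 - 1) * E)"
    unfolding noise_max_def[OF N] c_def E_def
    by (rule maximal_moment_bound[OF p ind]) (use noise_mean[OF N j] noise_moment(1)[OF N j] in auto)
  also have "\<dots> \<le> ennreal (c * real N powr (p / 2 - 1) * (2 powr p * h powr (p - 1) * \<Gamma>))"
    using E c by (intro ennreal_leI mult_left_mono) auto
  also have "c * real N powr (p / 2 - 1) * (2 powr p * h powr (p - 1) * \<Gamma>) = noise_const * h powr (p / 2)"
  proof -
    have "real N = \<tau> / h" using N_pos[OF N] tau by (simp add: h_def)
    then have "real N powr (p / 2 - 1) * h powr (p - 1) = \<tau> powr (p / 2 - 1) * (h powr (p - 1) / h powr (p / 2 - 1))"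
      using tau h by (simp add: powr_divide)
    also have "h powr (p - 1) / h powr (p / 2 - 1) = h powr (p / 2)"
      by (simp add: powr_diff[symmetric])
    finally show ?thesis by (simp add: noise_const_def c_def \<Gamma>_def mult_ac)
  qed
  finally show ?thesis by (simp add: h_def)
qed


text \<open>Bounds the sum of the Gronwall weights: 3^(p-1) from the three-term split of the error,
  \<tau>^(p-1) from the power mean over the steps, 2^(p-1) from separating current and delayed
  error.\<close>

definition growth_const :: real where
  "growth_const = 3 powr (p - 1) * (\<tau> powr (p - 1) * (2 powr (p - 1) * (\<integral>t. L t powr p \<partial>lborel)))"

text \<open>Data term times Gronwall factor; the summand \<open>growth_const\<close> outside the
  exponential carries the delayed error.\<close>

definition row_const :: real where
  "row_const = (3 powr (p - 1) * (1 + noise_const) + growth_const) * exp growth_const"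

lemma growth_const_nonneg: "0 \<le> growth_const"
  by (auto simp: growth_const_def intro!: mult_nonneg_nonneg integral_nonneg_AE)

lemma row_const_pos: "0 < row_const"
  using noise_const_nonneg growth_const_nonneg
  by (auto simp: row_const_def intro!: mult_pos_pos add_pos_nonneg)

section \<open>Gronwall recursion within one row\<close>

context
  fixes N j :: nat and h :: real
  assumes N: "\<tau> \<le> real N" and j: "j \<le> n"
  defines "h \<equiv> \<tau> / real N"
begin

text \<open>Sums of drift bounds increase with k, so one bound serves all earlier indices. The
  power-mean inequality gives h^p N^(p-1) = \<tau>^(p-1) h, leaving exactly one h per step for the
  cell integral.\<close>

lemma run_max_err_le:
  assumes k: "k \<le> N" and \<gamma>01: "\<And>i. i < N \<Longrightarrow> \<gamma> j (Suc i) \<omega> \<in> {0..1}"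
  shows "run_max (\<lambda>k. err N j k \<omega>) k powr p \<le> 3 powr (p - 1) * (norm (err N j 0 \<omega>) powr p + noise_max N j \<omega> powr p +
     \<tau> powr (p - 1) * (\<Sum>i<k. h * (L (\<theta> N j i \<omega>) powr p * (norm (err N j i \<omega>) + delay_err N j i \<omega>) powr p)))"
proof -
  have h: "0 < h" using h_pos[OF N] by (simp add: h_def)
  define q where "q i = L (\<theta> N j i \<omega>) * (norm (err N j i \<omega>) + delay_err N j i \<omega>)" for i
  have q: "0 \<le> q i" for i using delay_err_nonneg[OF N] L_nonneg by (simp add: q_def)
  have "run_max (\<lambda>k. err N j k \<omega>) k \<le> norm (err N j 0 \<omega>) + noise_max N j \<omega> + h * (\<Sum>i<k. q i)"
  proof (rule run_max_le)
    fix l assume l: "l \<le> k"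
    have "norm (\<Sum>i<l. drift N j i \<omega>) \<le> (\<Sum>i<l. q i)"
      unfolding q_def using l k \<gamma>01 drift_le[OF N j] by (intro sum_norm_le) auto
    also have "\<dots> \<le> (\<Sum>i<k. q i)" using l q by (intro sum_mono2) auto
    finally have d: "h * norm (\<Sum>i<l. drift N j i \<omega>) \<le> h * (\<Sum>i<k. q i)" using h by simp
    have m: "norm (\<Sum>i<l. noise N j i \<omega>) \<le> noise_max N j \<omega>"
      unfolding noise_max_def[OF N] using l k norm_le_run_max[of l N "\<lambda>k. \<Sum>i<k. noise N j i \<omega>"] by simp
    have "norm (err N j l \<omega>) \<le> norm (err N j 0 \<omega>) + norm (\<Sum>i<l. noise N j i \<omega>) + norm (h *\<^sub>R (\<Sum>i<l. drift N j i \<omega>))"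
      unfolding err_eq[OF N, of j l \<omega>, folded h_def] by (meson add_right_mono norm_triangle_ineq norm_triangle_le order_trans)
    then show "norm (err N j l \<omega>) \<le> norm (err N j 0 \<omega>) + noise_max N j \<omega> + h * (\<Sum>i<k. q i)"
      using d m h by (simp only: norm_scaleR abs_of_pos)
  qed
  then have "run_max (\<lambda>k. err N j k \<omega>) k powr p \<le> (norm (err N j 0 \<omega>) + noise_max N j \<omega> + h * (\<Sum>i<k. q i)) powr p"
    using p by (intro powr_mono2) auto
  also have "\<dots> \<le> 3 powr (p - 1) * (norm (err N j 0 \<omega>) powr p + noise_max N j \<omega> powr p + (h * (\<Sum>i<k. q i)) powr p)"
    using p h q by (intro powr_add3_le mult_nonneg_nonneg sum_nonneg) (auto simp: noise_max_def[OF N])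
  also have "(h * (\<Sum>i<k. q i)) powr p \<le> \<tau> powr (p - 1) * (\<Sum>i<k. h * (L (\<theta> N j i \<omega>) powr p * (norm (err N j i \<omega>) + delay_err N j i \<omega>) powr p))"
  proof -
    have "(h * (\<Sum>i<k. q i)) powr p = h powr p * (\<Sum>i<k. q i) powr p"
      using h q by (simp add: powr_mult sum_nonneg)
    also have "\<dots> \<le> h powr p * (real N powr (p - 1) * (\<Sum>i<k. q i powr p))"
    proof (intro mult_left_mono)
      have "(\<Sum>i<k. q i) powr p \<le> real k powr (p - 1) * (\<Sum>i<k. q i powr p)"
        using powr_sum_le[of p "{..<k}" q] p q by simp
      also have "\<dots> \<le> real N powr (p - 1) * (\<Sum>i<k. q i powr p)"
        using k p by (intro mult_right_mono powr_mono2) (auto intro: sum_nonneg)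
      finally show "(\<Sum>i<k. q i) powr p \<le> real N powr (p - 1) * (\<Sum>i<k. q i powr p)" .
    qed simp
    also have "\<dots> = \<tau> powr (p - 1) * (h * (\<Sum>i<k. q i powr p))"
    proof -
      have "\<tau> = h * real N" using N_pos[OF N] by (simp add: h_def)
      then have "\<tau> powr (p - 1) = h powr (p - 1) * real N powr (p - 1)" using h by (simp add: powr_mult)
      moreover have "h powr p = h powr (p - 1) * h" using h by (simp add: powr_diff)
      ultimately show ?thesis by simp
    qed
    finally show ?thesis
      using delay_err_nonneg[OF N] L_nonneg by (simp add: q_def powr_mult sum_distrib_left)
  qed
  finally show ?thesis by simp
qed

text \<open>The error at step i is at most the running maximum up to i, so the recursion closes in
  \<open>a\<close>. The h left in each drift term turns L^p into the cell weight
  \<open>b i\<close>.\<close>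

lemma err_moment_recursion:
  assumes k: "k \<le> N" and r: "0 \<le> r"
    and delay: "\<And>i. i < N \<Longrightarrow> (\<integral>\<^sup>+\<omega>. ennreal (delay_err N j i \<omega> powr p) \<partial>M) \<le> ennreal r"
  defines "b \<equiv> \<lambda>i. ennreal (3 powr (p - 1)) * (ennreal (\<tau> powr (p - 1)) * (ennreal (2 powr (p - 1)) *
     (\<integral>\<^sup>+t. ennreal (L t powr p) * indicator {grid_time \<tau> N j i<..grid_time \<tau> N j (Suc i)} t \<partial>lborel)))"
  defines "a \<equiv> \<lambda>k. \<integral>\<^sup>+\<omega>. ennreal (run_max (\<lambda>k. err N j k \<omega>) k powr p) \<partial>M"
  shows "a k \<le> ennreal (3 powr (p - 1)) * ((\<integral>\<^sup>+\<omega>. ennreal (norm (err N j 0 \<omega>) powr p) \<partial>M) +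
      (\<integral>\<^sup>+\<omega>. ennreal (noise_max N j \<omega> powr p) \<partial>M)) + (\<Sum>i<k. b i) * ennreal r + (\<Sum>i<k. b i * a i)"
proof -
  have h: "0 < h" using h_pos[OF N] by (simp add: h_def)
  note [measurable] = err_measurable[OF N] \<theta>_measurable[OF N] noise_max_measurable[OF N] delay_err_measurable[OF N]
  define lam where "lam i = (\<integral>\<^sup>+t. ennreal (L t powr p) * indicator {grid_time \<tau> N j i<..grid_time \<tau> N j (Suc i)} t \<partial>lborel)" for i
  define q where "q i \<omega> = (norm (err N j i \<omega>) + delay_err N j i \<omega>) powr p" for i \<omega>
  define l where "l i \<omega> = L (\<theta> N j i \<omega>) powr p" for i \<omega>
  have [measurable]: "q i \<in> borel_measurable M" if "i < N" for i using that unfolding q_def[abs_def] by simp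
  have [measurable]: "l i \<in> borel_measurable M" for i unfolding l_def[abs_def] by simp
  have q_le: "(\<integral>\<^sup>+\<omega>. ennreal (q i \<omega>) \<partial>M) \<le> ennreal (2 powr (p - 1)) * (a i + ennreal r)" if i: "i < N" for i
  proof -
    have "(\<integral>\<^sup>+\<omega>. ennreal (q i \<omega>) \<partial>M) \<le> (\<integral>\<^sup>+\<omega>. ennreal (2 powr (p - 1)) *
        (ennreal (run_max (\<lambda>k. err N j k \<omega>) i powr p) + ennreal (delay_err N j i \<omega> powr p)) \<partial>M)"
    proof (rule nn_integral_mono)
      fix \<omega>
      have "q i \<omega> \<le> 2 powr (p - 1) * (norm (err N j i \<omega>) powr p + delay_err N j i \<omega> powr p)"
        unfolding q_def using p delay_err_nonneg[OF N] by (intro powr_add_le) auto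
      also have "\<dots> \<le> 2 powr (p - 1) * (run_max (\<lambda>k. err N j k \<omega>) i powr p + delay_err N j i \<omega> powr p)"
        using p norm_le_run_max[of i i "\<lambda>k. err N j k \<omega>"]
        by (intro mult_left_mono add_right_mono powr_mono2) auto
      finally show "ennreal (q i \<omega>) \<le> ennreal (2 powr (p - 1)) *
        (ennreal (run_max (\<lambda>k. err N j k \<omega>) i powr p) + ennreal (delay_err N j i \<omega> powr p))"
        by (simp add: ennreal_mult[symmetric] ennreal_plus[symmetric] del: ennreal_plus)
    qed
    also have "\<dots> = ennreal (2 powr (p - 1)) * (a i + (\<integral>\<^sup>+\<omega>. ennreal (delay_err N j i \<omega> powr p) \<partial>M))"
      using i unfolding a_def by (subst nn_integral_cmult) (auto simp: nn_integral_add)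
    also have "\<dots> \<le> ennreal (2 powr (p - 1)) * (a i + ennreal r)"
      using delay[OF i] by (intro mult_left_mono add_left_mono) auto
    finally show ?thesis .
  qed
  have cell: "ennreal h * (\<integral>\<^sup>+\<omega>. ennreal (l i \<omega>) * ennreal (q i \<omega>) \<partial>M) \<le> lam i * (ennreal (2 powr (p - 1)) * (a i + ennreal r))"
    if i: "i < N" for i
  proof -
    have "ennreal h * (\<integral>\<^sup>+\<omega>. ennreal (l i \<omega>) * ennreal (q i \<omega>) \<partial>M) = lam i * (\<integral>\<^sup>+\<omega>. ennreal (q i \<omega>) \<partial>M)"
      unfolding l_def q_def lam_def h_def by (rule L_err_independent[OF N i])
    also have "\<dots> \<le> lam i * (ennreal (2 powr (p - 1)) * (a i + ennreal r))"
      using q_le[OF i] by (intro mult_left_mono) auto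
    finally show ?thesis .
  qed
  \<comment> \<open>The pathwise bound needs random variables in [0,1], which is only almost
    sure.\<close>
  have "AE \<omega> in M. \<forall>i<N. \<gamma> j (Suc i) \<omega> \<in> {0..1}"
    by (subst AE_all_countable) (use AE_uniform_mem[OF uniform[of "Suc i" j for i]] in auto)
  then have "a k \<le> (\<integral>\<^sup>+\<omega>. ennreal (3 powr (p - 1)) * (ennreal (norm (err N j 0 \<omega>) powr p) + ennreal (noise_max N j \<omega> powr p) +
     ennreal (\<tau> powr (p - 1)) * (\<Sum>i<k. ennreal h * (ennreal (l i \<omega>) * ennreal (q i \<omega>)))) \<partial>M)"
    unfolding a_def
  proof (intro nn_integral_mono_AE, eventually_elim)
    case (elim \<omega>)
    have "(\<Sum>i<k. ennreal h * (ennreal (l i \<omega>) * ennreal (q i \<omega>))) = ennreal (\<Sum>i<k. h * (l i \<omega> * q i \<omega>))"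
      using h by (subst sum_ennreal[symmetric]) (auto simp: l_def q_def ennreal_mult)
    moreover have "0 \<le> (\<Sum>i<k. h * (l i \<omega> * q i \<omega>))" using h by (auto simp: l_def q_def intro!: sum_nonneg)
    ultimately show ?case
      using run_max_err_le[OF k, of \<omega>] elim
      by (simp add: l_def q_def ennreal_mult[symmetric] ennreal_plus[symmetric] ennreal_leI del: ennreal_plus)
  qed
  also have "\<dots> = ennreal (3 powr (p - 1)) * ((\<integral>\<^sup>+\<omega>. ennreal (norm (err N j 0 \<omega>) powr p) \<partial>M) +
      (\<integral>\<^sup>+\<omega>. ennreal (noise_max N j \<omega> powr p) \<partial>M) +
      ennreal (\<tau> powr (p - 1)) * (\<Sum>i<k. ennreal h * (\<integral>\<^sup>+\<omega>. ennreal (l i \<omega>) * ennreal (q i \<omega>) \<partial>M)))"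
  proof -
    have "(\<integral>\<^sup>+\<omega>. (\<Sum>i<k. ennreal h * (ennreal (l i \<omega>) * ennreal (q i \<omega>))) \<partial>M) =
        (\<Sum>i<k. ennreal h * (\<integral>\<^sup>+\<omega>. ennreal (l i \<omega>) * ennreal (q i \<omega>) \<partial>M))"
      using k by (subst nn_integral_sum) (auto simp: nn_integral_cmult)
    then show ?thesis
      using k by (simp add: nn_integral_cmult nn_integral_add)
  qed
  also have "\<dots> \<le> ennreal (3 powr (p - 1)) * ((\<integral>\<^sup>+\<omega>. ennreal (norm (err N j 0 \<omega>) powr p) \<partial>M) +
      (\<integral>\<^sup>+\<omega>. ennreal (noise_max N j \<omega> powr p) \<partial>M) +
      ennreal (\<tau> powr (p - 1)) * (\<Sum>i<k. lam i * (ennreal (2 powr (p - 1)) * (a i + ennreal r))))"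
    using cell k by (intro mult_left_mono add_left_mono sum_mono) auto
  also have "\<dots> = ennreal (3 powr (p - 1)) * ((\<integral>\<^sup>+\<omega>. ennreal (norm (err N j 0 \<omega>) powr p) \<partial>M) +
      (\<integral>\<^sup>+\<omega>. ennreal (noise_max N j \<omega> powr p) \<partial>M)) + (\<Sum>i<k. b i * (a i + ennreal r))"
    by (simp add: distrib_left[of "ennreal (3 powr (p - 1))"] sum_distrib_left b_def lam_def mult_ac)
  finally show ?thesis
    by (simp add: distrib_left sum.distrib sum_distrib_right add_ac)
qed

text \<open>Gronwall with total weight at most \<open>growth_const\<close>, whatever N. Initial
  error, noise and delay are all bounded by multiples of their common sum, which can then be
  factored out.\<close>

lemma row_error_moment:
  assumes B: "0 \<le> B" and r: "0 \<le> r"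
    and init: "(\<integral>\<^sup>+\<omega>. ennreal (norm (err N j 0 \<omega>) powr p) \<partial>M) \<le> ennreal B"
    and delay: "\<And>i. i < N \<Longrightarrow> (\<integral>\<^sup>+\<omega>. ennreal (delay_err N j i \<omega> powr p) \<partial>M) \<le> ennreal r"
  shows "(\<integral>\<^sup>+\<omega>. ennreal (run_max (\<lambda>k. err N j k \<omega>) N powr p) \<partial>M) \<le> ennreal (row_const * (B + h powr (p / 2) + r))"
proof -
  define b where "b i = ennreal (3 powr (p - 1)) * (ennreal (\<tau> powr (p - 1)) * (ennreal (2 powr (p - 1)) *
     (\<integral>\<^sup>+t. ennreal (L t powr p) * indicator {grid_time \<tau> N j i<..grid_time \<tau> N j (Suc i)} t \<partial>lborel)))" for i
  define a where "a k = (\<integral>\<^sup>+\<omega>. ennreal (run_max (\<lambda>k. err N j k \<omega>) k powr p) \<partial>M)" for k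
  have b_sum: "(\<Sum>i<k. b i) \<le> ennreal growth_const" for k
  proof -
    have "(\<integral>\<^sup>+t. ennreal (L t powr p) \<partial>lborel) = ennreal (\<integral>t. L t powr p \<partial>lborel)"
      using L_int by (intro nn_integral_eq_integral) auto
    then have "(\<Sum>i<k. \<integral>\<^sup>+t. ennreal (L t powr p) * indicator {grid_time \<tau> N j i<..grid_time \<tau> N j (Suc i)} t \<partial>lborel)
        \<le> ennreal (\<integral>t. L t powr p \<partial>lborel)"
      using nn_integral_increments_le[OF N, of "\<lambda>t. ennreal (L t powr p)" j k] by simp
    then have "(\<Sum>i<k. b i) \<le> ennreal (3 powr (p - 1)) * (ennreal (\<tau> powr (p - 1)) * (ennreal (2 powr (p - 1)) *
        ennreal (\<integral>t. L t powr p \<partial>lborel)))"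
      unfolding b_def sum_distrib_left[symmetric] by (intro mult_left_mono) auto
    also have "\<dots> = ennreal growth_const"
      by (simp add: growth_const_def ennreal_mult integral_nonneg_AE)
    finally show ?thesis .
  qed
  define A where "A = (3 powr (p - 1) * (1 + noise_const) + growth_const) * (B + h powr (p / 2) + r)"
  have rec: "a k \<le> ennreal A + (\<Sum>i<k. b i * a i)" if k: "k \<le> N" for k
  proof -
    have "a k \<le> ennreal (3 powr (p - 1)) * ((\<integral>\<^sup>+\<omega>. ennreal (norm (err N j 0 \<omega>) powr p) \<partial>M) +
      (\<integral>\<^sup>+\<omega>. ennreal (noise_max N j \<omega> powr p) \<partial>M)) + (\<Sum>i<k. b i) * ennreal r + (\<Sum>i<k. b i * a i)"
      unfolding a_def b_def by (rule err_moment_recursion[OF k r delay])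
    also have "\<dots> \<le> ennreal (3 powr (p - 1)) * (ennreal B + ennreal (noise_const * h powr (p / 2))) +
        ennreal growth_const * ennreal r + (\<Sum>i<k. b i * a i)"
      using init noise_max_moment[OF N j] b_sum unfolding h_def
      by (intro add_mono mult_left_mono mult_right_mono) auto
    also have "ennreal (3 powr (p - 1)) * (ennreal B + ennreal (noise_const * h powr (p / 2))) + ennreal growth_const * ennreal r
        = ennreal (3 powr (p - 1) * (B + noise_const * h powr (p / 2)) + growth_const * r)"
      using B r noise_const_nonneg growth_const_nonneg
      by (simp add: ennreal_mult ennreal_plus)
    also have "\<dots> \<le> ennreal A"
    proof (rule ennreal_leI)
      have "B + noise_const * h powr (p / 2) \<le> (1 + noise_const) * (B + h powr (p / 2) + r)"
        using B r noise_const_nonneg by (simp add: algebra_simps add_nonneg_nonneg)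
      then have "3 powr (p - 1) * (B + noise_const * h powr (p / 2)) \<le> 3 powr (p - 1) * ((1 + noise_const) * (B + h powr (p / 2) + r))"
        by (intro mult_left_mono) auto
      moreover have "growth_const * r \<le> growth_const * (B + h powr (p / 2) + r)"
        using B growth_const_nonneg by (intro mult_left_mono) auto
      moreover have "A = 3 powr (p - 1) * ((1 + noise_const) * (B + h powr (p / 2) + r)) + growth_const * (B + h powr (p / 2) + r)"
        by (simp add: A_def algebra_simps)
      ultimately show "3 powr (p - 1) * (B + noise_const * h powr (p / 2)) + growth_const * r \<le> A"
        by linarith
    qed
    finally show ?thesis by (simp add: add_right_mono)
  qed
  have "A \<ge> 0" using B r noise_const_nonneg growth_const_nonneg by (simp add: A_def)
  have "a N \<le> ennreal A * (\<Prod>i<N. 1 + b i)" by (rule gronwall_ennreal[where N=N]) (use rec in auto)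
  also have "\<dots> \<le> ennreal A * ennreal (exp growth_const)"
    by (intro mult_left_mono prod_one_plus_le_exp b_sum growth_const_nonneg) auto
  also have "\<dots> = ennreal (row_const * (B + h powr (p / 2) + r))"
    using \<open>A \<ge> 0\<close> by (simp add: ennreal_mult[symmetric] A_def row_const_def mult_ac)
  finally show ?thesis by (simp add: a_def)
qed

end


text \<open>Initial and delayed error of a row come from the previous row. The delay multiplies the
  order of the moment by \<alpha>, and h <= 1 lets this smallest exponent absorb the others.\<close>

lemma error_moment:
  assumes "j \<le> n"
  shows "\<exists>C>0. \<forall>N. \<tau> \<le> real N \<longrightarrow>
    (\<integral>\<^sup>+\<omega>. ennreal (run_max (\<lambda>k. err N j k \<omega>) N powr p) \<partial>M) \<le> ennreal (C * (\<tau> / real N) powr (p / 2 * \<alpha> ^ j))"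
  using assms
proof (induction j)
  case 0
  show ?case
  \<comment> \<open>In row 0 the initial error is 0 and the delay term is the constant G * sqrt h,
    with p-th power G^p h^(p/2).\<close>
  proof (intro exI[of _ "row_const * (1 + G powr p)"] conjI allI impI)
    show "0 < row_const * (1 + G powr p)" using row_const_pos by (intro mult_pos_pos add_pos_nonneg) auto
    fix N assume N: "\<tau> \<le> real N"
    define h where "h = \<tau> / real N"
    have h: "0 < h" using h_pos[OF N] by (simp add: h_def)
    have "(\<integral>\<^sup>+\<omega>. ennreal (run_max (\<lambda>k. err N 0 k \<omega>) N powr p) \<partial>M) \<le> ennreal (row_const * (0 + h powr (p / 2) + (G * sqrt h) powr p))"
      unfolding h_def
      by (rule row_error_moment[OF N 0]) (use p in \<open>auto simp: err_0_0[OF N] delay_err_def[OF N] emeasure_space_1\<close>)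
    also have "(G * sqrt h) powr p = G powr p * h powr (p / 2)"
      using h G_pos by (simp add: powr_mult powr_half_sqrt[symmetric] powr_powr)
    finally show "(\<integral>\<^sup>+\<omega>. ennreal (run_max (\<lambda>k. err N 0 k \<omega>) N powr p) \<partial>M)
        \<le> ennreal (row_const * (1 + G powr p) * (\<tau> / real N) powr (p / 2 * \<alpha> ^ 0))"
      by (simp add: h_def algebra_simps)
  qed
next
  case (Suc j)
  then obtain C where C: "C > 0" and IH: "\<And>N. \<tau> \<le> real N \<Longrightarrow>
     (\<integral>\<^sup>+\<omega>. ennreal (run_max (\<lambda>k. err N j k \<omega>) N powr p) \<partial>M) \<le> ennreal (C * (\<tau> / real N) powr (p / 2 * \<alpha> ^ j))"
    by auto
  \<comment> \<open>Parts of the delayed error: the displacement of x in either argument gives the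
    two powers of \<open>G\<close>, the previous row gives 1 + C, and 3^(p-1) comes from the
    split.\<close>
  define D where "D = 3 powr (p - 1) * (G powr p + G powr (\<alpha> * p) + 1 + C)"
  have D: "D > 0" using C by (auto simp: D_def intro!: mult_pos_pos add_nonneg_pos)
  show ?case
  proof (intro exI[of _ "row_const * (C + 1 + D)"] conjI allI impI)
    show "0 < row_const * (C + 1 + D)" using row_const_pos C D by simp
    fix N assume N: "\<tau> \<le> real N"
    define h where "h = \<tau> / real N"
    have h: "0 < h" "h \<le> 1" using h_pos[OF N] h_le_1[OF N] by (auto simp: h_def)
    define H where "H = h powr (p / 2 * \<alpha> ^ Suc j)"
    \<comment> \<open>\<open>c\<close> is the order of the p-th moment in the previous row, so for
      an error z of that row H (1 + z^p / c) has mean at most (1 + C) H.\<close>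
    define c where "c = h powr (p / 2 * \<alpha> ^ j)"
    have c: "c > 0" "c powr \<alpha> = H" using h by (auto simp: c_def H_def powr_powr mult_ac)
    have \<alpha>j: "\<alpha> ^ Suc j \<le> \<alpha> ^ j" "\<alpha> ^ Suc j \<le> \<alpha>" "\<alpha> ^ Suc j \<le> 1"
      using alpha power_le_one[of \<alpha> j] power_le_one[of \<alpha> "Suc j"] by (auto simp: mult_left_le_one_le mult_left_le)
    have mono: "h powr s \<le> H" if "p / 2 * \<alpha> ^ Suc j \<le> s" for s
      unfolding H_def using h that by (intro powr_mono') auto
    have hH: "h powr (p / 2) \<le> H" "h powr (\<alpha> * p / 2) \<le> H" "c \<le> H"
      unfolding c_def using mult_left_mono[OF \<alpha>j(1), of "p / 2"] mult_left_mono[OF \<alpha>j(2), of "p / 2"]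
        mult_left_mono[OF \<alpha>j(3), of "p / 2"] p by (auto intro!: mono simp: mult_ac)
    note [measurable] = err_measurable[OF N]
    have last: "(\<integral>\<^sup>+\<omega>. ennreal (norm (err N j i \<omega>) powr p) \<partial>M) \<le> ennreal (C * c)" if "i \<le> N" for i
    proof -
      have "(\<integral>\<^sup>+\<omega>. ennreal (norm (err N j i \<omega>) powr p) \<partial>M) \<le> (\<integral>\<^sup>+\<omega>. ennreal (run_max (\<lambda>k. err N j k \<omega>) N powr p) \<partial>M)"
        using p by (intro nn_integral_mono ennreal_leI powr_mono2 norm_le_run_max[OF that]) auto
      also have "\<dots> \<le> ennreal (C * c)" using IH[OF N] by (simp add: c_def h_def)
      finally show ?thesis .
    qed
    have delay: "(\<integral>\<^sup>+\<omega>. ennreal (delay_err N (Suc j) i \<omega> powr p) \<partial>M) \<le> ennreal (D * H)" if i: "i < N" for i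
    proof -
      have pt: "delay_err N (Suc j) i \<omega> powr p \<le> 3 powr (p - 1) * H * (G powr p + G powr (\<alpha> * p) + 1) +
          3 powr (p - 1) * H / c * norm (err N j i \<omega>) powr p" for \<omega>
      proof -
        define z where "z = norm (err N j i \<omega>)"
        have Gh: "(G * sqrt h) powr s = G powr s * h powr (s / 2)" for s
          using h G_pos by (simp add: powr_mult powr_half_sqrt[symmetric] powr_powr)
        have "(z powr \<alpha>) powr p = (z powr p) powr \<alpha>" by (simp add: powr_powr mult.commute)
        also have "\<dots> \<le> H * (1 + z powr p / c)"
          using powr_le_one_plus[of \<alpha> c "z powr p"] alpha c by simp
        finally have 1: "(z powr \<alpha>) powr p \<le> H * (1 + z powr p / c)" .
        have 2: "(G * sqrt h) powr p \<le> G powr p * H"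
          unfolding Gh using hH(1) by (intro mult_left_mono) auto
        have "((G * sqrt h) powr \<alpha>) powr p = G powr (\<alpha> * p) * h powr (\<alpha> * p / 2)"
          unfolding powr_powr by (rule Gh)
        then have 3: "((G * sqrt h) powr \<alpha>) powr p \<le> G powr (\<alpha> * p) * H"
          using hH(2) by (simp only:) (intro mult_left_mono, auto)
        have "delay_err N (Suc j) i \<omega> powr p = (G * sqrt h + z powr \<alpha> + (G * sqrt h) powr \<alpha>) powr p"
          by (simp add: delay_err_def[OF N] h_def z_def add.assoc)
        also have "\<dots> \<le> 3 powr (p - 1) * ((G * sqrt h) powr p + (z powr \<alpha>) powr p + ((G * sqrt h) powr \<alpha>) powr p)"
          using p G_pos h by (intro powr_add3_le) auto
        also have "\<dots> \<le> 3 powr (p - 1) * (G powr p * H + H * (1 + z powr p / c) + G powr (\<alpha> * p) * H)"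
          using 1 2 3 by (intro mult_left_mono add_mono) auto
        also have "\<dots> = 3 powr (p - 1) * H * (G powr p + G powr (\<alpha> * p) + 1) + 3 powr (p - 1) * H / c * z powr p"
          by (simp add: algebra_simps)
        finally show ?thesis by (simp add: z_def)
      qed
      have H: "H > 0" using h by (simp add: H_def)
      have "(\<integral>\<^sup>+\<omega>. ennreal (delay_err N (Suc j) i \<omega> powr p) \<partial>M) \<le>
          (\<integral>\<^sup>+\<omega>. ennreal (3 powr (p - 1) * H * (G powr p + G powr (\<alpha> * p) + 1)) +
             ennreal (3 powr (p - 1) * H / c) * ennreal (norm (err N j i \<omega>) powr p) \<partial>M)"
        using pt H c by (intro nn_integral_mono)
          (simp add: ennreal_mult[symmetric] ennreal_plus[symmetric] ennreal_leI del: ennreal_plus)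
      also have "\<dots> = ennreal (3 powr (p - 1) * H * (G powr p + G powr (\<alpha> * p) + 1)) +
             ennreal (3 powr (p - 1) * H / c) * (\<integral>\<^sup>+\<omega>. ennreal (norm (err N j i \<omega>) powr p) \<partial>M)"
        using i by (simp add: nn_integral_add nn_integral_cmult emeasure_space_1)
      also have "\<dots> \<le> ennreal (3 powr (p - 1) * H * (G powr p + G powr (\<alpha> * p) + 1)) +
             ennreal (3 powr (p - 1) * H / c) * ennreal (C * c)"
        using last[of i] i by (intro add_left_mono mult_left_mono) auto
      also have "\<dots> = ennreal (3 powr (p - 1) * H * (G powr p + G powr (\<alpha> * p) + 1) + 3 powr (p - 1) * H / c * (C * c))"
        using H C c by (subst ennreal_mult[symmetric]) (auto simp del: ennreal_plus simp: ennreal_plus[symmetric])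
      also have "3 powr (p - 1) * H * (G powr p + G powr (\<alpha> * p) + 1) + 3 powr (p - 1) * H / c * (C * c) = D * H"
        using c(1) by (simp add: D_def algebra_simps)
      finally show ?thesis .
    qed
    have "(\<integral>\<^sup>+\<omega>. ennreal (run_max (\<lambda>k. err N (Suc j) k \<omega>) N powr p) \<partial>M)
        \<le> ennreal (row_const * (C * c + h powr (p / 2) + D * H))"
      unfolding h_def
    proof (rule row_error_moment[OF N Suc.prems])
      show "(\<integral>\<^sup>+\<omega>. ennreal (norm (err N (Suc j) 0 \<omega>) powr p) \<partial>M) \<le> ennreal (C * c)"
        using last[of N] by (simp add: err_Suc_0[OF N])
    qed (use C c D delay in \<open>auto simp: H_def\<close>)
    also have "\<dots> \<le> ennreal (row_const * (C * H + H + D * H))"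
      using hH C D row_const_pos by (intro ennreal_leI mult_left_mono add_mono) auto
    also have "row_const * (C * H + H + D * H) = row_const * (C + 1 + D) * (\<tau> / real N) powr (p / 2 * \<alpha> ^ Suc j)"
      by (simp add: H_def h_def algebra_simps)
    finally show "(\<integral>\<^sup>+\<omega>. ennreal (run_max (\<lambda>k. err N (Suc j) k \<omega>) N powr p) \<partial>M) \<le> \<dots>" .
  qed
qed

lemma max_grid_error_eq:
  assumes "\<tau> \<le> real N"
  shows "max_grid_error f \<tau> x\<^sub>0 x N j (\<lambda>j k. \<gamma> j k \<omega>) = run_max (\<lambda>k. err N j k \<omega>) N"
  unfolding max_grid_error_def Max_norm_eq_run_max err_def[OF assms] y_def[OF assms] ..

lemma max_grid_error_measurable:
  assumes "\<tau> \<le> real N"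
  shows "(\<lambda>\<omega>. max_grid_error f \<tau> x\<^sub>0 x N j (\<lambda>j k. \<gamma> j k \<omega>)) \<in> borel_measurable M"
  unfolding max_grid_error_eq[OF assms] using err_measurable[OF assms] by (intro borel_measurable_run_max)

text \<open>The finite \<open>nn_integral\<close> bound yields integrability, which gives
  \<open>Lp_norm\<close> its meaning; the p-th root removes p from the exponent.\<close>

lemma max_grid_error_Lp:
  "\<exists>C. \<forall>j\<le>n. 0 < C j \<and> (\<forall>N. \<tau> \<le> real N \<longrightarrow>
     in_Lp M p (\<lambda>\<omega>. max_grid_error f \<tau> x\<^sub>0 x N j (\<lambda>j k. \<gamma> j k \<omega>)) \<and>
     Lp_norm M p (\<lambda>\<omega>. max_grid_error f \<tau> x\<^sub>0 x N j (\<lambda>j k. \<gamma> j k \<omega>)) \<le> C j * (\<tau> / real N) powr (1 / 2 * \<alpha> ^ j))"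
proof -
  obtain C where C: "\<And>j. j \<le> n \<Longrightarrow> C j > 0" and bound: "\<And>j N. j \<le> n \<Longrightarrow> \<tau> \<le> real N \<Longrightarrow>
    (\<integral>\<^sup>+\<omega>. ennreal (run_max (\<lambda>k. err N j k \<omega>) N powr p) \<partial>M) \<le> ennreal (C j * (\<tau> / real N) powr (p / 2 * \<alpha> ^ j))"
    using error_moment by metis
  show ?thesis
  proof (intro exI[of _ "\<lambda>j. C j powr (1 / p)"] allI impI conjI)
    fix j assume j: "j \<le> n"
    show "0 < C j powr (1 / p)" using C[OF j] by simp
    fix N assume N: "\<tau> \<le> real N"
    define h where "h = \<tau> / real N"
    have h: "0 < h" using h_pos[OF N] by (simp add: h_def)
    define Z where "Z \<omega> = max_grid_error f \<tau> x\<^sub>0 x N j (\<lambda>j k. \<gamma> j k \<omega>)" for \<omega>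
    have [measurable]: "Z \<in> borel_measurable M" unfolding Z_def[abs_def] by (rule max_grid_error_measurable[OF N])
    have Zp: "(\<integral>\<^sup>+\<omega>. ennreal (\<bar>Z \<omega>\<bar> powr p) \<partial>M) \<le> ennreal (C j * h powr (p / 2 * \<alpha> ^ j))"
      using bound[OF j N] by (simp add: Z_def max_grid_error_eq[OF N] h_def)
    then have "(\<integral>\<^sup>+\<omega>. ennreal (\<bar>Z \<omega>\<bar> powr p) \<partial>M) < \<infinity>" by (simp add: order_le_less_trans)
    then have int: "integrable M (\<lambda>\<omega>. \<bar>Z \<omega>\<bar> powr p)" by (intro integrableI_bounded) auto
    then show "in_Lp M p Z" by (simp add: in_Lp_def)
    have "ennreal (\<integral>\<omega>. \<bar>Z \<omega>\<bar> powr p \<partial>M) \<le> ennreal (C j * h powr (p / 2 * \<alpha> ^ j))"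
      using Zp int by (simp add: nn_integral_eq_integral)
    then have "(\<integral>\<omega>. \<bar>Z \<omega>\<bar> powr p \<partial>M) \<le> C j * h powr (p / 2 * \<alpha> ^ j)"
      using C[OF j] by (subst (asm) ennreal_le_iff) auto
    then have "Lp_norm M p Z \<le> (C j * h powr (p / 2 * \<alpha> ^ j)) powr (1 / p)"
      unfolding Lp_norm_def using p by (intro powr_mono2) (auto intro: integral_nonneg_AE)
    also have "\<dots> = C j powr (1 / p) * h powr (1 / 2 * \<alpha> ^ j)"
      using C[OF j] p by (simp add: powr_mult powr_powr)
    finally show "Lp_norm M p Z \<le> C j powr (1 / p) * h powr (1 / 2 * \<alpha> ^ j)" .
  qed
qed

end

section \<open>Reduction to Borel data\<close>

lemma absolutely_continuous_on_subset:
  "absolutely_continuous_on S x \<Longrightarrow> T \<subseteq> S \<Longrightarrow> absolutely_continuous_on T x"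
  unfolding absolutely_continuous_on_def by (meson order_trans)

text \<open>Preimages under the two functions differ by a null set, hence are measurable together.
  It returns measurability from the modified scheme to the original one.\<close>

lemma (in complete_measure) borel_measurable_cong_AE:
  assumes f: "f \<in> borel_measurable M" and eq: "AE \<omega> in M. f \<omega> = g \<omega>"
  shows "g \<in> borel_measurable M"
proof (rule measurableI)
  fix A :: "'b set" assume "A \<in> sets borel"
  then have 1: "f -` A \<inter> space M \<in> sets M" using f by (rule measurable_sets[rotated])
  have 2: "AE \<omega> in M. \<omega> \<in> f -` A \<inter> space M \<longleftrightarrow> \<omega> \<in> g -` A \<inter> space M"
    using eq by eventually_elim auto
  show "g -` A \<inter> space M \<in> sets M" by (rule in_sets_AE[OF 2 1]) auto
qed simp

text \<open>A Lebesgue measurable function has a Borel version; cutting it off below 0 and outside S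
  gives it sign and support at every real time.\<close>

lemma Lp_borel_version:
  assumes u: "in_Lp (lebesgue_on S) p u" and S: "S \<in> sets borel" and nonneg: "\<And>t. t \<in> S \<Longrightarrow> 0 \<le> u t"
  shows "\<exists>v\<in>borel_measurable borel. (\<forall>t. 0 \<le> v t \<and> (t \<notin> S \<longrightarrow> v t = 0)) \<and>
    (AE t in lborel. t \<in> S \<longrightarrow> v t = u t) \<and> integrable lborel (\<lambda>t. v t powr p)"
proof -
  have Sl: "S \<in> sets lebesgue" "S \<inter> space lebesgue \<in> sets lebesgue" using S by auto
  have um: "u \<in> borel_measurable (lebesgue_on S)" and ui: "integrable (lebesgue_on S) (\<lambda>t. \<bar>u t\<bar> powr p)"
    using u by (auto simp: in_Lp_def)
  have "(\<lambda>t. if t \<in> S then u t else 0) \<in> borel_measurable lebesgue"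
    using um Sl(1) by (rule borel_measurable_if_I)
  then obtain w where w [measurable]: "w \<in> borel_measurable lborel"
    and w_eq: "AE t in lborel. (if t \<in> S then u t else 0) = w t"
    by (blast dest: completion_ex_borel_measurable_real)
  define v where "v t = (if t \<in> S then max 0 (w t) else 0)" for t
  have vm [measurable]: "v \<in> borel_measurable borel"
    unfolding v_def[abs_def] using S w by measurable
  have v_eq: "AE t in lborel. t \<in> S \<longrightarrow> v t = u t"
    using w_eq
  proof eventually_elim
    case (elim t)
    then show ?case using nonneg[of t] by (auto simp: v_def)
  qed
  have "integrable lebesgue (\<lambda>t. indicator S t *\<^sub>R \<bar>u t\<bar> powr p)"
    using ui integrable_restrict_space[OF Sl(2), of "\<lambda>t. \<bar>u t\<bar> powr p"] by simp
  moreover have "(\<lambda>t. v t powr p) \<in> borel_measurable lebesgue" by (intro measurable_completion) simp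
  moreover have "AE t in lebesgue. indicator S t *\<^sub>R \<bar>u t\<bar> powr p = v t powr p"
    using AE_completion[OF v_eq]
  proof eventually_elim
    case (elim t)
    then show ?case using nonneg[of t] by (auto simp: v_def)
  qed
  ultimately have "integrable lebesgue (\<lambda>t. v t powr p)"
    by (rule integrable_cong_AE_imp)
  then have "integrable lborel (\<lambda>t. v t powr p)" by (subst (asm) integrable_completion) auto
  then show ?thesis using vm v_eq by (intro bexI[of _ v]) (auto simp: v_def)
qed

text \<open>Allows the right-hand side to be changed away from the evaluation points.\<close>

lemma rand_euler_cong_rhs:
  assumes "\<And>j' k' y z. j' \<le> j \<Longrightarrow> k' < N \<Longrightarrow>
      f (grid_time \<tau> N j' k' + \<tau> / real N * g j' (Suc k')) y z = f' (grid_time \<tau> N j' k' + \<tau> / real N * g j' (Suc k')) y z"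
    and "k \<le> N"
  shows "rand_euler f \<tau> x\<^sub>0 N g j k = rand_euler f' \<tau> x\<^sub>0 N g j k"
  using assms
proof (induction j arbitrary: k)
  case 0
  then show ?case by (induction k) auto
next
  case (Suc j)
  have row: "rand_euler f \<tau> x\<^sub>0 N g j k = rand_euler f' \<tau> x\<^sub>0 N g j k" if "k \<le> N" for k
    by (rule Suc.IH) (use Suc.prems that in auto)
  show ?case using Suc.prems(2)
    by (induction k) (use Suc.prems(1) row in auto)
qed

text \<open>On a bounded interval s^q <= 1 + s^p is an integrable bound. Used with q = 1 and q = 2
  for the derivative of the solution.\<close>

lemma integrable_powr_bounded_support:
  fixes g :: "real \<Rightarrow> 'a::{banach, second_countable_topology}"
  assumes g: "integrable lborel (\<lambda>t. norm (g t) powr p)" and [measurable]: "g \<in> borel_measurable borel"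
    and q: "0 < q" "q \<le> p" and supp: "\<And>t. t \<notin> {a..b} \<Longrightarrow> g t = 0"
  shows "integrable lborel (\<lambda>t. norm (g t) powr q)"
proof (rule Bochner_Integration.integrable_bound)
  have "integrable lborel (indicator {a..b} :: real \<Rightarrow> real)"
    by (intro integrable_real_indicator) (auto simp: emeasure_lborel_Icc_eq)
  then show "integrable lborel (\<lambda>t. indicator {a..b} t + norm (g t) powr p)" using g by simp
  have "norm (norm (g t) powr q) \<le> norm (indicator {a..b} t + norm (g t) powr p)" for t
  proof (cases "t \<in> {a..b}")
    case True
    have "norm (g t) powr q \<le> 1 + norm (g t) powr p"
    proof (cases "norm (g t) \<le> 1")
      case True
      then have "norm (g t) powr q \<le> 1" using q by (intro powr_le1) auto
      then show ?thesis by (simp add: add_increasing2)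
    next
      case False
      then have "norm (g t) powr q \<le> norm (g t) powr p" using q by (intro powr_mono) auto
      then show ?thesis by simp
    qed
    then show ?thesis using True by simp
  qed (use supp q in simp)
  then show "AE t in lborel. norm (norm (g t) powr q) \<le> norm (indicator {a..b} t + norm (g t) powr p)" by simp
qed simp

theorem theorem4p2:
  fixes n :: nat and \<tau> p \<alpha> :: real and x\<^sub>0 :: "real ^ 'd"
    and f :: "real \<Rightarrow> real ^ 'd \<Rightarrow> real ^ 'd \<Rightarrow> real ^ 'd"
    and K L :: "real \<Rightarrow> real"
    and x :: "real \<Rightarrow> real ^ 'd"
    and P :: "'w measure"
    and \<gamma> :: "nat \<Rightarrow> nat \<Rightarrow> 'w \<Rightarrow> real"
  assumes \<tau>: "0 < \<tau>" and p: "2 \<le> p" and \<alpha>: "0 < \<alpha>" "\<alpha> \<le> 1"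
    and A1: "\<And>t. t \<in> {0..real (n + 1) * \<tau>} \<Longrightarrow> continuous_on UNIV (\<lambda>(y, z). f t y z)"
    and A2: "\<And>y z. (\<lambda>t. f t y z) \<in>
                 borel_measurable (restrict_space borel {0..real (n + 1) * \<tau>})"
    and K_nonneg: "\<And>t. t \<in> {0..real (n + 1) * \<tau>} \<Longrightarrow> 0 \<le> K t"
    and L_nonneg: "\<And>t. t \<in> {0..real (n + 1) * \<tau>} \<Longrightarrow> 0 \<le> L t"
    and K_Lp: "in_Lp (lebesgue_on {0..real (n + 1) * \<tau>}) p K"
    and L_Lp: "in_Lp (lebesgue_on {0..real (n + 1) * \<tau>}) p L"
    and A3_bound: "\<And>t. t \<in> {0..real (n + 1) * \<tau>} \<Longrightarrow> norm (f t 0 0) \<le> K t"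
    and A3_Hoelder: "\<And>t y\<^sub>1 y\<^sub>2 z\<^sub>1 z\<^sub>2. t \<in> {0..real (n + 1) * \<tau>} \<Longrightarrow>
           norm (f t y\<^sub>1 z\<^sub>1 - f t y\<^sub>2 z\<^sub>2) \<le> L t * (norm (y\<^sub>1 - y\<^sub>2) + norm (z\<^sub>1 - z\<^sub>2) powr \<alpha>)"
    and solution: "dde_solution f \<tau> n x\<^sub>0 x"
    and prob: "prob_space P"
    and complete: "complete_measure P"
    and indep: "prob_space.indep_vars P (\<lambda>_. borel) (\<lambda>(j, k). \<gamma> j k) (UNIV \<times> {1..})"
    and uniform: "\<And>j k. 1 \<le> k \<Longrightarrow>
           distributed P lborel (\<gamma> j k) (\<lambda>u. indicator {0..1} u)"
  shows "\<exists>C :: nat \<Rightarrow> real.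
           (\<forall>j\<le>n. 0 < C j) \<and>
           (\<forall>N::nat. \<lceil>\<tau>\<rceil> \<le> int N \<longrightarrow>
             (\<forall>j\<le>n.
               in_Lp P p (\<lambda>\<omega>. max_grid_error f \<tau> x\<^sub>0 x N j (\<lambda>j k. \<gamma> j k \<omega>)) \<and>
               Lp_norm P p (\<lambda>\<omega>. max_grid_error f \<tau> x\<^sub>0 x N j (\<lambda>j k. \<gamma> j k \<omega>))
                 \<le> C j * (\<tau> / real N) powr (1 / 2 * \<alpha> ^ j))) \<and>
           (\<alpha> = 1 \<longrightarrow>
             (\<forall>N::nat. \<lceil>\<tau>\<rceil> \<le> int N \<longrightarrow>
               (\<forall>j\<le>n.
                 Lp_norm P p (\<lambda>\<omega>. max_grid_error f \<tau> x\<^sub>0 x N j (\<lambda>j k. \<gamma> j k \<omega>))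
                   \<le> C j * (\<tau> / real N) powr (1 / 2))))"
proof -
  interpret prob_space P by (rule prob)
  interpret complete_measure P by (rule complete)
  define T where "T = real (n + 1) * \<tau>"
  have T: "0 < T" using \<tau> by (simp add: T_def)
  have I: "{0..T} \<in> sets borel" by simp
  obtain K' where K'm [measurable]: "K' \<in> borel_measurable borel" and K': "\<And>t. 0 \<le> K' t"
    "\<And>t. t \<notin> {0..T} \<Longrightarrow> K' t = 0" "AE t in lborel. t \<in> {0..T} \<longrightarrow> K' t = K t" "integrable lborel (\<lambda>t. K' t powr p)"
    using Lp_borel_version[OF K_Lp[folded T_def] I K_nonneg[folded T_def]] by blast
  obtain L' where L'm [measurable]: "L' \<in> borel_measurable borel" and L': "\<And>t. 0 \<le> L' t"
    "\<And>t. t \<notin> {0..T} \<Longrightarrow> L' t = 0" "AE t in lborel. t \<in> {0..T} \<longrightarrow> L' t = L t" "integrable lborel (\<lambda>t. L' t powr p)"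
    using Lp_borel_version[OF L_Lp[folded T_def] I L_nonneg[folded T_def]] by blast
  have "AE t in lborel. (t \<in> {0..T} \<longrightarrow> K' t = K t) \<and> (t \<in> {0..T} \<longrightarrow> L' t = L t)"
    using K'(3) L'(3) by eventually_elim simp
  then obtain B where B: "B \<in> null_sets lborel"
    and "{t \<in> space lborel. \<not> ((t \<in> {0..T} \<longrightarrow> K' t = K t) \<and> (t \<in> {0..T} \<longrightarrow> L' t = L t))} \<subseteq> B"
    unfolding eventually_ae_filter by blast
  then have KL: "\<And>t. t \<in> {0..T} - B \<Longrightarrow> K' t = K t \<and> L' t = L t" by auto
  have Bm [measurable]: "B \<in> sets borel" using B by auto
  define S where "S = {0..T} - B"
  have Sm [measurable]: "S \<in> sets borel" by (simp add: S_def)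
  (* The evaluation points almost surely avoid the null set B, so f may be replaced by f', which obeys
     the growth and Hoelder bounds with Borel functions at all real times. *)
  define f' where "f' t y z = (if t \<in> S then f t y z else 0)" for t y z
  have f'_hoelder: "norm (f' t y\<^sub>1 z\<^sub>1 - f' t y\<^sub>2 z\<^sub>2) \<le> L' t * (norm (y\<^sub>1 - y\<^sub>2) + norm (z\<^sub>1 - z\<^sub>2) powr \<alpha>)" for t y\<^sub>1 y\<^sub>2 z\<^sub>1 z\<^sub>2
    using A3_Hoelder[of t y\<^sub>1 z\<^sub>1 y\<^sub>2 z\<^sub>2] KL[of t] L'(1)[of t] by (auto simp: f'_def S_def T_def)
  have f'_bound: "norm (f' t 0 0) \<le> K' t" for t
    using A3_bound[of t] KL[of t] K'(1)[of t] by (auto simp: f'_def S_def T_def)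
  \<comment> \<open>Continuity in the pair of space arguments and Borel measurability in time give
    joint measurability, so the scheme can be composed with random times.\<close>
  have f'_meas: "(\<lambda>(t, w). f' t (fst w) (snd w)) \<in> borel_measurable (borel \<Otimes>\<^sub>M borel)"
  proof (rule caratheodory_measurable)
    fix w :: "(real ^ 'd) \<times> (real ^ 'd)"
    have "(\<lambda>t. f t (fst w) (snd w)) \<in> borel_measurable (restrict_space borel {0..T})"
      using A2 by (simp add: T_def)
    then have "(\<lambda>t. indicator {0..T} t *\<^sub>R f t (fst w) (snd w)) \<in> borel_measurable borel"
      by (subst (asm) borel_measurable_restrict_space_iff) auto
    then have "(\<lambda>t. if t \<in> S then indicator {0..T} t *\<^sub>R f t (fst w) (snd w) else 0) \<in> borel_measurable borel"
      by measurable
    also have "(\<lambda>t. if t \<in> S then indicator {0..T} t *\<^sub>R f t (fst w) (snd w) else 0) = (\<lambda>t. f' t (fst w) (snd w))"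
      by (auto simp: f'_def S_def)
    finally show "(\<lambda>t. f' t (fst w) (snd w)) \<in> borel_measurable borel" .
  next
    fix t :: real
    show "continuous_on UNIV (\<lambda>w. f' t (fst w) (snd w))"
      using A1[of t] by (cases "t \<in> S") (auto simp: f'_def S_def T_def split_def)
  qed
  have ac: "absolutely_continuous_on {-\<tau>..T} x" and x_init: "\<And>t. t \<in> {-\<tau>..0} \<Longrightarrow> x t = x\<^sub>0"
    and der: "AE t in lebesgue_on {0..T}. (x has_vector_derivative f t (x t) (x (t - \<tau>))) (at t)"
    using solution[unfolded dde_solution_def, folded T_def] by blast+
  \<comment> \<open>Clamping the time extends x constantly beyond both ends: continuous on the line,
    equal to \<open>x\<^sub>0\<close> for all t <= 0, and unchanged on the interval of the
    solution.\<close>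
  define X where "X t = x (max (-\<tau>) (min t T))" for t
  have X_eq: "X t = x t" if "t \<in> {-\<tau>..T}" for t using that by (auto simp: X_def)
  have X_cont: "continuous_on UNIV X"
    unfolding X_def
    by (rule continuous_on_compose2[OF absolutely_continuous_on_imp_continuous_on[OF ac]])
      (use \<tau> T in \<open>auto intro!: continuous_intros\<close>)
  have X_init: "X t = x\<^sub>0" if "t \<le> 0" for t using x_init that \<tau> T by (auto simp: X_def)
  have [measurable]: "X \<in> borel_measurable borel"
    using X_cont by (rule borel_measurable_continuous_onI)
  \<comment> \<open>Boundedness of the solution turns the growth and Hoelder bounds into an L^p
    bound for \<open>g\<close>.\<close>
  obtain R where R: "\<And>t. norm (X t) \<le> R"
  proof -
    have "compact (x ` {-\<tau>..T})"
      by (intro compact_continuous_image absolutely_continuous_on_imp_continuous_on[OF ac]) auto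
    then obtain R where "\<forall>y\<in>x ` {-\<tau>..T}. norm y \<le> R"
      by (blast dest: compact_imp_bounded bounded_iff[THEN iffD1])
    then show thesis using that[of R] \<tau> T by (auto simp: X_def)
  qed
  define g where "g t = f' t (X t) (X (t - \<tau>))" for t
  have g_meas [measurable]: "g \<in> borel_measurable borel"
  proof -
    have "(\<lambda>t. (t, (X t, X (t - \<tau>)))) \<in> measurable borel (borel \<Otimes>\<^sub>M borel)" by measurable
    from measurable_compose[OF this f'_meas] show ?thesis by (simp add: g_def[abs_def])
  qed
  have g_supp: "g t = 0" if "t \<notin> {0..T}" for t using that by (auto simp: g_def f'_def S_def)
  have g_p: "integrable lborel (\<lambda>t. norm (g t) powr p)"
  proof (rule Bochner_Integration.integrable_bound)
    define c where "c = R + R powr \<alpha>"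
    have R0: "0 \<le> R" using order_trans[OF norm_ge_zero R] .
    show "integrable lborel (\<lambda>t. 2 powr (p - 1) * (K' t powr p + c powr p * L' t powr p))"
      using K'(4) L'(4) by (intro integrable_mult_right Bochner_Integration.integrable_add)
    have "norm (g t) powr p \<le> 2 powr (p - 1) * (K' t powr p + c powr p * L' t powr p)" for t
    proof -
      have "norm (g t) \<le> norm (f' t 0 0) + norm (f' t (X t) (X (t - \<tau>)) - f' t 0 0)"
        unfolding g_def by (metis add.commute norm_triangle_sub)
      also have "\<dots> \<le> K' t + L' t * (norm (X t - 0) + norm (X (t - \<tau>) - 0) powr \<alpha>)"
        by (intro add_mono f'_bound f'_hoelder)
      also have "\<dots> \<le> K' t + L' t * c"
        unfolding c_def using R[of t] R[of "t - \<tau>"] L'(1)[of t] \<alpha>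
        by (intro add_left_mono mult_left_mono add_mono powr_mono2) auto
      finally have "norm (g t) powr p \<le> (K' t + L' t * c) powr p" using p by (intro powr_mono2) auto
      also have "\<dots> \<le> 2 powr (p - 1) * (K' t powr p + (L' t * c) powr p)"
        using p K'(1)[of t] L'(1)[of t] R0 by (intro powr_add_le) (auto simp: c_def)
      finally show ?thesis using L'(1)[of t] R0 by (simp add: powr_mult c_def mult.commute)
    qed
    then show "AE t in lborel. norm (norm (g t) powr p) \<le> norm (2 powr (p - 1) * (K' t powr p + c powr p * L' t powr p))"
      by (auto intro: order_trans[OF _ abs_ge_self])
  qed simp
  note g_q = integrable_powr_bounded_support[OF g_p g_meas _ _ g_supp]
  have g_1: "integrable lborel g"
    using g_q[of 1] p by (subst integrable_norm_iff[symmetric]) auto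
  have g_2: "integrable lborel (\<lambda>t. (norm (g t))\<^sup>2)"
    using g_q[of 2] p by (simp add: powr_numeral)
  have ftc: "X t - X s = (LINT u:{s..t}|lborel. g u)" if st: "0 \<le> s" "s \<le> t" "t \<le> real (n + 1) * \<tau>" for s t
  proof -
    \<comment> \<open>Times without the derivative form a null set, and so does \<open>B\<close>,
      where \<open>f'\<close> was set to 0. Off both, x has derivative \<open>g\<close>.\<close>
    define E where "E = {t \<in> {0..T}. \<not> (x has_vector_derivative f t (x t) (x (t - \<tau>))) (at t)}"
    have "AE t in lebesgue. t \<notin> E"
      using der by (subst (asm) AE_restrict_space_iff) (auto simp: E_def elim!: eventually_mono)
    then have "negligible E" by (simp add: negligible_iff_null_sets completion.null_sets_iff_AE)
    moreover have "negligible B" using B by (simp add: negligible_iff_null_sets null_sets_completionI)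
    ultimately have neg: "negligible (E \<union> B)" by (rule negligible_Un)
    have "(g has_integral x t - x s) {s..t}"
    proof (rule absolutely_continuous_has_integral[OF _ st(2) neg])
      show "absolutely_continuous_on {s..t} x"
        by (rule absolutely_continuous_on_subset[OF ac]) (use st \<tau> in \<open>auto simp: T_def\<close>)
      fix u assume u: "u \<in> {s..t} - (E \<union> B)"
      then have "g u = f u (x u) (x (u - \<tau>))"
        using st \<tau> by (auto simp: g_def f'_def S_def X_eq T_def)
      then show "(x has_vector_derivative g u) (at u)" using u st by (auto simp: E_def T_def)
    qed
    moreover have "(LINT u:{s..t}|lborel. g u) = integral {s..t} g"
      by (rule set_borel_integral_eq_integral) (auto simp: set_integrable_def intro!: integrable_mult_indicator g_1)
    ultimately show ?thesis using st \<tau> by (simp add: X_eq T_def integral_unique)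
  qed
  interpret E: rand_euler_error P \<tau> p \<alpha> n x\<^sub>0 f' L' X \<gamma> g
    by unfold_locales (fact g_def \<tau> p \<alpha> f'_meas L'm L'(1) L'(4) f'_hoelder X_cont X_init g_1 g_2 g_p ftc indep uniform)+
  obtain C where C: "\<And>j. j \<le> n \<Longrightarrow> 0 < C j" and bound: "\<And>j N. j \<le> n \<Longrightarrow> \<tau> \<le> real N \<Longrightarrow>
     in_Lp P p (\<lambda>\<omega>. max_grid_error f' \<tau> x\<^sub>0 X N j (\<lambda>j k. \<gamma> j k \<omega>)) \<and>
     Lp_norm P p (\<lambda>\<omega>. max_grid_error f' \<tau> x\<^sub>0 X N j (\<lambda>j k. \<gamma> j k \<omega>)) \<le> C j * (\<tau> / real N) powr (1 / 2 * \<alpha> ^ j)"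
    using E.max_grid_error_Lp by blast
  have transfer: "in_Lp P p (\<lambda>\<omega>. max_grid_error f \<tau> x\<^sub>0 x N j (\<lambda>j k. \<gamma> j k \<omega>)) \<and>
     Lp_norm P p (\<lambda>\<omega>. max_grid_error f \<tau> x\<^sub>0 x N j (\<lambda>j k. \<gamma> j k \<omega>)) \<le> C j * (\<tau> / real N) powr (1 / 2 * \<alpha> ^ j)"
    if j: "j \<le> n" and N: "\<tau> \<le> real N" for j N
  proof -
    define Z where "Z \<omega> = max_grid_error f \<tau> x\<^sub>0 x N j (\<lambda>j k. \<gamma> j k \<omega>)" for \<omega>
    define Z' where "Z' \<omega> = max_grid_error f' \<tau> x\<^sub>0 X N j (\<lambda>j k. \<gamma> j k \<omega>)" for \<omega>
    have h: "0 < \<tau> / real N" using E.h_pos[OF N] .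
    have "AE \<omega> in P. grid_time \<tau> N j' k' + \<tau> / real N * \<gamma> j' (Suc k') \<omega> \<in> S" if "j' \<le> n" "k' < N" for j' k'
    proof -
      have u: "distributed P lborel (\<gamma> j' (Suc k')) (\<lambda>u. indicator {0..1} u)" by (rule uniform) simp
      have "AE \<omega> in P. grid_time \<tau> N j' k' + \<tau> / real N * \<gamma> j' (Suc k') \<omega> \<notin> B"
        by (rule AE_uniform_affine[OF u h]) (use B in \<open>auto intro: AE_not_in\<close>)
      then show ?thesis
        using AE_uniform_mem[OF u]
      proof eventually_elim
        case (elim \<omega>)
        have "\<tau> / real N * \<gamma> j' (Suc k') \<omega> \<in> {0..\<tau> / real N}" 
          using elim h mult_nonneg_nonneg[of "\<tau> / real N" "\<gamma> j' (Suc k') \<omega>"]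
            mult_left_mono[of "\<gamma> j' (Suc k') \<omega>" 1 "\<tau> / real N"] by simp
        moreover have "0 \<le> grid_time \<tau> N j' k'" using \<tau> by (simp add: grid_time_nonneg)
        moreover have "grid_time \<tau> N j' k' + \<tau> / real N \<le> T"
          using grid_time_le[of \<tau> "Suc k'" N j' n] that \<tau> by (simp add: grid_time_Suc T_def)
        ultimately show ?case using elim by (simp add: S_def)
      qed
    qed
    \<comment> \<open>Only finitely many evaluation points occur, so one null event covers them
      all.\<close>
    then have "AE \<omega> in P. \<forall>j'\<in>{..n}. \<forall>k'\<in>{..<N}. grid_time \<tau> N j' k' + \<tau> / real N * \<gamma> j' (Suc k') \<omega> \<in> S"
      by (subst AE_finite_all; simp)+
    then have eq: "AE \<omega> in P. Z' \<omega> = Z \<omega>"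
    proof eventually_elim
      case (elim \<omega>)
      have y: "rand_euler f \<tau> x\<^sub>0 N (\<lambda>j k. \<gamma> j k \<omega>) j i = rand_euler f' \<tau> x\<^sub>0 N (\<lambda>j k. \<gamma> j k \<omega>) j i" if "i \<le> N" for i
        by (rule rand_euler_cong_rhs[OF _ that]) (use elim j in \<open>auto simp: f'_def\<close>)
      have x: "x (grid_time \<tau> N j i) = X (grid_time \<tau> N j i)" if "i \<le> N" for i
        using grid_time_le[of \<tau> i N j n] grid_time_nonneg[of \<tau> N j i] that j \<tau> by (simp add: X_eq T_def)
      show ?case
        unfolding Z_def Z'_def max_grid_error_def using x y by (intro arg_cong[where f=Max] image_cong) auto
    qed
    have Z': "Z' \<in> borel_measurable P" "integrable P (\<lambda>\<omega>. \<bar>Z' \<omega>\<bar> powr p)"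
      and le: "Lp_norm P p Z' \<le> C j * (\<tau> / real N) powr (1 / 2 * \<alpha> ^ j)"
      using bound[OF j N] by (auto simp: in_Lp_def Z'_def[abs_def])
    \<comment> \<open>\<open>Z\<close> is only known to agree almost surely with the measurable
      \<open>Z'\<close>; completeness of \<open>P\<close> makes it measurable.\<close>
    have Z [measurable]: "Z \<in> borel_measurable P" by (rule borel_measurable_cong_AE[OF Z'(1) eq])
    have eq': "AE \<omega> in P. \<bar>Z' \<omega>\<bar> powr p = \<bar>Z \<omega>\<bar> powr p" using eq by eventually_elim simp
    have "in_Lp P p Z"
      unfolding in_Lp_def using Z integrable_cong_AE_imp[OF Z'(2) _ eq'] by simp
    moreover have "Lp_norm P p Z = Lp_norm P p Z'"
      unfolding Lp_norm_def using Z'(1) eq' integral_cong_AE[of "\<lambda>\<omega>. \<bar>Z' \<omega>\<bar> powr p" P "\<lambda>\<omega>. \<bar>Z \<omega>\<bar> powr p"] by simp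
    ultimately show ?thesis using le by (simp add: Z_def[abs_def])
  qed
  have ceil: "\<tau> \<le> real N" if "\<lceil>\<tau>\<rceil> \<le> int N" for N using that by linarith
  show ?thesis
  proof (intro exI[of _ C] conjI allI impI)
    fix N j assume *: "\<alpha> = 1" "\<lceil>\<tau>\<rceil> \<le> int N" "j \<le> n"
    then show "Lp_norm P p (\<lambda>\<omega>. max_grid_error f \<tau> x\<^sub>0 x N j (\<lambda>j k. \<gamma> j k \<omega>)) \<le> C j * (\<tau> / real N) powr (1 / 2)"
      using transfer[OF *(3) ceil[OF *(2)]] by simp
  qed (use C transfer ceil in auto)
qed

end
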